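(* Let $d\ge 1$, $\Omega=[0,1]^d$, and let $0\le m\le s$. There is a constant $C>0$ depending only on $s,m,d$ such that for every $f\in\mathcal{B}^s(\Omega)$ there is an $M\le C\|f\|_{\mathcal{B}^s(\Omega)}$ such that for all integers $n\ge 1$ $$\inf_{f_n\in \Sigma_{n,M}} \|f-f_n\|_{H^m(\Omega)} \le C\, \|f\|_{\mathcal{B}^s(\Omega)}\,n^{-\frac{1}{2} - \frac{s-m}{d}}.$$
   Context: The Fourier transform is $\hat g(\xi)=\int_{\mathbb{R}^d} g(x)e^{-2\pi \mathrm{i}\,\xi\cdot x}\,dx$, and $|\cdot|$ is the Euclidean norm. For $s\ge 0$, the spectral Barron space is $$\mathcal{B}^s(\Omega)=\Big\{f:\Omega\to\mathbb{C}:\ \|f\|_{\mathcal{B}^s(\Omega)}:=\inf_{f_e|_\Omega=f}\int_{\mathbb{R}^d}(1+|\xi|)^s|\hat f_e(\xi)|\,d\xi<\infty\Big\},$$ where the infimum is over extensions $f_e\in L^1(\mathbb{R}^d)$ of $f$. For $n\ge1$, $M\geq 0$, $$\Sigma_{n,M}=\Big\{\sum_{j=1}^n a_je^{2\pi \mathrm{i}\,\theta_j\cdot x}:\ \theta_j\in\mathbb{R}^d,\ a_j\in\mathbb{C},\ \sum_{j=1}^n|a_j|\le M\Big\}.$$ $H^m(\Omega)$ is the usual $L^2$-based Sobolev space of order $m$ (the fractional, Sobolev–Slobodeckij, space if $m$ is not an integer), with $H^0=L^2$. Functions are identified when equal almost everywhere. *)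

theory Defs
  imports "HOL-Analysis.Analysis"
begin

definition unit_cube :: "(real ^ 'd) set" where
  "unit_cube = cbox 0 1"

definition fourier :: "(real ^ 'd \<Rightarrow> complex) \<Rightarrow> real ^ 'd \<Rightarrow> complex" where
  "fourier g \<xi> = (LINT x|lebesgue. g x * exp (- 2 * of_real pi * \<i> * of_real (\<xi> \<bullet> x)))"

text \<open>
  A function on \<open>\<Omega>\<close> is a total function of which only the values on \<open>\<Omega>\<close> matter, up to null sets;
  correspondingly an extension has to agree with it almost everywhere on \<open>\<Omega>\<close>.
\<close>

definition L1_extensions ::
  "(real ^ 'd) set \<Rightarrow> (real ^ 'd \<Rightarrow> complex) \<Rightarrow> (real ^ 'd \<Rightarrow> complex) set" where
  "L1_extensions \<Omega> f = {fe. integrable lebesgue fe \<and> (AE x in lebesgue. x \<in> \<Omega> \<longrightarrow> fe x = f x)}"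

definition barron_norm :: "real \<Rightarrow> (real ^ 'd) set \<Rightarrow> (real ^ 'd \<Rightarrow> complex) \<Rightarrow> ennreal" where
  "barron_norm s \<Omega> f =
     (INF fe\<in>L1_extensions \<Omega> f.
        (\<integral>\<^sup>+ \<xi>. ennreal ((1 + norm \<xi>) powr s * norm (fourier fe \<xi>)) \<partial>lebesgue))"

definition barron_space :: "real \<Rightarrow> (real ^ 'd) set \<Rightarrow> (real ^ 'd \<Rightarrow> complex) set" where
  "barron_space s \<Omega> = {f. barron_norm s \<Omega> f < \<infinity>}"

definition exp_sums :: "nat \<Rightarrow> real \<Rightarrow> (real ^ 'd \<Rightarrow> complex) set" where
  "exp_sums n M =
     {g. \<exists>(a :: nat \<Rightarrow> complex) (\<theta> :: nat \<Rightarrow> real ^ 'd). (\<Sum>j<n. norm (a j)) \<le> M \<and>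
         g = (\<lambda>x. \<Sum>j<n. a j * exp (2 * of_real pi * \<i> * of_real (\<theta> j \<bullet> x)))}"

definition partial_deriv :: "'d \<Rightarrow> (real ^ 'd \<Rightarrow> complex) \<Rightarrow> real ^ 'd \<Rightarrow> complex" where
  "partial_deriv i \<phi> x = frechet_derivative \<phi> (at x) (axis i 1)"

primrec iter_partial :: "'d list \<Rightarrow> (real ^ 'd \<Rightarrow> complex) \<Rightarrow> real ^ 'd \<Rightarrow> complex" where
  "iter_partial [] \<phi> = \<phi>"
| "iter_partial (i # is) \<phi> = partial_deriv i (iter_partial is \<phi>)"

text \<open>
  A function is of class \<open>C\<^sup>\<infinity>\<close> iff its iterated partial derivatives of all orders exist and are
  differentiable.
\<close>

definition test_functions :: "(real ^ 'd) set \<Rightarrow> (real ^ 'd \<Rightarrow> complex) set" where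
  "test_functions U =
     {\<phi>. (\<forall>is x. iter_partial is \<phi> differentiable (at x)) \<and>
         compact (closure {x. \<phi> x \<noteq> 0}) \<and> closure {x. \<phi> x \<noteq> 0} \<subseteq> U}"

text \<open>
  A multi-index is a function \<open>\<alpha> :: 'd \<Rightarrow> nat\<close> of order \<open>\<Sum>i\<in>UNIV. \<alpha> i\<close>.  For a test function \<open>\<phi>\<close>,
  the derivative of multi-index \<open>\<alpha>\<close> is \<open>iter_partial is \<phi>\<close> for any list \<open>is\<close> in which each \<open>i\<close>
  occurs \<open>\<alpha> i\<close> times: the order of differentiation is irrelevant.
\<close>

definition has_weak_deriv ::
  "(real ^ 'd) set \<Rightarrow> ('d \<Rightarrow> nat) \<Rightarrow> (real ^ 'd \<Rightarrow> complex) \<Rightarrow> (real ^ 'd \<Rightarrow> complex) \<Rightarrow> bool" where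
  "has_weak_deriv U \<alpha> u v \<longleftrightarrow>
     (\<forall>K. compact K \<and> K \<subseteq> U \<longrightarrow> u absolutely_integrable_on K \<and> v absolutely_integrable_on K) \<and>
     (\<forall>\<phi>\<in>test_functions U. \<forall>is. (\<forall>i. count_list is i = \<alpha> i) \<longrightarrow>
        (LINT x:U|lebesgue. u x * iter_partial is \<phi> x) =
        (-1) ^ (\<Sum>i\<in>UNIV. \<alpha> i) * (LINT x:U|lebesgue. v x * \<phi> x))"

definition L2_norm_sq :: "(real ^ 'd) set \<Rightarrow> (real ^ 'd \<Rightarrow> complex) \<Rightarrow> ennreal" where
  "L2_norm_sq U v = (\<integral>\<^sup>+ x\<in>U. ennreal ((norm (v x))\<^sup>2) \<partial>lebesgue)"

definition slobodeckij_sq :: "real \<Rightarrow> (real ^ 'd) set \<Rightarrow> (real ^ 'd \<Rightarrow> complex) \<Rightarrow> ennreal" where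
  "slobodeckij_sq \<sigma> U v =
     (\<integral>\<^sup>+ x\<in>U. (\<integral>\<^sup>+ y\<in>U. ennreal ((norm (v x - v y))\<^sup>2 /
        norm (x - y) powr (real CARD('d) + 2 * \<sigma>)) \<partial>lebesgue) \<partial>lebesgue)"

definition weak_deriv_families ::
  "nat \<Rightarrow> (real ^ 'd) set \<Rightarrow> (real ^ 'd \<Rightarrow> complex) \<Rightarrow> (('d \<Rightarrow> nat) \<Rightarrow> real ^ 'd \<Rightarrow> complex) set" where
  "weak_deriv_families k U u = {D. \<forall>\<alpha>. (\<Sum>i\<in>UNIV. \<alpha> i) \<le> k \<longrightarrow> has_weak_deriv U \<alpha> u (D \<alpha>)}"

text \<open>
  The norm of \<open>H\<^sup>m(U)\<close> for open \<open>U\<close> and \<open>m \<ge> 0\<close>.  Weak derivatives are unique up to null sets, so all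
  members of \<open>weak_deriv_families (nat \<lfloor>m\<rfloor>) U u\<close> give the same value and the infimum only selects
  it; it is \<open>\<infinity>\<close> if some weak derivative of order at most \<open>\<lfloor>m\<rfloor>\<close> does not exist.  Thus \<open>u\<close>
  belongs to \<open>H\<^sup>m(U)\<close> iff the value is finite.
\<close>

definition sobolev_norm_sq :: "real \<Rightarrow> (real ^ 'd) set \<Rightarrow> (real ^ 'd \<Rightarrow> complex) \<Rightarrow> ennreal" where
  "sobolev_norm_sq m U u =
     (let k = nat \<lfloor>m\<rfloor>; \<sigma> = frac m in
      INF D\<in>weak_deriv_families k U u.
        (\<Sum>\<alpha> | (\<Sum>i\<in>UNIV. \<alpha> i) \<le> k. L2_norm_sq U (D \<alpha>)) +
        (if \<sigma> = 0 then 0 else (\<Sum>\<alpha> | (\<Sum>i\<in>UNIV. \<alpha> i) = k. slobodeckij_sq \<sigma> U (D \<alpha>))))"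

definition sobolev_norm :: "real \<Rightarrow> (real ^ 'd) set \<Rightarrow> (real ^ 'd \<Rightarrow> complex) \<Rightarrow> ennreal" where
  "sobolev_norm m U u =
     (if sobolev_norm_sq m U u = \<infinity> then \<infinity> else ennreal (sqrt (enn2real (sobolev_norm_sq m U u))))"

end

theory Submission
  imports Defs "HOL-Probability.Characteristic_Functions"
begin

text \<open>
  On the cube, a function of finite Barron norm is a series of characters \<open>x \<mapsto> cis (k \<bullet> x)\<close> with
  \<open>k\<close> in the integer lattice, and its coefficients satisfy
  \<open>\<Sum>k. (1 + \<bar>k\<bar>) powr s * \<bar>a k\<bar> \<le> C * barron_norm s unit_cube f\<close>.  All approximants are
  partial sums of this one series, over suitable sets of at most \<open>n\<close> frequencies.  The moduli of
  the coefficients of a partial sum add up to at most the weighted sum above, and this is why one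
  bound \<open>M\<close> serves all \<open>n\<close>.

  The lattice makes it possible to reproduce all low frequencies exactly: a ball of radius \<open>\<rho>\<close>
  contains a continuum of frequencies, but only about \<open>\<rho> ^ d\<close> lattice points.  A single character
  of real frequency \<open>\<eta>\<close> is transferred to the lattice by a cutoff: on \<open>[0, 1]\<close> the function
  \<open>cis (\<eta> * x)\<close> agrees with \<open>\<phi> x * cis (\<eta> * x)\<close>, where \<open>\<phi>\<close> is a bump of high finite smoothness
  whose support is shorter than the period \<open>2 * pi\<close>, and the latter is the sum of its Fourier
  series.  The coefficients are \<open>b (k - \<eta>)\<close> with \<open>b\<close> a multiple of the Fourier transform of \<open>\<phi>\<close>,
  so they decay as fast as desired away from \<open>\<eta>\<close> (\<open>cis_expansion_1d\<close>, and
  \<open>cis_lattice_expansion\<close> for products of coordinates).  Inserting this into the Fourier inversion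
  formula (\<open>fourier_inversion_AE\<close>) and integrating each coefficient over all frequencies gives the
  series (\<open>lattice_representation\<close>).

  The Sobolev norm of a lattice series is at most a constant times the \<open>\<ell>\<^sup>2\<close> norm of the weighted
  coefficients \<open>(1 + \<bar>k\<bar>) powr m * \<bar>a k\<bar>\<close> (\<open>sobolev_norm_lattice_series\<close>): the cube lies in a
  period cell, where distinct characters are orthogonal, and weak derivatives act on the
  coefficients by multiplication.  The Slobodeckij seminorm becomes a square sum too after the
  substitution \<open>y = x + h\<close>, because \<open>\<integral> \<bar>cis (k \<bullet> h) - 1\<bar>\<^sup>2 / \<bar>h\<bar> powr (d + 2 * \<sigma>) dh\<close> is a
  multiple of \<open>\<bar>k\<bar> powr (2 * \<sigma>)\<close>.

  It remains to choose the frequencies.  At most half of the \<open>n\<close> terms are spent on all \<open>k\<close> with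
  \<open>1 + \<bar>k\<bar> \<le> \<rho>\<close>, where \<open>\<rho>\<close> is of order \<open>n powr (1 / d)\<close>.  For the other frequencies the
  weighted sum of order \<open>m\<close> is at most \<open>W = \<rho> powr (m - s) * A\<close>, where \<open>A\<close> bounds the one of order
  \<open>s\<close>.  The second half is spent on the largest of these weighted coefficients; what is left has
  \<open>\<ell>\<^sup>2\<close> norm at most \<open>W / sqrt (n / 2)\<close> (\<open>stechkin_selection\<close>).  The two factors are the two parts
  of the exponent \<open>- 1 / 2 - (s - m) / d\<close>.
\<close>

section \<open>Pointwise convergence of Fourier series\<close>

lemma borel_measurable_cnj [measurable (raw)]:
  "f \<in> borel_measurable M \<Longrightarrow> (\<lambda>x. cnj (f x)) \<in> borel_measurable M"
  by (rule borel_measurable_continuous_on[where f = cnj]) (auto intro: continuous_intros)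

lemma borel_measurable_cis [measurable (raw)]:
  "f \<in> borel_measurable M \<Longrightarrow> (\<lambda>x. cis (f x)) \<in> borel_measurable M"
  unfolding cis_conv_exp by measurable

lemma cis_sum: "cis (\<Sum>i\<in>A. f i) = (\<Prod>i\<in>A. cis (f i))"
  by (induction A rule: infinite_finite_induct) (auto simp: cis_mult[symmetric])

lemma norm_cis_diff_le: "cmod (cis s - cis t) \<le> \<bar>s - t\<bar>"
proof -
  have "cis s - cis t = cis t * (cis (s - t) - 1)" by (simp add: algebra_simps cis_mult)
  then have "cmod (cis s - cis t) = cmod (cis (s - t) - 1)" by (simp add: norm_mult)
  also have "\<dots> \<le> \<bar>s - t\<bar>"
  proof (rule abs_le_square_iff[THEN iffD2, of "cmod _", simplified])
    have "(cmod (cis (s - t) - 1))\<^sup>2 = 2 - 2 * cos (s - t)"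
      by (simp add: cmod_power2 power2_diff sin_squared_eq)
    also have "\<dots> = (2 * sin ((s - t) / 2))\<^sup>2"
      using cos_double_sin[of "(s - t) / 2"]
      by (simp only: power_mult_distrib nonzero_mult_div_cancel_left times_divide_eq_right) simp
    also have "\<dots> \<le> (s - t)\<^sup>2"
      using abs_sin_x_le_abs_x[of "(s - t) / 2"] by (intro abs_le_square_iff[THEN iffD1]) (simp add: abs_mult)
    finally show "(cmod (cis (s - t) - 1))\<^sup>2 \<le> (s - t)\<^sup>2" .
  qed
  finally show ?thesis .
qed

lemma integrable_bounded_finite_measure:
  fixes f :: "'a \<Rightarrow> complex"
  assumes "finite_measure M" "f \<in> borel_measurable M" "\<And>x. x \<in> space M \<Longrightarrow> norm (f x) \<le> B"
  shows "integrable M f"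
  using assms by (intro finite_measure.integrable_const_bound[where B=B]) auto

lemma norm_sum_orthogonal:
  fixes e :: "'k \<Rightarrow> 'a \<Rightarrow> complex"
  assumes M: "finite_measure M"
    and [measurable]: "\<And>k. e k \<in> borel_measurable M"
    and bnd: "\<And>k x. x \<in> space M \<Longrightarrow> norm (e k x) \<le> 1"
    and orth: "\<And>k l. (\<integral>x. e k x * cnj (e l x) \<partial>M) = (if k = l then of_real c else 0)"
    and F: "finite F"
  shows "(\<integral>x. (cmod (\<Sum>k\<in>F. B k * e k x))\<^sup>2 \<partial>M) = c * (\<Sum>k\<in>F. (cmod (B k))\<^sup>2)"
proof -
  have int: "integrable M (\<lambda>x. e k x * cnj (e l x))" for k l
    by (rule integrable_bounded_finite_measure[OF M, of _ 1])
       (auto simp: norm_mult intro!: mult_le_one bnd)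
  have "complex_of_real (\<integral>x. (cmod (\<Sum>k\<in>F. B k * e k x))\<^sup>2 \<partial>M)
      = (\<integral>x. complex_of_real ((cmod (\<Sum>k\<in>F. B k * e k x))\<^sup>2) \<partial>M)"
    by (simp del: of_real_power)
  also have "\<dots> = (\<integral>x. (\<Sum>k\<in>F. \<Sum>l\<in>F. (B k * cnj (B l)) * (e k x * cnj (e l x))) \<partial>M)"
    by (intro Bochner_Integration.integral_cong refl, subst complex_norm_square)
       (simp add: sum_product cnj_sum algebra_simps)
  also have "\<dots> = (\<Sum>k\<in>F. \<Sum>l\<in>F. (B k * cnj (B l)) * (if k = l then of_real c else 0))"
    by (simp add: int orth)
  also have "\<dots> = (\<Sum>k\<in>F. of_real (c * (cmod (B k))\<^sup>2))"
  proof (intro sum.cong refl)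
    fix k assume k: "k \<in> F"
    have "(\<Sum>l\<in>F. (B k * cnj (B l)) * (if k = l then of_real c else 0)) = (\<Sum>l\<in>F. if k = l then (B k * cnj (B k)) * of_real c else 0)"
      by (intro sum.cong) auto
    also have "\<dots> = of_real (c * (cmod (B k))\<^sup>2)" using k F by (simp add: complex_norm_square[symmetric])
    finally show "(\<Sum>l\<in>F. (B k * cnj (B l)) * (if k = l then of_real c else 0)) = of_real (c * (cmod (B k))\<^sup>2)" .
  qed
  also have "\<dots> = of_real (c * (\<Sum>k\<in>F. (cmod (B k))\<^sup>2))" by (simp add: sum_distrib_left)
  finally show ?thesis by (simp only: of_real_eq_iff)
qed

text \<open>
  The square integral of \<open>G\<close> minus its projection \<open>S\<close> to the span of the \<open>e k\<close> is nonnegative; by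
  orthogonality it is the difference of the two sides, divided by \<open>c\<close>.
\<close>

lemma bessel_inequality:
  fixes e :: "'k \<Rightarrow> 'a \<Rightarrow> complex"
  assumes M: "finite_measure M"
    and [measurable]: "\<And>k. e k \<in> borel_measurable M"
    and bnd: "\<And>k x. x \<in> space M \<Longrightarrow> norm (e k x) \<le> 1"
    and orth: "\<And>k l. (\<integral>x. e k x * cnj (e l x) \<partial>M) = (if k = l then of_real c else 0)"
    and c: "c > 0"
    and [measurable]: "G \<in> borel_measurable M" and G: "\<And>x. x \<in> space M \<Longrightarrow> norm (G x) \<le> K"
    and F: "finite F"
  shows "(\<Sum>k\<in>F. (cmod (\<integral>x. G x * cnj (e k x) \<partial>M))\<^sup>2) \<le> c * (\<integral>x. (cmod (G x))\<^sup>2 \<partial>M)"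
proof (cases "space M = {}")
  case True
  then show ?thesis by (simp add: Bochner_Integration.integral_empty)
next
  case False
  then have K: "K \<ge> 0" using G norm_ge_zero order_trans by blast
  define g where "g k = (\<integral>x. G x * cnj (e k x) \<partial>M)" for k
  \<comment> \<open>The orthogonal projection of \<open>G\<close>; the \<open>e k\<close> have square norm \<open>c\<close>.\<close>
  define S where "S x = (\<Sum>k\<in>F. (g k / of_real c) * e k x)" for x
  have [measurable]: "S \<in> borel_measurable M" unfolding S_def by measurable
  have intGe: "integrable M (\<lambda>x. G x * cnj (e k x))" for k
    by (rule integrable_bounded_finite_measure[OF M, of _ "K * 1"])
       (auto simp: norm_mult simp del: mult_1_right intro!: mult_mono bnd G K)
  have intGG: "integrable M (\<lambda>x. (cmod (G x))\<^sup>2)"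
    by (rule finite_measure.integrable_const_bound[OF M, of _ "K\<^sup>2"]) (auto intro!: power_mono G)
  have SB: "norm (S x) \<le> (\<Sum>k\<in>F. cmod (g k / of_real c))" if "x \<in> space M" for x
    unfolding S_def
    by (rule sum_norm_le, subst norm_mult) (intro mult_left_le bnd that norm_ge_zero)
  have intSS: "integrable M (\<lambda>x. (cmod (S x))\<^sup>2)"
    by (rule finite_measure.integrable_const_bound[OF M, of _ "(\<Sum>k\<in>F. cmod (g k / of_real c))\<^sup>2"])
       (auto intro!: power_mono SB)
  have SGeq: "G x * cnj (S x) = (\<Sum>k\<in>F. cnj (g k) / of_real c * (G x * cnj (e k x)))" for x
    by (simp add: S_def sum_distrib_left cnj_sum algebra_simps)
  have intGS: "integrable M (\<lambda>x. G x * cnj (S x))"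
    unfolding SGeq by (intro Bochner_Integration.integrable_sum integrable_mult_right intGe)
  have GS: "(\<integral>x. G x * cnj (S x) \<partial>M) = of_real ((\<Sum>k\<in>F. (cmod (g k))\<^sup>2) / c)"
    unfolding SGeq
    by (simp add: intGe g_def[symmetric] sum_divide_distrib of_real_divide complex_norm_square mult.commute del: of_real_power)
  have SS: "(\<integral>x. (cmod (S x))\<^sup>2 \<partial>M) = (\<Sum>k\<in>F. (cmod (g k))\<^sup>2) / c"
    unfolding S_def
    by (subst norm_sum_orthogonal[OF M _ bnd orth F])
       (use c in \<open>auto simp: norm_divide power_divide sum_divide_distrib sum_distrib_left power2_eq_square field_simps\<close>)
  have "0 \<le> (\<integral>x. (cmod (G x - S x))\<^sup>2 \<partial>M)" by simp
  also have "\<dots> = (\<integral>x. (cmod (G x))\<^sup>2 + (cmod (S x))\<^sup>2 - 2 * Re (G x * cnj (S x)) \<partial>M)"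
    by (intro Bochner_Integration.integral_cong refl)
       (unfold cmod_power2, simp add: algebra_simps power2_eq_square)
  also have "\<dots> = (\<integral>x. (cmod (G x))\<^sup>2 \<partial>M) + (\<Sum>k\<in>F. (cmod (g k))\<^sup>2) / c - 2 * ((\<Sum>k\<in>F. (cmod (g k))\<^sup>2) / c)"
    using intGG intSS integrable_Re[OF intGS] integral_Re[OF intGS] GS SS
    by (simp del: of_real_divide times_complex.sel)
  finally show ?thesis using c by (simp add: g_def field_simps)
qed

abbreviation circle_measure :: "real measure" where
  "circle_measure \<equiv> restrict_space lborel {-pi..pi}"

lemma finite_measure_circle: "finite_measure circle_measure"
  by (rule finite_measureI) (simp add: emeasure_restrict_space)

lemma integral_cis_interval:
  assumes "u \<noteq> 0" "a \<le> b"
  shows "(\<integral>t\<in>{a..b}. cis (u * t) \<partial>lborel) = (cis (u * b) - cis (u * a)) / (\<i> * of_real u)"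
proof -
  have "(\<integral>t. indicator {a..b} t *\<^sub>R cis (u * t) \<partial>lborel) = cis (u * b) / (\<i> * of_real u) - cis (u * a) / (\<i> * of_real u)"
  proof (rule integral_FTC_Icc)
    fix x
    show "((\<lambda>x. cis (u * x) / (\<i> * of_real u)) has_vector_derivative cis (u * x)) (at x within {a..b})"
    proof -
      have "((\<lambda>z. exp (\<i> * of_real u * z) / (\<i> * of_real u)) has_field_derivative exp (\<i> * of_real u * of_real x)) (at (of_real x))"
        using assms(1) by (auto intro!: derivative_eq_intros)
      then have "((\<lambda>x. exp (\<i> * of_real u * of_real x) / (\<i> * of_real u)) has_vector_derivative exp (\<i> * of_real u * of_real x)) (at x)"
        by (rule has_vector_derivative_real_field)
      then show ?thesis by (simp add: cis_conv_exp mult.assoc has_vector_derivative_at_within)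
    qed
  qed (use assms in \<open>auto simp: cis_conv_exp intro!: continuous_intros\<close>)
  then show ?thesis by (simp add: set_lebesgue_integral_def diff_divide_distrib)
qed

lemma circle_orthogonal:
  fixes k l :: int
  shows "(\<integral>t. cis (of_int k * t) * cnj (cis (of_int l * t)) \<partial>circle_measure) = (if k = l then of_real (2 * pi) else 0)"
proof -
  have *: "cis (of_int k * t) * cnj (cis (of_int l * t)) = cis (of_int (k - l) * t)" for t
    by (simp add: cis_cnj cis_mult algebra_simps)
  show ?thesis
  proof (cases "k = l")
    case True
    then show ?thesis unfolding * by (simp add: scaleR_conv_of_real measure_restrict_space space_restrict_space)
  next
    case False
    have "cis (of_int (k - l) * pi) = cis (of_int (k - l) * (-pi))"
    proof -
      have "cis (of_int (k - l) * pi) = cis (of_int (k - l) * (-pi)) * cis (2 * pi * of_int (k - l))"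
        by (simp add: cis_mult algebra_simps)
      also have "cis (2 * pi * of_int (k - l)) = 1" by (rule cis_multiple_2pi) auto
      finally show ?thesis by simp
    qed
    then show ?thesis using False integral_cis_interval[of "of_int (k - l)" "-pi" pi]
      unfolding * by (simp add: integral_restrict_space set_lebesgue_integral_def)
  qed
qed

text \<open>
  Bessel's inequality makes the squares of the coefficients summable.  The injection \<open>k\<close> allows
  both directions to infinity to be treated alike.
\<close>

lemma fourier_coeff_tendsto_0:
  fixes k :: "nat \<Rightarrow> int"
  assumes k: "inj k"
    and [measurable]: "G \<in> borel_measurable circle_measure"
    and G: "\<And>t. t \<in> {-pi..pi} \<Longrightarrow> norm (G t) \<le> K"
  shows "(\<lambda>n. \<integral>t. G t * cis (- of_int (k n) * t) \<partial>circle_measure) \<longlonglongrightarrow> 0"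
proof -
  define g where "g n = (\<integral>t. G t * cnj (cis (of_int (k n) * t)) \<partial>circle_measure)" for n
  have "(\<Sum>n<N. (cmod (g n))\<^sup>2) \<le> (2 * pi) * (\<integral>x. (cmod (G x))\<^sup>2 \<partial>circle_measure)" for N
    unfolding g_def
    by (rule bessel_inequality[OF finite_measure_circle, where K = K])
       (use k G in \<open>auto simp: circle_orthogonal inj_eq space_restrict_space intro!: measurable_restrict_space1\<close>)
  then have "summable (\<lambda>n. (cmod (g n))\<^sup>2)"
    by (intro bounded_imp_summable[of _ "(2 * pi) * (\<integral>x. (cmod (G x))\<^sup>2 \<partial>circle_measure)"])
       (auto simp: lessThan_Suc_atMost[symmetric] simp del: sum.lessThan_Suc)
  then have "(\<lambda>n. (cmod (g n))\<^sup>2) \<longlonglongrightarrow> 0" by (rule summable_LIMSEQ_zero)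
  then have "(\<lambda>n. sqrt ((cmod (g n))\<^sup>2)) \<longlonglongrightarrow> sqrt 0" by (intro tendsto_real_sqrt)
  then have "g \<longlonglongrightarrow> 0" by (simp add: tendsto_norm_zero_iff)
  then show ?thesis by (simp add: g_def[abs_def] cis_cnj)
qed

text \<open>
  Only a linear lower bound up to the antipode matters, so the fourth-order Taylor bound of the
  cosine suffices: it gives \<open>2 - 2 * cos t \<ge> t\<^sup>2 * (1 - t\<^sup>2 / 12)\<close>, and \<open>pi\<^sup>2 < 10\<close>.
\<close>

lemma cis_minus_1_lower:
  assumes "\<bar>t\<bar> \<le> pi" shows "\<bar>t\<bar> \<le> 3 * cmod (cis t - 1)"
proof -
  have "(\<Sum>m<4. cos_coeff m * t ^ m) = cos_coeff 0 + cos_coeff 1 * t + cos_coeff 2 * t\<^sup>2 + cos_coeff 3 * t ^ 3"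
    by (simp add: eval_nat_numeral)
  also have "\<dots> = 1 - t\<^sup>2 / 2" by (simp add: cos_coeff_def)
  finally have *: "(\<Sum>m<4. cos_coeff m * t ^ m) = 1 - t\<^sup>2 / 2" .
  obtain s where s: "cos t = (\<Sum>m<4. cos_coeff m * t ^ m) + (cos (s + 1/2 * real (4::nat) * pi) / fact 4) * t ^ 4"
    using Maclaurin_cos_expansion[of t 4] by blast
  have "cos (s + 1/2 * real (4::nat) * pi) / fact 4 * t ^ 4 \<le> 1 / fact 4 * t ^ 4"
    by (intro mult_right_mono divide_right_mono) auto
  then have "cos t \<le> 1 - t\<^sup>2 / 2 + t ^ 4 / 24"
    using s unfolding * by (simp add: fact_numeral)
  then have 1: "2 - 2 * cos t \<ge> t\<^sup>2 * (1 - t\<^sup>2 / 12)"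
    by (simp add: field_simps power4_eq_xxxx power2_eq_square)
  have "t\<^sup>2 \<le> (3.15)\<^sup>2"
    using assms pi_approx by (intro abs_le_square_iff[THEN iffD1]) simp
  then have "t\<^sup>2 \<le> 10" by (simp add: power2_eq_square)
  then have "t\<^sup>2 * (1 - t\<^sup>2 / 12) \<ge> t\<^sup>2 * (1/6)" by (intro mult_left_mono) auto
  moreover have "(cmod (cis t - 1))\<^sup>2 = 2 - 2 * cos t"
    by (simp add: cmod_power2 power2_diff sin_squared_eq)
  ultimately have "t\<^sup>2 \<le> (3 * cmod (cis t - 1))\<^sup>2" using 1 by (simp add: power_mult_distrib del: mult_le_cancel_left) (smt (verit) zero_le_power2)
  then show ?thesis by (metis abs_le_square_iff abs_of_nonneg norm_ge_zero mult_nonneg_nonneg zero_le_numeral)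
qed

text \<open>
  Chernoff's argument: division by \<open>cis t - 1\<close> turns \<open>H - H 0\<close> into a bounded function \<open>G\<close>, by the
  Lipschitz condition at \<open>0\<close>.  The Fourier coefficients of \<open>H - H 0\<close> are then differences of
  consecutive coefficients of \<open>G\<close>, so the symmetric partial sums telescope to two coefficients
  of \<open>G\<close>, which tend to \<open>0\<close>.
\<close>

lemma dini_fourier:
  fixes H :: "real \<Rightarrow> complex"
  assumes [measurable]: "H \<in> borel_measurable borel"
    and lip: "\<And>t. \<bar>t\<bar> \<le> pi \<Longrightarrow> norm (H t - H 0) \<le> K * \<bar>t\<bar>"
  shows "(\<lambda>N. \<Sum>k = - int N..int N. \<integral>t. H t * cis (- of_int k * t) \<partial>circle_measure) \<longlonglongrightarrow> of_real (2 * pi) * H 0"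
proof -
  have K: "K \<ge> 0" using lip[of pi] norm_ge_zero[of "H pi - H 0"] by (smt (verit) mult_neg_pos pi_gt_zero)
  define G where "G t = (H t - H 0) / (cis t - 1)" for t
  have [measurable]: "G \<in> borel_measurable borel" unfolding G_def by measurable
  have eq: "H t - H 0 = G t * (cis t - 1)" if "\<bar>t\<bar> \<le> pi" for t
    using lip[OF that] cis_minus_1_lower[OF that] by (cases "cis t = 1") (auto simp: G_def)
  have Gb: "norm (G t) \<le> 3 * K" if "\<bar>t\<bar> \<le> pi" for t
  proof (cases "cis t = 1")
    case True then show ?thesis using K by (simp add: G_def)
  next
    case False
    have "norm (H t - H 0) \<le> K * (3 * cmod (cis t - 1))"
      using lip[OF that] cis_minus_1_lower[OF that] K by (meson mult_left_mono order_trans)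
    then show ?thesis using False by (simp add: G_def norm_divide field_simps)
  qed
  define g where "g k = (\<integral>t. G t * cis (- of_int k * t) \<partial>circle_measure)" for k :: int
  have int: "integrable circle_measure (\<lambda>t. G t * cis (u * t))" for u
    by (rule integrable_bounded_finite_measure[OF finite_measure_circle, of _ "3 * K"])
       (use Gb in \<open>auto simp: norm_mult space_restrict_space intro!: measurable_restrict_space1\<close>)
  have intH: "integrable circle_measure (\<lambda>t. (H t - H 0) * cis (u * t))" for u
    by (rule integrable_bounded_finite_measure[OF finite_measure_circle, of _ "K * pi * 1"])
       (use lip K in \<open>auto simp: norm_mult space_restrict_space intro!: measurable_restrict_space1 order_trans[OF lip] mult_left_mono\<close>)
  have intc: "integrable circle_measure (\<lambda>t. c * cis (u * t))" for u c
    by (rule integrable_bounded_finite_measure[OF finite_measure_circle, of _ "norm c"])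
       (auto simp: norm_mult intro!: measurable_restrict_space1)
  have step: "(\<integral>t. H t * cis (- of_int k * t) \<partial>circle_measure) = (g (k - 1) - g k) + (if k = 0 then of_real (2 * pi) * H 0 else 0)" for k
  proof -
    have "(\<integral>t. H t * cis (- of_int k * t) \<partial>circle_measure)
       = (\<integral>t. (H t - H 0) * cis (- of_int k * t) + H 0 * cis (- of_int k * t) \<partial>circle_measure)"
      by (simp add: algebra_simps)
    also have "\<dots> = (\<integral>t. (H t - H 0) * cis (- of_int k * t) \<partial>circle_measure) + (\<integral>t. H 0 * cis (- of_int k * t) \<partial>circle_measure)"
      by (intro Bochner_Integration.integral_add intH intc)
    also have "(\<integral>t. (H t - H 0) * cis (- of_int k * t) \<partial>circle_measure)
      = (\<integral>t. G t * cis (- of_int (k - 1) * t) - G t * cis (- of_int k * t) \<partial>circle_measure)"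
    proof (intro Bochner_Integration.integral_cong refl)
      fix t assume "t \<in> space circle_measure"
      then have "\<bar>t\<bar> \<le> pi" by (auto simp: space_restrict_space)
      moreover have "cis (- of_int (k - 1) * t) = cis t * cis (- of_int k * t)" by (simp add: cis_mult algebra_simps)
      ultimately show "(H t - H 0) * cis (- of_int k * t) = G t * cis (- of_int (k - 1) * t) - G t * cis (- of_int k * t)"
        by (simp add: eq algebra_simps)
    qed
    also have "\<dots> = g (k - 1) - g k" unfolding g_def by (intro Bochner_Integration.integral_diff int)
    also have "(\<integral>t. H 0 * cis (- of_int k * t) \<partial>circle_measure) = (if k = 0 then of_real (2 * pi) * H 0 else 0)"
      using circle_orthogonal[of 0 k] by (simp add: cis_cnj)
    finally show ?thesis .
  qed
  have sum: "(\<Sum>k = - int N..int N. \<integral>t. H t * cis (- of_int k * t) \<partial>circle_measure) = g (- int N - 1) - g (int N) + of_real (2 * pi) * H 0" for N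
  proof (induction N)
    case 0 then show ?case by (simp add: step[of 0, simplified])
  next
    case (Suc N)
    define f where "f k = (\<integral>t. H t * cis (- of_int k * t) \<partial>circle_measure)" for k :: int
    have "{- int (Suc N)..int (Suc N)} = insert (- int (Suc N)) (insert (int (Suc N)) {- int N..int N})" by auto
    then have "sum f {- int (Suc N)..int (Suc N)} = f (- int (Suc N)) + (f (int (Suc N)) + sum f {- int N..int N})"
      by (simp only:) simp
    moreover have "f (int (Suc N)) = g (int N) - g (int (Suc N))"
      using step[of "int (Suc N)"] by (simp add: f_def)
    moreover have "f (- int (Suc N)) = g (- int (Suc N) - 1) - g (- int (Suc N))"
      unfolding f_def step by simp
    moreover have "g (- int (Suc N)) = g (- int N - 1)" by (rule arg_cong[of _ _ g]) simp
    moreover have "sum f {- int N..int N} = g (- int N - 1) - g (int N) + of_real (2 * pi) * H 0"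
      using Suc by (simp add: f_def[abs_def])
    ultimately have "sum f {- int (Suc N)..int (Suc N)} = g (- int (Suc N) - 1) - g (int (Suc N)) + of_real (2 * pi) * H 0"
      by (simp only:) simp
    then show ?case by (simp only: f_def[abs_def])
  qed
  have "(\<lambda>N. g (- int N - 1)) \<longlonglongrightarrow> 0" "(\<lambda>N. g (int N)) \<longlonglongrightarrow> 0"
    unfolding g_def by (rule fourier_coeff_tendsto_0[of _ _ "3 * K"]; use Gb in \<open>auto simp: inj_def intro!: measurable_restrict_space1\<close>)+
  then have "(\<lambda>N. g (- int N - 1) - g (int N) + of_real (2 * pi) * H 0) \<longlonglongrightarrow> 0 - 0 + of_real (2 * pi) * H 0"
    by (intro tendsto_intros)
  then show ?thesis unfolding sum by simp
qed

section \<open>Characters expanded over the integers\<close>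

lemma summable_inverse_squares: "summable (\<lambda>n. 1 / (1 + real n)\<^sup>2)"
  using inverse_power_summable[of 2, where 'a=real] summable_Suc_iff[of "\<lambda>n. inverse (real n ^ 2)"]
  by (simp add: field_simps add.commute)

text \<open>
  The bound must not depend on the shift \<open>u\<close>, so \<open>u\<close> is replaced by its integer part at the cost
  of a factor \<open>4\<close>, and the integers on either side of it are compared with the natural numbers.
\<close>

lemma shifted_inverse_squares:
  obtains C where "C \<ge> 0" "\<And>u F. finite F \<Longrightarrow> (\<Sum>k\<in>F. 1 / (1 + \<bar>of_int k - u\<bar>)\<^sup>2) \<le> (C :: real)"
proof -
  define h where "h n = 4 / (1 + real n)\<^sup>2" for n
  have h0: "h n \<ge> 0" for n by (simp add: h_def)
  have sm: "summable h" unfolding h_def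
    using summable_mult[OF summable_inverse_squares, of 4] by simp
  show ?thesis
  proof (rule that[of "2 * suminf h"])
    show "2 * suminf h \<ge> 0" using suminf_nonneg[OF sm h0] by simp
    fix u :: real and F :: "int set" assume F: "finite F"
    define m where "m = \<lfloor>u\<rfloor>"
    have bnd: "1 / (1 + \<bar>of_int k - u\<bar>)\<^sup>2 \<le> h (nat \<bar>k - m\<bar>)" for k
    proof -
      have "\<bar>u - of_int m\<bar> \<le> 1" unfolding m_def by linarith
      then have "1 + \<bar>of_int (k - m)\<bar> \<le> 2 * (1 + \<bar>of_int k - u\<bar>)"
        using abs_triangle_ineq[of "of_int k - u" "u - of_int m"] abs_ge_zero[of "of_int k - u"]
        unfolding of_int_diff by (simp del: abs_ge_zero)
      then have "1 / (1 + \<bar>of_int k - u\<bar>) \<le> 2 / (1 + \<bar>of_int (k - m)\<bar>)" by (simp add: field_simps)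
      then have "(1 / (1 + \<bar>of_int k - u\<bar>))\<^sup>2 \<le> (2 / (1 + \<bar>of_int (k - m)\<bar>))\<^sup>2" by (intro power_mono) auto
      then show ?thesis by (simp add: h_def power_divide)
    qed
    have half: "(\<Sum>k\<in>A. h (nat \<bar>k - m\<bar>)) \<le> suminf h" if "finite A" "inj_on (\<lambda>k. nat \<bar>k - m\<bar>) A" for A
    proof -
      have "(\<Sum>k\<in>A. h (nat \<bar>k - m\<bar>)) = sum h ((\<lambda>k. nat \<bar>k - m\<bar>) ` A)"
        using that by (simp add: sum.reindex)
      also have "\<dots> \<le> suminf h" using that by (intro sum_le_suminf sm) (auto simp: h0)
      finally show ?thesis .
    qed
    have "(\<Sum>k\<in>F. 1 / (1 + \<bar>of_int k - u\<bar>)\<^sup>2) \<le> (\<Sum>k\<in>F. h (nat \<bar>k - m\<bar>))"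
      by (intro sum_mono bnd)
    also have "\<dots> = (\<Sum>k\<in>F \<inter> {m..}. h (nat \<bar>k - m\<bar>)) + (\<Sum>k\<in>F - {m..}. h (nat \<bar>k - m\<bar>))"
      using F by (rule sum.Int_Diff)
    also have "\<dots> \<le> suminf h + suminf h"
      using F by (intro add_mono half) (auto simp: inj_on_def)
    finally show "(\<Sum>k\<in>F. 1 / (1 + \<bar>of_int k - u\<bar>)\<^sup>2) \<le> 2 * suminf h" by simp
  qed
qed

text \<open>
  Averaging over an interval of length \<open>2 * \<delta>\<close> multiplies a Fourier transform by this factor,
  which gains one order of decay.
\<close>

lemma average_cis_decay:
  assumes "\<delta> > 0"
  shows "(1 + \<bar>u\<bar>) * cmod ((\<integral>v\<in>{-\<delta>..\<delta>}. cis (u * v) \<partial>lborel) / of_real (2 * \<delta>)) \<le> 1 + 1 / \<delta>"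
proof -
  define I where "I = (\<integral>v\<in>{-\<delta>..\<delta>}. cis (u * v) \<partial>lborel)"
  have "cmod I \<le> (\<integral>v\<in>{-\<delta>..\<delta>}. 1 \<partial>lborel)"
    unfolding I_def set_lebesgue_integral_def
    by (rule order_trans[OF integral_norm_bound]) (auto intro!: eq_refl Bochner_Integration.integral_cong)
  also have "\<dots> = 2 * \<delta>" using assms by (simp add: set_lebesgue_integral_def)
  finally have 1: "cmod I \<le> 2 * \<delta>" .
  have 2: "\<bar>u\<bar> * cmod I \<le> 2"
  proof (cases "u = 0")
    case False
    then have "I = (cis (u * \<delta>) - cis (u * -\<delta>)) / (\<i> * of_real u)"
      unfolding I_def using assms by (intro integral_cis_interval) auto
    then have "\<bar>u\<bar> * cmod I = cmod (cis (u * \<delta>) - cis (u * -\<delta>))"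
      using False by (simp add: norm_divide norm_mult)
    also have "\<dots> \<le> 2" by (rule order_trans[OF norm_triangle_ineq4]) simp
    finally show ?thesis .
  qed simp
  have "(1 + \<bar>u\<bar>) * cmod (I / of_real (2 * \<delta>)) = (cmod I + \<bar>u\<bar> * cmod I) / (2 * \<delta>)"
    using assms by (simp add: norm_divide field_simps)
  also have "\<dots> \<le> (2 * \<delta> + 2) / (2 * \<delta>)" using assms 1 2 by (intro divide_right_mono add_mono) auto
  also have "\<dots> = 1 + 1 / \<delta>" using assms by (simp add: field_simps)
  finally show ?thesis unfolding I_def .
qed

lemma integrable_compact_support:
  fixes f :: "'a::euclidean_space \<Rightarrow> complex"
  assumes [measurable]: "f \<in> borel_measurable borel" and B: "\<And>x. norm (f x) \<le> B"
    and S: "\<And>x. x \<notin> cbox a b \<Longrightarrow> f x = 0"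
  shows "integrable lborel f"
proof (rule Bochner_Integration.integrable_bound[where f = "\<lambda>x. indicator (cbox a b) x *\<^sub>R B"])
  have "0 \<le> B" using B[of undefined] norm_ge_zero order_trans by blast
  then show "AE x in lborel. norm (f x) \<le> norm (indicator (cbox a b) x *\<^sub>R B)"
    using B S by (auto simp: indicator_def)
  show "integrable lborel (\<lambda>x. indicator (cbox a b) x *\<^sub>R B)"
    by (intro integrable_scaleR_left integrable_real_indicator) (use emeasure_bounded_finite[OF bounded_cbox, of a b] in auto)
qed simp

text \<open>
  Fubini's theorem, where compact support makes the double integral absolutely convergent.
\<close>

lemma bump_average:
  fixes \<phi> :: "real \<Rightarrow> real"
  assumes [measurable]: "\<phi> \<in> borel_measurable borel" and B: "\<And>x. \<bar>\<phi> x\<bar> \<le> B"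
    and S: "\<And>x. x \<notin> {a..b} \<Longrightarrow> \<phi> x = 0" and \<delta>: "\<delta> > 0"
  defines "\<psi> \<equiv> \<lambda>x. (\<integral>v\<in>{-\<delta>..\<delta>}. \<phi> (x + v) \<partial>lborel) / (2 * \<delta>)"
  shows "(\<integral>x. \<psi> x * cis (- u * x) \<partial>lborel)
    = ((\<integral>v\<in>{-\<delta>..\<delta>}. cis (u * v) \<partial>lborel) / of_real (2 * \<delta>)) * (\<integral>x. \<phi> x * cis (- u * x) \<partial>lborel)"
proof -
  define f where "f x v = of_real (indicator {-\<delta>..\<delta>} v * \<phi> (x + v) / (2 * \<delta>)) * cis (- u * x)" for x v :: real
  have fb: "norm (f x v) \<le> B / (2 * \<delta>)" for x v
    using B[of "x + v"] \<delta> unfolding f_def norm_mult norm_of_real norm_cis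
    by (auto simp: indicator_def intro!: divide_right_mono intro: order_trans[OF abs_ge_zero])
  have int: "integrable (lborel \<Otimes>\<^sub>M lborel) (case_prod f)"
    unfolding lborel_prod
  proof (rule integrable_compact_support[where B = "B / (2 * \<delta>)" and a = "(a - \<delta>, -\<delta>)" and b = "(b + \<delta>, \<delta>)"])
    show "case_prod f \<in> borel_measurable borel"
      unfolding f_def borel_prod[symmetric] by measurable
    show "norm (case_prod f x) \<le> B / (2 * \<delta>)" for x using fb by (auto split: prod.split)
    show "case_prod f x = 0" if "x \<notin> cbox (a - \<delta>, - \<delta>) (b + \<delta>, \<delta>)" for x
    proof -
      obtain p q where x: "x = (p, q)" by (cases x)
      have "q \<notin> {-\<delta>..\<delta>} \<or> p + q \<notin> {a..b}" using that unfolding x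
        by (auto simp: cbox_Pair_eq)
      then show ?thesis using S[of "p + q"] by (auto simp: x f_def)
    qed
  qed
  have "(\<integral>x. \<psi> x * cis (- u * x) \<partial>lborel) = (\<integral>x. (\<integral>v. f x v \<partial>lborel) \<partial>lborel)"
  proof (intro Bochner_Integration.integral_cong refl)
    fix x
    have "\<psi> x = (\<integral>v. indicator {-\<delta>..\<delta>} v * \<phi> (x + v) / (2 * \<delta>) \<partial>lborel)"
      by (simp add: \<psi>_def set_lebesgue_integral_def)
    then have "complex_of_real (\<psi> x) = (\<integral>v. of_real (indicator {-\<delta>..\<delta>} v * \<phi> (x + v) / (2 * \<delta>)) \<partial>lborel)"
      by (simp only: integral_complex_of_real)
    then show "\<psi> x * cis (- u * x) = (\<integral>v. f x v \<partial>lborel)" by (simp add: f_def)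
  qed
  also have "\<dots> = (\<integral>v. (\<integral>x. f x v \<partial>lborel) \<partial>lborel)"
    using lborel_pair.Fubini_integral[OF int] by simp
  also have "\<dots> = (\<integral>v. (indicator {-\<delta>..\<delta>} v *\<^sub>R cis (u * v) / of_real (2 * \<delta>)) * (\<integral>x. \<phi> x * cis (- u * x) \<partial>lborel) \<partial>lborel)"
  proof (intro Bochner_Integration.integral_cong refl)
    fix v
    have "(\<integral>x. f x v \<partial>lborel) = (\<integral>x. (indicator {-\<delta>..\<delta>} v *\<^sub>R cis (u * v) / of_real (2 * \<delta>)) * (\<phi> (v + x) * cis (- u * (v + x))) \<partial>lborel)"
      by (intro Bochner_Integration.integral_cong refl)
         (auto simp: f_def indicator_def cis_mult scaleR_conv_of_real algebra_simps cis_divide[symmetric])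
    also have "\<dots> = (indicator {-\<delta>..\<delta>} v *\<^sub>R cis (u * v) / of_real (2 * \<delta>)) * (\<integral>x. \<phi> (v + x) * cis (- u * (v + x)) \<partial>lborel)"
      by simp
    also have "(\<integral>x. \<phi> (v + x) * cis (- u * (v + x)) \<partial>lborel) = (\<integral>x. \<phi> x * cis (- u * x) \<partial>lborel)"
      using lborel_integral_real_affine[of 1 "\<lambda>x. \<phi> x * cis (- u * x)" v] by simp
    finally show "(\<integral>x. f x v \<partial>lborel) = (indicator {-\<delta>..\<delta>} v *\<^sub>R cis (u * v) / of_real (2 * \<delta>)) * (\<integral>x. \<phi> x * cis (- u * x) \<partial>lborel)" .
  qed
  also have "\<dots> = ((\<integral>v\<in>{-\<delta>..\<delta>}. cis (u * v) \<partial>lborel) / of_real (2 * \<delta>)) * (\<integral>x. \<phi> x * cis (- u * x) \<partial>lborel)"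
    by (simp only: integral_mult_left_zero integral_divide_zero set_lebesgue_integral_def)
  finally show ?thesis .
qed

definition line_fourier :: "(real \<Rightarrow> real) \<Rightarrow> real \<Rightarrow> complex" where
  "line_fourier \<phi> u = (\<integral>x. \<phi> x * cis (- u * x) \<partial>lborel)"

text \<open>
  Averaging over \<open>[-\<delta>, \<delta>]\<close> gains one order of decay of the Fourier transform, by
  \<open>average_cis_decay\<close>, and moves the edges of the plateau and of the support by \<open>\<delta>\<close>.  The margin
  \<open>\<rho>\<close> provides the room for this: a bump with margin \<open>\<rho>'\<close> strictly between \<open>\<rho>\<close> and \<open>1/2\<close> is
  averaged with \<open>\<delta> = \<rho>' - \<rho>\<close>.  The induction starts from a trapezoid.
\<close>

lemma bump_exists:
  assumes "0 \<le> \<rho>" "\<rho> < 1/2"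
  shows "\<exists>(\<phi> :: real \<Rightarrow> real) K C. (\<forall>x y. \<bar>\<phi> x - \<phi> y\<bar> \<le> K * \<bar>x - y\<bar>) \<and> (\<forall>x\<in>{-\<rho>..1+\<rho>}. \<phi> x = 1)
    \<and> (\<forall>x. x \<notin> {-1+\<rho>..2-\<rho>} \<longrightarrow> \<phi> x = 0) \<and> (\<forall>x. \<bar>\<phi> x\<bar> \<le> 1)
    \<and> (\<forall>u. (1 + \<bar>u\<bar>) ^ r * cmod (line_fourier \<phi> u) \<le> C)"
  using assms
proof (induction r arbitrary: \<rho>)
  case 0
  \<comment> \<open>The slope of a trapezoid that falls from \<open>1\<close> to \<open>0\<close> over a length of \<open>1 - 2 * \<rho>\<close>.\<close>
  define q where "q = 1 / (1 - 2 * \<rho>)"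
  have q: "q > 0" "(1 - 2 * \<rho>) * q = 1" using 0 by (auto simp: q_def)
  define \<phi> where "\<phi> x = max 0 (min 1 ((3/2 - \<rho> - \<bar>x - 1/2\<bar>) * q))" for x
  have lip: "\<bar>\<phi> x - \<phi> y\<bar> \<le> q * \<bar>x - y\<bar>" for x y
  proof -
    have "\<bar>\<phi> x - \<phi> y\<bar> \<le> \<bar>(3/2 - \<rho> - \<bar>x - 1/2\<bar>) * q - (3/2 - \<rho> - \<bar>y - 1/2\<bar>) * q\<bar>"
      unfolding \<phi>_def by linarith
    also have "\<dots> = \<bar>\<bar>y - 1/2\<bar> - \<bar>x - 1/2\<bar>\<bar> * q"
      using q by (simp add: left_diff_distrib[symmetric] abs_mult)
    also have "\<dots> \<le> \<bar>x - y\<bar> * q" using q by (intro mult_right_mono) linarith+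
    finally show ?thesis by (simp add: mult.commute)
  qed
  have one: "\<phi> x = 1" if "x \<in> {-\<rho>..1+\<rho>}" for x
  proof -
    have "(3/2 - \<rho> - \<bar>x - 1/2\<bar>) * q \<ge> (1 - 2 * \<rho>) * q"
      using that q by (intro mult_right_mono) auto
    then show ?thesis using q by (simp add: \<phi>_def)
  qed
  have zero: "\<phi> x = 0" if "x \<notin> {-1+\<rho>..2-\<rho>}" for x
  proof -
    have "(3/2 - \<rho> - \<bar>x - 1/2\<bar>) * q \<le> 0"
      using that q by (intro mult_nonpos_nonneg) (auto simp: abs_if)
    then show ?thesis by (simp add: \<phi>_def)
  qed
  have bnd: "\<bar>\<phi> x\<bar> \<le> 1" for x by (simp add: \<phi>_def)
  have [measurable]: "\<phi> \<in> borel_measurable borel" unfolding \<phi>_def by measurable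
  have "cmod (line_fourier \<phi> u) \<le> (\<integral>x. cmod (\<phi> x * cis (- u * x)) \<partial>lborel)" for u
    unfolding line_fourier_def by (rule integral_norm_bound)
  then have "cmod (line_fourier \<phi> u) \<le> (\<integral>x. \<bar>\<phi> x\<bar> \<partial>lborel)" for u
    by (simp add: norm_mult)
  then show ?case using lip one zero bnd
    by (intro exI[of _ \<phi>] exI[of _ q] exI[of _ "\<integral>x. \<bar>\<phi> x\<bar> \<partial>lborel"]) auto
next
  case (Suc r)
  define \<rho>' where "\<rho>' = (\<rho> + 1/2) / 2"
  have \<rho>': "0 \<le> \<rho>'" "\<rho>' < 1/2" using Suc.prems by (auto simp: \<rho>'_def)
  obtain \<phi> :: "real \<Rightarrow> real" and K C where \<phi>: "\<And>x y. \<bar>\<phi> x - \<phi> y\<bar> \<le> K * \<bar>x - y\<bar>"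
      "\<And>x. x \<in> {-\<rho>'..1+\<rho>'} \<Longrightarrow> \<phi> x = 1" "\<And>x. x \<notin> {-1+\<rho>'..2-\<rho>'} \<Longrightarrow> \<phi> x = 0" "\<And>x. \<bar>\<phi> x\<bar> \<le> 1"
      "\<And>u. (1 + \<bar>u\<bar>) ^ r * cmod (line_fourier \<phi> u) \<le> C"
    using Suc.IH[OF \<rho>'] by blast
  define \<delta> where "\<delta> = \<rho>' - \<rho>"
  have \<delta>: "\<delta> > 0" using Suc.prems by (simp add: \<delta>_def \<rho>'_def)
  have K0: "K \<ge> 0" using \<phi>(1)[of 0 1] by simp
  have "continuous_on UNIV \<phi>"
    by (rule lipschitz_on_continuous_on[of K]) (use \<phi>(1) K0 in \<open>auto simp: lipschitz_on_def dist_real_def\<close>)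
  then have [measurable]: "\<phi> \<in> borel_measurable borel" by (rule borel_measurable_continuous_onI)
  have ind: "integrable lborel (indicator {-\<delta>..\<delta>} :: real \<Rightarrow> real)" using \<delta> by simp
  define \<psi> where "\<psi> x = (\<integral>v\<in>{-\<delta>..\<delta>}. \<phi> (x + v) \<partial>lborel) / (2 * \<delta>)" for x
  have int: "set_integrable lborel {-\<delta>..\<delta>} (\<lambda>v. \<phi> (x + v))" for x
    unfolding set_integrable_def
    by (rule Bochner_Integration.integrable_bound[where f = "\<lambda>v. indicator {-\<delta>..\<delta>} v :: real"])
       (use ind in \<open>auto simp: \<phi>(4) split: split_indicator simp del: integrable_indicator_iff\<close>)
  have avg: "(\<integral>v\<in>{-\<delta>..\<delta>}. c \<partial>lborel) / (2 * \<delta>) = c" for c :: real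
    using \<delta> by (simp add: set_lebesgue_integral_def)
  have lip: "\<bar>\<psi> x - \<psi> y\<bar> \<le> K * \<bar>x - y\<bar>" for x y
  proof -
    have "\<bar>\<psi> x - \<psi> y\<bar> = \<bar>\<integral>v\<in>{-\<delta>..\<delta>}. \<phi> (x + v) - \<phi> (y + v) \<partial>lborel\<bar> / (2 * \<delta>)"
      using \<delta> int by (simp add: \<psi>_def set_integral_diff diff_divide_distrib[symmetric])
    also have "\<dots> \<le> (\<integral>v\<in>{-\<delta>..\<delta>}. K * \<bar>x - y\<bar> \<partial>lborel) / (2 * \<delta>)"
    proof (intro divide_right_mono)
      show "\<bar>\<integral>v\<in>{-\<delta>..\<delta>}. \<phi> (x + v) - \<phi> (y + v) \<partial>lborel\<bar> \<le> (\<integral>v\<in>{-\<delta>..\<delta>}. K * \<bar>x - y\<bar> \<partial>lborel)"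
        unfolding set_lebesgue_integral_def
      proof (rule order_trans[OF integral_abs_bound], rule integral_mono)
        show "integrable lborel (\<lambda>v. \<bar>indicator {-\<delta>..\<delta>} v *\<^sub>R (\<phi> (x + v) - \<phi> (y + v))\<bar>)"
          using set_integral_diff(1)[OF int int, of x y] by (auto simp: set_integrable_def)
        show "\<bar>indicator {-\<delta>..\<delta>} v *\<^sub>R (\<phi> (x + v) - \<phi> (y + v))\<bar> \<le> indicator {-\<delta>..\<delta>} v *\<^sub>R (K * \<bar>x - y\<bar>)" for v
          using \<phi>(1)[of "x + v" "y + v"] by (auto simp: indicator_def)
      qed (use \<delta> in auto)
    qed (use \<delta> in auto)
    finally show ?thesis by (simp only: avg)
  qed
  have const: "\<psi> x = c" if "\<And>v. v \<in> {-\<delta>..\<delta>} \<Longrightarrow> \<phi> (x + v) = c" for x c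
  proof -
    have "(\<integral>v\<in>{-\<delta>..\<delta>}. \<phi> (x + v) \<partial>lborel) = (\<integral>v\<in>{-\<delta>..\<delta>}. c \<partial>lborel)"
      by (rule set_lebesgue_integral_cong) (auto intro: that)
    then show ?thesis by (simp add: \<psi>_def avg)
  qed
  have one: "\<psi> x = 1" if "x \<in> {-\<rho>..1+\<rho>}" for x
    by (rule const, rule \<phi>(2)) (use that in \<open>auto simp: \<delta>_def\<close>)
  have zero: "\<psi> x = 0" if "x \<notin> {-1+\<rho>..2-\<rho>}" for x
    by (rule const, rule \<phi>(3)) (use that in \<open>auto simp: \<delta>_def\<close>)
  have bnd: "\<bar>\<psi> x\<bar> \<le> 1" for x
  proof -
    have "\<bar>\<integral>v\<in>{-\<delta>..\<delta>}. \<phi> (x + v) \<partial>lborel\<bar> \<le> (\<integral>v\<in>{-\<delta>..\<delta>}. 1 \<partial>lborel)"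
      unfolding set_lebesgue_integral_def
    proof (rule order_trans[OF integral_abs_bound], rule integral_mono)
      show "integrable lborel (\<lambda>v. \<bar>indicator {-\<delta>..\<delta>} v *\<^sub>R \<phi> (x + v)\<bar>)"
        using int[of x] by (auto simp: set_integrable_def)
      show "integrable lborel (\<lambda>v. indicator {-\<delta>..\<delta>} v *\<^sub>R (1::real))"
        using ind by (simp only: real_scaleR_def mult_1_right)
      show "\<bar>indicator {-\<delta>..\<delta>} v *\<^sub>R \<phi> (x + v)\<bar> \<le> indicator {-\<delta>..\<delta>} v *\<^sub>R 1" for v
        by (simp add: \<phi>(4) indicator_def)
    qed
    then have "\<bar>\<integral>v\<in>{-\<delta>..\<delta>}. \<phi> (x + v) \<partial>lborel\<bar> / (2 * \<delta>) \<le> (\<integral>v\<in>{-\<delta>..\<delta>}. 1 \<partial>lborel) / (2 * \<delta>)"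
      using \<delta> by (intro divide_right_mono) auto
    then show ?thesis unfolding avg using \<delta> by (simp add: \<psi>_def)
  qed
  have decay: "(1 + \<bar>u\<bar>) ^ Suc r * cmod (line_fourier \<psi> u) \<le> (1 + 1 / \<delta>) * C" for u
  proof -
    have eq: "line_fourier \<psi> u
      = ((\<integral>v\<in>{-\<delta>..\<delta>}. cis (u * v) \<partial>lborel) / of_real (2 * \<delta>)) * line_fourier \<phi> u"
      unfolding \<psi>_def line_fourier_def by (rule bump_average[of \<phi> 1]) (use \<phi> \<delta> in auto)
    have "(1 + \<bar>u\<bar>) ^ Suc r * cmod (line_fourier \<psi> u)
      = ((1 + \<bar>u\<bar>) * cmod ((\<integral>v\<in>{-\<delta>..\<delta>}. cis (u * v) \<partial>lborel) / of_real (2 * \<delta>))) *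
        ((1 + \<bar>u\<bar>) ^ r * cmod (line_fourier \<phi> u))"
      unfolding eq norm_mult by (simp add: mult_ac)
    also have "\<dots> \<le> (1 + 1 / \<delta>) * C"
      using \<delta> by (intro mult_mono average_cis_decay \<phi>(5)) auto
    finally show ?thesis .
  qed
  show ?case using lip one zero bnd decay by blast
qed

text \<open>
  The series is the Fourier series at \<open>x\<close> of \<open>\<phi> t * cis (\<eta> * t)\<close>, where the bump \<open>\<phi>\<close> is \<open>1\<close> on
  \<open>[0, 1]\<close> and vanishes outside \<open>[-1, 2]\<close>.  The coefficients are computed over the period
  \<open>[x - pi, x + pi]\<close> centred at \<open>x\<close>; it contains \<open>[-1, 2]\<close> for all \<open>x\<close> in \<open>[0, 1]\<close>, so that they are
  integrals over the whole line.
\<close>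

lemma cis_expansion_1d:
  obtains b :: "real \<Rightarrow> complex" and C where "continuous_on UNIV b" "\<And>u. (1 + \<bar>u\<bar>) ^ r * cmod (b u) \<le> C"
    "\<And>\<eta> x. 0 \<le> x \<Longrightarrow> x \<le> 1 \<Longrightarrow> (\<lambda>N. \<Sum>k = - int N..int N. b (of_int k - \<eta>) * cis (of_int k * x)) \<longlonglongrightarrow> cis (\<eta> * x)"
proof -
  obtain \<phi> :: "real \<Rightarrow> real" and K C where \<phi>: "\<And>x y. \<bar>\<phi> x - \<phi> y\<bar> \<le> K * \<bar>x - y\<bar>"
      "\<And>x. x \<in> {0..1} \<Longrightarrow> \<phi> x = 1" "\<And>x. x \<notin> {-1..2} \<Longrightarrow> \<phi> x = 0" "\<And>x. \<bar>\<phi> x\<bar> \<le> 1"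
      "\<And>u. (1 + \<bar>u\<bar>) ^ r * cmod (line_fourier \<phi> u) \<le> C"
    using bump_exists[OF order_refl half_gt_zero[OF zero_less_one], of r,
      unfolded minus_zero add_0_right diff_zero] by blast
  have K0: "K \<ge> 0" using \<phi>(1)[of 0 1] by simp
  have cont: "continuous_on UNIV \<phi>"
    by (rule lipschitz_on_continuous_on[of K]) (use \<phi>(1) K0 in \<open>auto simp: lipschitz_on_def dist_real_def\<close>)
  then have [measurable]: "\<phi> \<in> borel_measurable borel" by (rule borel_measurable_continuous_onI)
  define b where "b u = line_fourier \<phi> u / of_real (2 * pi)" for u
  show ?thesis
  proof (rule that)
    have ind: "integrable lborel (indicator {-1..2} :: real \<Rightarrow> real)" by simp
    have "continuous_on UNIV (line_fourier \<phi>)"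
      unfolding line_fourier_def continuous_on_sequentially o_def
    proof safe
      fix v :: "nat \<Rightarrow> real" and u assume v: "v \<longlonglongrightarrow> u"
      show "(\<lambda>n. \<integral>x. \<phi> x * cis (- v n * x) \<partial>lborel) \<longlonglongrightarrow> (\<integral>x. \<phi> x * cis (- u * x) \<partial>lborel)"
      proof (rule integral_dominated_convergence[OF _ _ ind])
        show "AE x in lborel. (\<lambda>n. \<phi> x * cis (- v n * x)) \<longlonglongrightarrow> \<phi> x * cis (- u * x)"
          unfolding cis_conv_exp by (intro AE_I2 tendsto_intros v)
        show "AE x in lborel. norm (\<phi> x * cis (- v n * x)) \<le> indicator {- 1..2} x" for n
          using \<phi>(3,4) by (intro AE_I2) (auto simp: norm_mult indicator_def)
      qed measurable
    qed
    then show "continuous_on UNIV b" unfolding b_def by (intro continuous_intros) auto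
    show "(1 + \<bar>u\<bar>) ^ r * cmod (b u) \<le> C / (2 * pi)" for u
      using \<phi>(5)[of u] by (simp add: b_def norm_divide divide_right_mono)
    fix \<eta> x :: real assume x: "0 \<le> x" "x \<le> 1"
    define H where "H t = \<phi> (x + t) * cis (\<eta> * (x + t))" for t
    have H0: "H 0 = cis (\<eta> * x)" using \<phi>(2) x by (simp add: H_def)
    have coeff: "(\<integral>t. H t * cis (- of_int k * t) \<partial>circle_measure) = of_real (2 * pi) * (b (of_int k - \<eta>) * cis (of_int k * x))" for k
    proof -
      have "(\<integral>t. H t * cis (- of_int k * t) \<partial>circle_measure) = (\<integral>t. indicator {-pi..pi} t *\<^sub>R (H t * cis (- of_int k * t)) \<partial>lborel)"
        by (simp add: integral_restrict_space)
      also have "\<dots> = (\<integral>t. cis (of_int k * x) * (\<phi> (x + 1 * t) * cis (- (of_int k - \<eta>) * (x + 1 * t))) \<partial>lborel)"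
      proof (intro Bochner_Integration.integral_cong refl)
        fix t
        have "\<phi> (x + t) = 0" if "t \<notin> {-pi..pi}"
          by (rule \<phi>(3)) (use that x pi_gt3 in auto)
        moreover have "cis (\<eta> * (x + t)) * cis (- of_int k * t) = cis (of_int k * x) * cis (- (of_int k - \<eta>) * (x + t))"
          by (simp add: cis_mult algebra_simps)
        ultimately show "indicator {-pi..pi} t *\<^sub>R (H t * cis (- of_int k * t)) = cis (of_int k * x) * (\<phi> (x + 1 * t) * cis (- (of_int k - \<eta>) * (x + 1 * t)))"
          by (simp add: H_def indicator_def)
      qed
      also have "\<dots> = cis (of_int k * x) * (\<integral>t. \<phi> (x + 1 * t) * cis (- (of_int k - \<eta>) * (x + 1 * t)) \<partial>lborel)" by simp
      also have "(\<integral>t. \<phi> (x + 1 * t) * cis (- (of_int k - \<eta>) * (x + 1 * t)) \<partial>lborel) = (\<integral>t. \<phi> t * cis (- (of_int k - \<eta>) * t) \<partial>lborel)"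
        using lborel_integral_real_affine[of 1 "\<lambda>t. \<phi> t * cis (- (of_int k - \<eta>) * t)" x] by simp
      finally show ?thesis by (simp add: b_def line_fourier_def)
    qed
    have "(\<lambda>N. \<Sum>k = - int N..int N. \<integral>t. H t * cis (- of_int k * t) \<partial>circle_measure) \<longlonglongrightarrow> of_real (2 * pi) * H 0"
    proof (rule dini_fourier)
      show "H \<in> borel_measurable borel" unfolding H_def by measurable
      fix t
      have "H t - H 0 = of_real (\<phi> (x + t) - \<phi> x) * cis (\<eta> * (x + t)) + of_real (\<phi> x) * (cis (\<eta> * (x + t)) - cis (\<eta> * x))"
        by (simp add: H_def algebra_simps)
      also have "norm \<dots> \<le> \<bar>\<phi> (x + t) - \<phi> x\<bar> * 1 + \<bar>\<phi> x\<bar> * \<bar>\<eta> * (x + t) - \<eta> * x\<bar>"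
        by (intro order_trans[OF norm_triangle_ineq] add_mono)
           (simp_all add: norm_mult norm_cis_diff_le mult_left_mono)
      also have "\<dots> \<le> K * \<bar>t\<bar> * 1 + 1 * (\<bar>\<eta>\<bar> * \<bar>t\<bar>)"
        using \<phi>(1)[of "x + t" x] \<phi>(4)[of x]
        by (intro add_mono mult_mono) (auto simp: algebra_simps abs_mult[symmetric])
      finally show "norm (H t - H 0) \<le> (K + \<bar>\<eta>\<bar>) * \<bar>t\<bar>" by (simp add: algebra_simps)
    qed
    then have "(\<lambda>N. of_real (2 * pi) * (\<Sum>k = - int N..int N. b (of_int k - \<eta>) * cis (of_int k * x))) \<longlonglongrightarrow> of_real (2 * pi) * cis (\<eta> * x)"
      unfolding coeff H0 sum_distrib_left[symmetric] .
    from tendsto_mult_left[OF this, of "inverse (of_real (2 * pi))"]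
    show "(\<lambda>N. \<Sum>k = - int N..int N. b (of_int k - \<eta>) * cis (of_int k * x)) \<longlonglongrightarrow> cis (\<eta> * x)"
      by (simp add: field_simps)
  qed
qed

section \<open>Fourier inversion for integrable functions\<close>

lemma Basis_vec_real: "(Basis :: (real ^ 'd) set) = (\<lambda>i. axis i 1) ` UNIV"
  by (auto simp: Basis_vec_def)

lemma inj_axis: "inj (\<lambda>i. axis i (1::real) :: real ^ 'd)"
  by (auto simp: inj_def axis_eq_axis)

lemma
  fixes g :: "'d::finite \<Rightarrow> real \<Rightarrow> complex"
  assumes g: "\<And>i. integrable lborel (g i)"
  shows integrable_prod_vec: "integrable lborel (\<lambda>x :: real ^ 'd. \<Prod>i\<in>UNIV. g i (x $ i))"
    and integral_prod_vec: "(\<integral>x. (\<Prod>i\<in>UNIV. g i ((x :: real ^ 'd) $ i)) \<partial>lborel) = (\<Prod>i\<in>UNIV. \<integral>t. g i t \<partial>lborel)"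
proof -
  interpret product_sigma_finite "\<lambda>_ :: real ^ 'd. lborel :: real measure" ..
  have [measurable]: "g i \<in> borel_measurable borel" for i using g[of i] by auto
  let ?B = "Basis :: (real ^ 'd) set"
  define T where "T f = (\<Sum>b\<in>?B. f b *\<^sub>R b)" for f :: "real ^ 'd \<Rightarrow> real"
  define j where "j b = (THE i. b = (axis i 1 :: real ^ 'd))" for b
  have j: "j (axis i 1) = i" for i by (auto simp: j_def axis_eq_axis)
  have Tm: "T \<in> (\<Pi>\<^sub>M b\<in>?B. lborel) \<rightarrow>\<^sub>M borel" unfolding T_def by measurable
  have Tc: "T f $ i = f (axis i 1)" for f i
  proof -
    have "T f = (\<Sum>k\<in>UNIV. f (axis k 1) *\<^sub>R axis k 1)"
      unfolding T_def Basis_vec_real by (subst sum.reindex[OF inj_axis]) simp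
    then show ?thesis by (simp add: sum_component axis_def if_distrib cong: if_cong)
  qed
  have eq: "(\<Prod>i\<in>UNIV. g i (T f $ i)) = (\<Prod>b\<in>?B. g (j b) (f b))" for f
    unfolding Tc Basis_vec_real by (subst prod.reindex[OF inj_axis]) (simp add: j)
  have lb: "(lborel :: (real ^ 'd) measure) = distr (\<Pi>\<^sub>M b\<in>?B. lborel) borel T"
    unfolding T_def by (rule lborel_eq)
  have "integrable (\<Pi>\<^sub>M b\<in>?B. lborel) (\<lambda>f. \<Prod>b\<in>?B. g (j b) (f b))"
    by (rule product_integrable_prod) (auto intro: g)
  then show "integrable lborel (\<lambda>x :: real ^ 'd. \<Prod>i\<in>UNIV. g i (x $ i))"
    by (subst lb, subst integrable_distr_eq[OF Tm]) (simp_all add: eq)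
  have "(\<integral>x. (\<Prod>i\<in>UNIV. g i ((x :: real ^ 'd) $ i)) \<partial>lborel) = (\<integral>f. (\<Prod>b\<in>?B. g (j b) (f b)) \<partial>(\<Pi>\<^sub>M b\<in>?B. lborel))"
    by (subst lb, subst integral_distr[OF Tm]) (simp_all add: eq)
  also have "\<dots> = (\<Prod>b\<in>?B. integral\<^sup>L lborel (g (j b)))"
    by (rule product_integral_prod) (auto intro: g)
  also have "\<dots> = (\<Prod>i\<in>UNIV. \<integral>t. g i t \<partial>lborel)"
    unfolding Basis_vec_real by (subst prod.reindex[OF inj_axis]) (simp add: j)
  finally show "(\<integral>x. (\<Prod>i\<in>UNIV. g i ((x :: real ^ 'd) $ i)) \<partial>lborel) = (\<Prod>i\<in>UNIV. \<integral>t. g i t \<partial>lborel)" .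
qed

text \<open>
  This is the characteristic function of the standard normal distribution after rescaling by
  \<open>sqrt (2 * pi)\<close>.
\<close>

lemma gauss_1d:
  shows "integrable lborel (\<lambda>u. of_real (exp (- pi * u\<^sup>2)) * cis (- 2 * pi * \<xi> * u))"
    and "(\<integral>u. of_real (exp (- pi * u\<^sup>2)) * cis (- 2 * pi * \<xi> * u) \<partial>lborel) = of_real (exp (- pi * \<xi>\<^sup>2))"
proof -
  define c where "c = sqrt (2 * pi)"
  have c: "c > 0" "c\<^sup>2 = 2 * pi" by (simp_all add: c_def)
  define t where "t = - c * \<xi>"
  have *: "(\<integral>x. of_real (std_normal_density x) * cis (t * x) \<partial>lborel) = of_real (exp (- (t^2) / 2))"
  proof -
    have "char std_normal_distribution t = (\<integral>x. iexp (t * x) \<partial>density lborel (\<lambda>x. ennreal (std_normal_density x)))"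
      by (simp add: char_def)
    also have "\<dots> = (\<integral>x. std_normal_density x *\<^sub>R iexp (t * x) \<partial>lborel)"
      by (subst integral_density) auto
    finally show ?thesis by (simp add: char_std_normal_distribution scaleR_conv_of_real cis_conv_exp)
  qed
  have int: "integrable lborel (\<lambda>x. of_real (std_normal_density x) * cis (t * x))"
    by (rule Bochner_Integration.integrable_bound[OF integrable_normal_density[of 1 0]])
       (auto simp: norm_mult)
  have pt: "of_real (std_normal_density (0 + c * u)) * cis (t * (0 + c * u)) = (of_real (exp (- pi * u\<^sup>2)) * cis (- 2 * pi * \<xi> * u)) / of_real c" for u
  proof -
    have "std_normal_density x = exp (- x\<^sup>2 / 2) / c" for x by (simp add: normal_density_def c_def)
    moreover have "- (c * u)\<^sup>2 / 2 = - pi * u\<^sup>2" by (simp add: power_mult_distrib c)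
    moreover have "t * (c * u) = - (c\<^sup>2) * \<xi> * u" by (simp add: t_def power2_eq_square)
    ultimately show ?thesis by (simp add: c(2))
  qed
  have "integrable lborel (\<lambda>u. of_real (std_normal_density (0 + c * u)) * cis (t * (0 + c * u)))"
    by (rule lborel_integrable_real_affine[OF int]) (use c in auto)
  then have "integrable lborel (\<lambda>u. of_real c * ((of_real (exp (- pi * u\<^sup>2)) * cis (- 2 * pi * \<xi> * u)) / of_real c))"
    unfolding pt by (rule integrable_mult_right)
  then show "integrable lborel (\<lambda>u. of_real (exp (- pi * u\<^sup>2)) * cis (- 2 * pi * \<xi> * u))" using c by simp
  have "(\<integral>x. of_real (std_normal_density x) * cis (t * x) \<partial>lborel)
     = \<bar>c\<bar> *\<^sub>R (\<integral>u. (of_real (exp (- pi * u\<^sup>2)) * cis (- 2 * pi * \<xi> * u)) / of_real c \<partial>lborel)"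
    using lborel_integral_real_affine[of c "\<lambda>x. of_real (std_normal_density x) * cis (t * x)" 0] c
    unfolding pt by simp
  also have "\<dots> = (\<integral>u. of_real (exp (- pi * u\<^sup>2)) * cis (- 2 * pi * \<xi> * u) \<partial>lborel)"
    using c by (simp add: scaleR_conv_of_real)
  finally show "(\<integral>u. of_real (exp (- pi * u\<^sup>2)) * cis (- 2 * pi * \<xi> * u) \<partial>lborel) = of_real (exp (- pi * \<xi>\<^sup>2))"
    unfolding * using c by (simp add: t_def power_mult_distrib)
qed

text \<open>
  With this normalisation the Gaussian is its own Fourier transform.
\<close>

definition gauss :: "real ^ 'd \<Rightarrow> real" where "gauss x = exp (- pi * (x \<bullet> x))"

lemma gauss_vec:
  fixes \<xi> :: "real ^ 'd"
  shows integrable_gauss_cis: "integrable lborel (\<lambda>u. of_real (gauss u) * cis (- 2 * pi * (\<xi> \<bullet> u)))"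
    and fourier_gauss: "(\<integral>u. of_real (gauss u) * cis (- 2 * pi * (\<xi> \<bullet> u)) \<partial>lborel) = of_real (gauss \<xi>)"
proof -
  define g where "g i u = of_real (exp (- pi * u\<^sup>2)) * cis (- 2 * pi * (\<xi> $ i) * u)" for i u
  have pt: "of_real (gauss u) * cis (- 2 * pi * (\<xi> \<bullet> u)) = (\<Prod>i\<in>UNIV. g i (u $ i))" for u
  proof -
    have "gauss u = (\<Prod>i\<in>UNIV. exp (- pi * (u $ i)\<^sup>2))"
      by (simp add: gauss_def inner_vec_def exp_sum[symmetric] sum_distrib_left power2_eq_square)
    moreover have "cis (- 2 * pi * (\<xi> \<bullet> u)) = (\<Prod>i\<in>UNIV. cis (- 2 * pi * (\<xi> $ i) * (u $ i)))"
      by (simp add: inner_vec_def cis_sum[symmetric] sum_distrib_left mult.assoc)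
    ultimately show ?thesis by (simp add: g_def prod.distrib)
  qed
  have gi: "integrable lborel (g i)" "(\<integral>u. g i u \<partial>lborel) = of_real (exp (- pi * (\<xi> $ i)\<^sup>2))" for i
    using gauss_1d[of "\<xi> $ i"] by (simp_all add: g_def[abs_def])
  show "integrable lborel (\<lambda>u. of_real (gauss u) * cis (- 2 * pi * (\<xi> \<bullet> u)))"
    unfolding pt by (rule integrable_prod_vec) (rule gi)
  show "(\<integral>u. of_real (gauss u) * cis (- 2 * pi * (\<xi> \<bullet> u)) \<partial>lborel) = of_real (gauss \<xi>)"
    unfolding pt
    by (subst integral_prod_vec) (simp_all add: gi gauss_def inner_vec_def exp_sum[symmetric] sum_distrib_left power2_eq_square flip: of_real_prod)
qed

lemma gauss_measurable [measurable]: "gauss \<in> borel_measurable borel"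
  unfolding gauss_def by measurable

lemma gauss_nonneg: "gauss x \<ge> 0" and gauss_le_1: "gauss x \<le> 1"
  by (simp_all add: gauss_def)

lemma integrable_gauss: "integrable lborel (gauss :: real ^ 'd \<Rightarrow> real)"
proof -
  have "integrable lborel (\<lambda>u :: real ^ 'd. of_real (gauss u) :: complex)"
    using integrable_gauss_cis[of 0] by simp
  then show ?thesis by (simp only: complex_of_real_integrable_eq)
qed

lemma integral_gauss: "(\<integral>u. gauss (u :: real ^ 'd) \<partial>lborel) = 1"
proof -
  have "complex_of_real (\<integral>u. gauss (u :: real ^ 'd) \<partial>lborel) = 1"
    using fourier_gauss[of 0] by (simp add: gauss_def)
  then show ?thesis by simp
qed

lemma
  fixes f :: "'a::euclidean_space \<Rightarrow> 'b :: {banach, second_countable_topology}"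
  assumes c: "c \<noteq> 0" and [measurable]: "f \<in> borel_measurable borel"
  shows integral_affine: "(\<integral>x. f x \<partial>lborel) = \<bar>c\<bar> ^ DIM('a) *\<^sub>R (\<integral>x. f (t + c *\<^sub>R x) \<partial>lborel)"
    and integrable_affine: "integrable lborel f \<Longrightarrow> integrable lborel (\<lambda>x. f (t + c *\<^sub>R x))"
proof -
  have lb: "lborel = density (distr lborel borel (\<lambda>x::'a. t + c *\<^sub>R x)) (\<lambda>_. ennreal (\<bar>c\<bar>^DIM('a)))"
    using lborel_affine[OF c, of t] by simp
  show "(\<integral>x. f x \<partial>lborel) = \<bar>c\<bar> ^ DIM('a) *\<^sub>R (\<integral>x. f (t + c *\<^sub>R x) \<partial>lborel)"
    by (subst lb, subst integral_density) (auto simp: integral_distr)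
  assume f: "integrable lborel f"
  have "integrable (density (distr lborel borel (\<lambda>x::'a. t + c *\<^sub>R x)) (\<lambda>_. ennreal (\<bar>c\<bar>^DIM('a)))) f"
    using f by (subst lb[symmetric])
  then have "integrable lborel (\<lambda>x. \<bar>c\<bar>^DIM('a) *\<^sub>R f (t + c *\<^sub>R x))"
    by (subst (asm) integrable_density) (auto simp: integrable_distr_eq)
  from integrable_scaleR_right[OF this, of "inverse (\<bar>c\<bar>^DIM('a))"]
  show "integrable lborel (\<lambda>x. f (t + c *\<^sub>R x))" using c by simp
qed

text \<open>
  A product of integrable functions is integrable on the product space and dominates the kernel.
\<close>

lemma Fubini_dominated:
  fixes K :: "'a::euclidean_space \<Rightarrow> 'b::euclidean_space \<Rightarrow> complex"
  assumes K: "case_prod K \<in> borel_measurable (lborel \<Otimes>\<^sub>M lborel)"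
    and F: "integrable lborel F" and G: "integrable lborel G"
    and le: "\<And>x y. norm (K x y) \<le> norm (F x :: complex) * norm (G y :: complex)"
  shows "(\<integral>x. (\<integral>y. K x y \<partial>lborel) \<partial>lborel) = (\<integral>y. (\<integral>x. K x y \<partial>lborel) \<partial>lborel)"
proof -
  have [measurable]: "F \<in> borel_measurable lborel" "G \<in> borel_measurable lborel" using F G by auto
  have "integrable (lborel \<Otimes>\<^sub>M lborel) (\<lambda>(x, y). F x * G y)"
    by (rule lborel_pair.Fubini_integrable) (use F G in \<open>auto simp: norm_mult\<close>)
  then have "integrable (lborel \<Otimes>\<^sub>M lborel) (case_prod K)"
    by (rule Bochner_Integration.integrable_bound) (use K le in \<open>auto simp: norm_mult\<close>)
  from lborel_pair.Fubini_integral[OF this] show ?thesis by simp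
qed

text \<open>
  Damping the inversion integral by a wide Gaussian amounts to convolving \<open>f\<close> with a narrow one:
  after exchanging the integrals, the inner one is the transform of a rescaled Gaussian.
\<close>

lemma gauss_smoothing:
  fixes f :: "real ^ 'd \<Rightarrow> complex" and y :: "real ^ 'd"
  assumes f: "integrable lborel f" and \<epsilon>: "\<epsilon> > 0"
  shows "(\<integral>\<xi>. (\<integral>x. f x * cis (- 2 * pi * (\<xi> \<bullet> x)) \<partial>lborel) * cis (2 * pi * (\<xi> \<bullet> y)) * gauss (\<epsilon> *\<^sub>R \<xi>) \<partial>lborel)
    = (\<integral>x. f x * of_real ((1 / \<epsilon>) ^ CARD('d) * gauss ((1 / \<epsilon>) *\<^sub>R (x - y))) \<partial>lborel)"
proof -
  have [measurable]: "f \<in> borel_measurable borel" using f by auto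
  have "(\<integral>\<xi>. (\<integral>x. f x * cis (- 2 * pi * (\<xi> \<bullet> x)) \<partial>lborel) * cis (2 * pi * (\<xi> \<bullet> y)) * gauss (\<epsilon> *\<^sub>R \<xi>) \<partial>lborel)
     = (\<integral>\<xi>. (\<integral>x. f x * cis (2 * pi * (\<xi> \<bullet> (y - x))) * gauss (\<epsilon> *\<^sub>R \<xi>) \<partial>lborel) \<partial>lborel)"
  proof (intro Bochner_Integration.integral_cong refl)
    fix \<xi> :: "real ^ 'd"
    have *: "f x * cis (2 * pi * (\<xi> \<bullet> (y - x))) * gauss (\<epsilon> *\<^sub>R \<xi>) = (cis (2 * pi * (\<xi> \<bullet> y)) * gauss (\<epsilon> *\<^sub>R \<xi>)) * (f x * cis (- 2 * pi * (\<xi> \<bullet> x)))" for x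
      by (simp add: inner_diff_right right_diff_distrib cis_divide[symmetric] divide_inverse algebra_simps)
    show "(\<integral>x. f x * cis (- 2 * pi * (\<xi> \<bullet> x)) \<partial>lborel) * cis (2 * pi * (\<xi> \<bullet> y)) * gauss (\<epsilon> *\<^sub>R \<xi>)
      = (\<integral>x. f x * cis (2 * pi * (\<xi> \<bullet> (y - x))) * gauss (\<epsilon> *\<^sub>R \<xi>) \<partial>lborel)"
      unfolding * by (subst integral_mult_right_zero) (simp add: mult_ac)
  qed
  also have "\<dots> = (\<integral>x. (\<integral>\<xi>. f x * cis (2 * pi * (\<xi> \<bullet> (y - x))) * gauss (\<epsilon> *\<^sub>R \<xi>) \<partial>lborel) \<partial>lborel)"
  proof (rule Fubini_dominated)
    show "integrable lborel (\<lambda>\<xi>. of_real (gauss (0 + \<epsilon> *\<^sub>R \<xi>)) :: complex)"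
      by (intro integrable_affine[where f = "\<lambda>x. of_real (gauss x) :: complex"]) (use \<epsilon> integrable_gauss in auto)
    show "integrable lborel f" by fact
    show "norm (f x * cis (2 * pi * (\<xi> \<bullet> (y - x))) * gauss (\<epsilon> *\<^sub>R \<xi>)) \<le> norm (of_real (gauss (0 + \<epsilon> *\<^sub>R \<xi>)) :: complex) * norm (f x)" for x \<xi>
      by (simp add: norm_mult)
  qed measurable
  also have "\<dots> = (\<integral>x. f x * of_real ((1 / \<epsilon>) ^ CARD('d) * gauss ((1 / \<epsilon>) *\<^sub>R (x - y))) \<partial>lborel)"
  proof (intro Bochner_Integration.integral_cong refl)
    fix x :: "real ^ 'd"
    have "(\<integral>\<xi>. cis (2 * pi * (\<xi> \<bullet> (y - x))) * gauss (\<epsilon> *\<^sub>R \<xi>) \<partial>lborel)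
       = \<bar>1 / \<epsilon>\<bar> ^ DIM(real ^ 'd) *\<^sub>R (\<integral>\<xi>. cis (2 * pi * ((0 + (1 / \<epsilon>) *\<^sub>R \<xi>) \<bullet> (y - x))) * gauss (\<epsilon> *\<^sub>R (0 + (1 / \<epsilon>) *\<^sub>R \<xi>)) \<partial>lborel)"
      by (rule integral_affine) (use \<epsilon> in auto)
    also have "(\<integral>\<xi>. cis (2 * pi * ((0 + (1 / \<epsilon>) *\<^sub>R \<xi>) \<bullet> (y - x))) * gauss (\<epsilon> *\<^sub>R (0 + (1 / \<epsilon>) *\<^sub>R \<xi>)) \<partial>lborel)
       = (\<integral>\<xi>. of_real (gauss \<xi>) * cis (- 2 * pi * (((1 / \<epsilon>) *\<^sub>R (x - y)) \<bullet> \<xi>)) \<partial>lborel)"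
      using \<epsilon> by (intro Bochner_Integration.integral_cong refl) (simp add: inner_commute inner_diff_left inner_diff_right algebra_simps)
    also have "\<dots> = of_real (gauss ((1 / \<epsilon>) *\<^sub>R (x - y)))" by (rule fourier_gauss)
    finally show "(\<integral>\<xi>. f x * cis (2 * pi * (\<xi> \<bullet> (y - x))) * gauss (\<epsilon> *\<^sub>R \<xi>) \<partial>lborel) = f x * of_real ((1 / \<epsilon>) ^ CARD('d) * gauss ((1 / \<epsilon>) *\<^sub>R (x - y)))"
      using \<epsilon> by (simp add: mult.assoc scaleR_conv_of_real)
  qed
  finally show ?thesis .
qed

lemma tendsto_indicator_box:
  fixes x :: "'a::euclidean_space"
  assumes "v \<longlonglongrightarrow> x" "x \<notin> cbox a b - box a b"
  shows "(\<lambda>n. indicator (box a b) (v n) :: real) \<longlonglongrightarrow> indicator (box a b) x"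
proof (cases "x \<in> box a b")
  case True
  then have "eventually (\<lambda>n. v n \<in> box a b) sequentially"
    using assms(1) open_box topological_tendstoD by blast
  then have "eventually (\<lambda>n. indicator (box a b) (v n) = (1::real)) sequentially"
    by eventually_elim simp
  then show ?thesis using True by (auto intro: tendsto_eventually)
next
  case False
  then have "x \<in> - cbox a b" using assms(2) by auto
  then have "eventually (\<lambda>n. v n \<in> - cbox a b) sequentially"
    using assms(1) closed_cbox topological_tendstoD by blast
  then have "eventually (\<lambda>n. indicator (box a b) (v n) = (0::real)) sequentially"
    by eventually_elim (use box_subset_cbox[of a b] in \<open>auto simp: indicator_def\<close>)
  then show ?thesis using False by (auto intro: tendsto_eventually)
qed

text \<open>
  Both sides are limits, for \<open>\<epsilon> \<rightarrow> 0\<close>, of the integral over the box of the two expressions in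
  \<open>gauss_smoothing\<close>.  In the first one the damping factor tends to \<open>1\<close>.  In the second one the
  Gaussian is moved from \<open>f\<close> to the indicator of the box, and the smoothed indicators converge
  off the boundary of the box, which is a null set.  Integrating over boxes thus replaces
  convergence of approximate identities in \<open>L\<^sup>1\<close> by dominated convergence.
\<close>

lemma fourier_inversion_box:
  fixes f :: "real ^ 'd \<Rightarrow> complex"
  assumes f: "integrable lborel f"
    and ft: "integrable lborel ft" and ft_def: "\<And>\<xi>. ft \<xi> = (\<integral>x. f x * cis (- 2 * pi * (\<xi> \<bullet> x)) \<partial>lborel)"
  shows "(\<integral>x. indicator (box a b) x *\<^sub>R f x \<partial>lborel)
    = (\<integral>y. indicator (box a b) y *\<^sub>R (\<integral>\<xi>. ft \<xi> * cis (2 * pi * (\<xi> \<bullet> y)) \<partial>lborel) \<partial>lborel)"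
proof -
  have [measurable]: "f \<in> borel_measurable borel" "ft \<in> borel_measurable borel" using f ft by auto
  define B where "B = box a b"
  have [measurable]: "B \<in> sets borel" by (simp add: B_def)
  have Bfin: "emeasure lborel B < \<infinity>" unfolding B_def using emeasure_bounded_finite[OF bounded_box, of a b] by auto
  define \<epsilon> where "\<epsilon> n = 1 / (1 + real n)" for n
  have \<epsilon>: "\<epsilon> n > 0" for n by (simp add: \<epsilon>_def)
  have \<epsilon>0: "\<epsilon> \<longlonglongrightarrow> 0" unfolding \<epsilon>_def using LIMSEQ_inverse_real_of_nat by (simp add: divide_inverse add.commute)
  define h where "h n y = (\<integral>\<xi>. ft \<xi> * cis (2 * pi * (\<xi> \<bullet> y)) * gauss (\<epsilon> n *\<^sub>R \<xi>) \<partial>lborel)" for n and y :: "real ^ 'd"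
  define g where "g y = (\<integral>\<xi>. ft \<xi> * cis (2 * pi * (\<xi> \<bullet> y)) \<partial>lborel)" for y :: "real ^ 'd"
  have [measurable]: "h n \<in> borel_measurable borel" "g \<in> borel_measurable borel" for n
    unfolding h_def g_def by measurable
  have hg: "(\<lambda>n. h n y) \<longlonglongrightarrow> g y" for y
    unfolding h_def g_def
  proof (rule integral_dominated_convergence)
    show "integrable lborel (\<lambda>\<xi>. norm (ft \<xi>))" using ft by simp
    show "AE \<xi> in lborel. (\<lambda>n. ft \<xi> * cis (2 * pi * (\<xi> \<bullet> y)) * of_real (gauss (\<epsilon> n *\<^sub>R \<xi>))) \<longlonglongrightarrow> ft \<xi> * cis (2 * pi * (\<xi> \<bullet> y))"
    proof (intro AE_I2)
      fix \<xi> :: "real ^ 'd"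
      have "(\<lambda>n. ft \<xi> * cis (2 * pi * (\<xi> \<bullet> y)) * of_real (gauss (\<epsilon> n *\<^sub>R \<xi>))) \<longlonglongrightarrow> ft \<xi> * cis (2 * pi * (\<xi> \<bullet> y)) * of_real (gauss (0 *\<^sub>R \<xi>))"
        unfolding gauss_def by (intro tendsto_intros \<epsilon>0)
      then show "(\<lambda>n. ft \<xi> * cis (2 * pi * (\<xi> \<bullet> y)) * of_real (gauss (\<epsilon> n *\<^sub>R \<xi>))) \<longlonglongrightarrow> ft \<xi> * cis (2 * pi * (\<xi> \<bullet> y))"
        by (simp add: gauss_def)
    qed
    show "AE \<xi> in lborel. norm (ft \<xi> * cis (2 * pi * (\<xi> \<bullet> y)) * of_real (gauss (\<epsilon> n *\<^sub>R \<xi>))) \<le> norm (ft \<xi>)" for n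
      by (intro AE_I2) (simp add: norm_mult gauss_nonneg gauss_le_1 mult_left_le)
  qed measurable
  have hb: "norm (h n y) \<le> (\<integral>\<xi>. norm (ft \<xi>) \<partial>lborel)" for n y
    unfolding h_def
    by (rule order_trans[OF integral_norm_bound], rule integral_mono')
       (use ft in \<open>auto simp: norm_mult gauss_nonneg gauss_le_1 mult_left_le\<close>)
  have 1: "(\<lambda>n. \<integral>y. indicator B y *\<^sub>R h n y \<partial>lborel) \<longlonglongrightarrow> (\<integral>y. indicator B y *\<^sub>R g y \<partial>lborel)"
  proof (rule integral_dominated_convergence)
    show "integrable lborel (\<lambda>y. indicator B y *\<^sub>R (\<integral>\<xi>. norm (ft \<xi>) \<partial>lborel))"
      using Bfin by (intro integrable_scaleR_left integrable_real_indicator) auto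
    show "AE y in lborel. norm (indicator B y *\<^sub>R h n y) \<le> indicator B y *\<^sub>R (\<integral>\<xi>. norm (ft \<xi>) \<partial>lborel)" for n
      by (intro AE_I2) (simp add: hb indicator_def)
  qed (auto intro!: tendsto_intros hg)
  let ?I = "\<lambda>n x. \<integral>u. indicator B (x - \<epsilon> n *\<^sub>R u) * gauss u \<partial>lborel"
  have eq: "(\<integral>y. indicator B y *\<^sub>R h n y \<partial>lborel) = (\<integral>x. f x * of_real (?I n x) \<partial>lborel)" for n
  proof -
    define k where "k w = (1 / \<epsilon> n) ^ CARD('d) * gauss ((1 / \<epsilon> n) *\<^sub>R w)" for w :: "real ^ 'd"
    have [measurable]: "k \<in> borel_measurable borel" unfolding k_def by measurable
    have kb: "0 \<le> k w" "k w \<le> (1 / \<epsilon> n) ^ CARD('d)" for w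
      unfolding k_def using \<epsilon>[of n] by (auto intro!: mult_nonneg_nonneg mult_left_le gauss_nonneg gauss_le_1)
    have "(\<integral>y. indicator B y *\<^sub>R h n y \<partial>lborel) = (\<integral>y. (\<integral>x. f x * of_real (indicator B y * k (x - y)) \<partial>lborel) \<partial>lborel)"
    proof (intro Bochner_Integration.integral_cong refl)
      fix y
      have "h n y = (\<integral>x. f x * of_real (k (x - y)) \<partial>lborel)"
        unfolding h_def ft_def k_def by (rule gauss_smoothing[OF f \<epsilon>])
      then show "indicator B y *\<^sub>R h n y = (\<integral>x. f x * of_real (indicator B y * k (x - y)) \<partial>lborel)"
        by (simp add: indicator_def)
    qed
    also have "\<dots> = (\<integral>x. (\<integral>y. f x * of_real (indicator B y * k (x - y)) \<partial>lborel) \<partial>lborel)"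
    proof (rule Fubini_dominated)
      show "integrable lborel (\<lambda>y. of_real (indicator B y * (1 / \<epsilon> n) ^ CARD('d)) :: complex)"
        using Bfin by (intro integrable_of_real integrable_mult_left integrable_real_indicator) auto
      show "integrable lborel f" by fact
      show "norm (f x * of_real (indicator B y * k (x - y))) \<le> norm (of_real (indicator B y * (1 / \<epsilon> n) ^ CARD('d)) :: complex) * norm (f x)" for x y
        using kb[of "x - y"] \<epsilon>[of n] by (auto simp: norm_mult norm_power norm_divide indicator_def mult.commute[of _ "cmod (f x)"] intro!: mult_left_mono)
    qed measurable
    also have "\<dots> = (\<integral>x. f x * of_real (?I n x) \<partial>lborel)"
    proof (intro Bochner_Integration.integral_cong refl)
      fix x :: "real ^ 'd"
      have "(\<integral>y. indicator B y * k (x - y) \<partial>lborel) = \<bar>- \<epsilon> n\<bar> ^ DIM(real ^ 'd) *\<^sub>R (\<integral>u. indicator B (x + (- \<epsilon> n) *\<^sub>R u) * k (x - (x + (- \<epsilon> n) *\<^sub>R u)) \<partial>lborel)"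
        by (rule integral_affine) (use \<epsilon>[of n] in auto)
      also have "\<dots> = (\<integral>u. \<bar>- \<epsilon> n\<bar> ^ DIM(real ^ 'd) * (indicator B (x + (- \<epsilon> n) *\<^sub>R u) * k (x - (x + (- \<epsilon> n) *\<^sub>R u))) \<partial>lborel)"
        by simp
      also have "\<dots> = ?I n x"
        using \<epsilon>[of n] by (intro Bochner_Integration.integral_cong refl) (simp add: k_def power_one_over field_simps)
      finally have "(\<integral>y. indicator B y * k (x - y) \<partial>lborel) = ?I n x" .
      then show "(\<integral>y. f x * of_real (indicator B y * k (x - y)) \<partial>lborel) = f x * of_real (?I n x)"
        by (subst integral_mult_right_zero, subst integral_complex_of_real) simp
    qed
    finally show ?thesis .
  qed
  have 2: "(\<lambda>n. \<integral>x. f x * of_real (?I n x) \<partial>lborel) \<longlonglongrightarrow> (\<integral>x. f x * of_real (indicator B x) \<partial>lborel)"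
  proof (rule integral_dominated_convergence)
    show "integrable lborel (\<lambda>x. norm (f x))" using f by simp
    have "AE x in lborel. x \<notin> cbox a b - box a b"
    proof (rule AE_not_in)
      have "cbox a b - box a b \<in> null_sets lebesgue"
        using negligible_frontier_interval[of a b] by (simp add: negligible_iff_null_sets)
      then show "cbox a b - box a b \<in> null_sets lborel"
        by (simp add: null_sets_completion_iff)
    qed
    then show "AE x in lborel. (\<lambda>n. f x * of_real (?I n x)) \<longlonglongrightarrow> f x * of_real (indicator B x)"
    proof eventually_elim
      fix x assume x: "x \<notin> cbox a b - box a b"
      have "(\<lambda>n. ?I n x) \<longlonglongrightarrow> (\<integral>u. indicator B x * gauss (u :: real ^ 'd) \<partial>lborel)"
      proof (rule integral_dominated_convergence)
        show "integrable lborel (gauss :: real ^ 'd \<Rightarrow> real)" by (rule integrable_gauss)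
        have "(\<lambda>n. x - \<epsilon> n *\<^sub>R u) \<longlonglongrightarrow> x - 0 *\<^sub>R u" for u by (intro tendsto_intros \<epsilon>0)
        then show "AE u in lborel. (\<lambda>n. indicator B (x - \<epsilon> n *\<^sub>R u) * gauss u) \<longlonglongrightarrow> indicator B x * gauss u"
          unfolding B_def by (intro AE_I2 tendsto_intros tendsto_indicator_box x) simp
        show "AE u in lborel. norm (indicator B (x - \<epsilon> n *\<^sub>R u) * gauss u) \<le> gauss u" for n
          by (intro AE_I2) (simp add: indicator_def gauss_nonneg)
      qed measurable
      also have "(\<integral>u. indicator B x * gauss (u :: real ^ 'd) \<partial>lborel) = indicator B x"
        by (simp add: integral_gauss)
      finally show "(\<lambda>n. f x * of_real (?I n x)) \<longlonglongrightarrow> f x * of_real (indicator B x)"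
        by (intro tendsto_intros)
    qed
    show "AE x in lborel. norm (f x * of_real (?I n x)) \<le> norm (f x)" for n
    proof (intro AE_I2)
      fix x
      have "\<bar>?I n x\<bar> \<le> (\<integral>u. gauss (u :: real ^ 'd) \<partial>lborel)"
        by (rule order_trans[OF integral_abs_bound], rule integral_mono')
           (auto intro: integrable_gauss simp: abs_mult gauss_nonneg indicator_def)
      then show "norm (f x * of_real (?I n x)) \<le> norm (f x)"
        unfolding integral_gauss by (simp add: norm_mult mult_left_le)
    qed
  qed measurable
  have "(\<integral>y. indicator B y *\<^sub>R g y \<partial>lborel) = (\<integral>x. f x * of_real (indicator B x) \<partial>lborel)"
    using LIMSEQ_unique[OF 1 2[folded eq]] .
  also have "\<dots> = (\<integral>x. indicator B x *\<^sub>R f x \<partial>lborel)" by (simp add: scaleR_conv_of_real mult.commute)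
  finally show ?thesis by (simp add: g_def B_def)
qed

text \<open>
  Boxes are stable under intersection and generate the Borel sets, so all set integrals of \<open>w\<close>
  vanish by Dynkin's theorem.
\<close>

lemma AE_zero_if_box_integrals_zero:
  fixes w :: "'a::euclidean_space \<Rightarrow> complex"
  assumes w: "integrable lborel w" and UN: "(\<integral>x. w x \<partial>lborel) = 0"
    and box: "\<And>a b. (\<integral>x. indicator (box a b) x *\<^sub>R w x \<partial>lborel) = 0"
  shows "AE x in lborel. w x = 0"
proof (rule sigma_finite_measure.density_zero[OF sigma_finite_lborel w])
  fix A :: "'a set" assume "A \<in> sets lborel"
  then have A: "A \<in> sigma_sets UNIV (range (\<lambda>(a, b). box a b))"
    by (simp add: borel_eq_box)
  have meas: "A \<in> sets lborel" if "A \<in> sigma_sets UNIV (range (\<lambda>(a, b). box a b))" for A :: "'a set"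
    using that by (simp add: borel_eq_box)
  have I: "Int_stable (range (\<lambda>(a, b). box a b :: 'a set))" by (auto simp: Int_stable_def box_Int_box)
  have P: "range (\<lambda>(a, b). box a b :: 'a set) \<subseteq> Pow UNIV" by simp
  from I P A show "(\<integral>x\<in>A. w x \<partial>lborel) = 0"
  proof (induction rule: sigma_sets_induct_disjoint)
    case (basic A)
    then show ?case using box by (auto simp: set_lebesgue_integral_def)
  next
    case (compl A)
    have [measurable]: "A \<in> sets lborel" using meas[OF compl(1)] .
    have "(\<integral>x\<in>UNIV - A. w x \<partial>lborel) = (\<integral>x. w x - indicator A x *\<^sub>R w x \<partial>lborel)"
      unfolding set_lebesgue_integral_def
      by (intro Bochner_Integration.integral_cong refl) (auto simp: indicator_def)
    also have "\<dots> = (\<integral>x. w x \<partial>lborel) - (\<integral>x\<in>A. w x \<partial>lborel)"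
      unfolding set_lebesgue_integral_def
      by (intro Bochner_Integration.integral_diff w integrable_mult_indicator meas compl(1))
    finally show ?case using UN compl by simp
  next
    case (union A)
    have m: "A i \<in> sets lborel" for i using union(2) by (intro meas) auto
    have "(\<integral>x\<in>(\<Union>i. A i). w x \<partial>lborel) = (\<Sum>i. (\<integral>x\<in>A i. w x \<partial>lborel))"
    proof (rule lebesgue_integral_countable_add)
      show "set_integrable lborel (\<Union> (range A)) w" unfolding set_integrable_def
        using m by (intro integrable_mult_indicator w) auto
    qed (use union m in \<open>auto simp: disjoint_family_on_def\<close>)
    then show ?case using union by simp
  qed (simp add: set_lebesgue_integral_def)
qed

lemma fourier_inversion_AE:
  fixes f :: "real ^ 'd \<Rightarrow> complex"
  assumes f: "integrable lborel f"
    and ft: "integrable lborel ft" and ft_def: "\<And>\<xi>. ft \<xi> = (\<integral>x. f x * cis (- 2 * pi * (\<xi> \<bullet> x)) \<partial>lborel)"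
  shows "AE x in lborel. x \<in> box p q \<longrightarrow> f x = (\<integral>\<xi>. ft \<xi> * cis (2 * pi * (\<xi> \<bullet> x)) \<partial>lborel)"
proof -
  have [measurable]: "f \<in> borel_measurable borel" "ft \<in> borel_measurable borel" using f ft by auto
  define g where "g y = (\<integral>\<xi>. ft \<xi> * cis (2 * pi * (\<xi> \<bullet> y)) \<partial>lborel)" for y :: "real ^ 'd"
  have [measurable]: "g \<in> borel_measurable borel" unfolding g_def by measurable
  have gb: "norm (g y) \<le> (\<integral>\<xi>. norm (ft \<xi>) \<partial>lborel)" for y
    unfolding g_def by (rule order_trans[OF integral_norm_bound]) (simp add: norm_mult)
  have int_f: "integrable lborel (\<lambda>x. indicator (box a b) x *\<^sub>R f x)" for a b
    by (intro integrable_mult_indicator f) simp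
  have int_g: "integrable lborel (\<lambda>x. indicator (box a b) x *\<^sub>R g x)" for a b
  proof (rule Bochner_Integration.integrable_bound)
    show "integrable lborel (\<lambda>y. indicator (box a b) y *\<^sub>R (\<integral>\<xi>. norm (ft \<xi>) \<partial>lborel))"
      using emeasure_bounded_finite[OF bounded_box, of a b]
      by (intro integrable_scaleR_left integrable_real_indicator) auto
  qed (auto simp: indicator_def intro: order_trans[OF gb])
  have box: "(\<integral>x. indicator (box a b) x *\<^sub>R (f x - g x) \<partial>lborel) = 0" for a b
    using fourier_inversion_box[OF f ft ft_def, of a b] int_f[of a b] int_g[of a b]
    by (simp add: scaleR_diff_right g_def[symmetric])
  have "AE x in lborel. indicator (box p q) x *\<^sub>R (f x - g x) = 0"
  proof (rule AE_zero_if_box_integrals_zero)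
    show "integrable lborel (\<lambda>x. indicator (box p q) x *\<^sub>R (f x - g x))"
      using int_f[of p q] int_g[of p q] by (simp add: scaleR_diff_right)
    show "(\<integral>x. indicator (box p q) x *\<^sub>R (f x - g x) \<partial>lborel) = 0" by (rule box)
    fix a b
    obtain a' b' where "box a b \<inter> box p q = box a' (b' :: real ^ 'd)" using box_Int_box by blast
    then have "indicator (box a b) x *\<^sub>R indicator (box p q) x *\<^sub>R (f x - g x) = indicator (box a' b') x *\<^sub>R (f x - g x)" for x
      by (auto simp: indicator_def set_eq_iff)
    then show "(\<integral>x. indicator (box a b) x *\<^sub>R indicator (box p q) x *\<^sub>R (f x - g x) \<partial>lborel) = 0"
      by (simp only: box)
  qed
  then show ?thesis by eventually_elim (auto simp: g_def indicator_def)
qed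

section \<open>Barron functions as lattice series\<close>

lemma one_plus_sum_le_prod:
  fixes t :: "'a \<Rightarrow> real"
  assumes "\<And>i. i \<in> A \<Longrightarrow> t i \<ge> 0"
  shows "1 + (\<Sum>i\<in>A. t i) \<le> (\<Prod>i\<in>A. 1 + t i)"
  using assms
proof (induction A rule: infinite_finite_induct)
  case (insert i A)
  have "1 + (t i + sum t A) \<le> (1 + t i) * (1 + sum t A)"
    using insert.prems by (simp add: algebra_simps sum_nonneg)
  also have "\<dots> \<le> (1 + t i) * (\<Prod>i\<in>A. 1 + t i)"
    using insert by (intro mult_left_mono) auto
  finally show ?case using insert by simp
qed auto

text \<open>
  The lattice is enumerated by the natural numbers, so that the tools for ordinary series of
  functions apply.
\<close>

definition lattice_index :: "nat \<Rightarrow> 'd \<Rightarrow> int" where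
  "lattice_index = from_nat_into UNIV"

definition lattice_vec :: "nat \<Rightarrow> real ^ 'd" where
  "lattice_vec n = (\<chi> i. of_int (lattice_index n i))"

text \<open>
  The bound on all finite partial sums expresses absolute convergence of the weighted coefficients
  together with the size of their sum.
\<close>

definition lattice_expansion :: "real \<Rightarrow> real \<Rightarrow> (real ^ 'd \<Rightarrow> complex) \<Rightarrow> (nat \<Rightarrow> complex) \<Rightarrow> bool" where
  "lattice_expansion s A f a \<longleftrightarrow>
     (\<forall>F. finite F \<longrightarrow> (\<Sum>n\<in>F. (1 + norm (lattice_vec n :: real ^ 'd)) powr s * cmod (a n)) \<le> A) \<and>
     (AE x in lebesgue. x \<in> box 0 1 \<longrightarrow> (\<lambda>n. a n * cis (lattice_vec n \<bullet> x)) sums f x)"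

lemma bij_lattice_index: "bij (lattice_index :: nat \<Rightarrow> 'd::finite \<Rightarrow> int)"
proof -
  have "inj (\<lambda>z :: int. (\<lambda>_ :: 'd. z))" by (simp add: inj_def fun_eq_iff)
  then have "infinite (range (\<lambda>z :: int. (\<lambda>_ :: 'd. z)))"
    using infinite_UNIV_int finite_imageD by blast
  then have "infinite (UNIV :: ('d \<Rightarrow> int) set)" by (rule infinite_super[OF subset_UNIV])
  then show ?thesis unfolding lattice_index_def by (rule bij_betw_from_nat_into[OF countableI_type])
qed

lemma cis_lattice_vec: "cis (lattice_vec n \<bullet> x) = (\<Prod>i\<in>UNIV. cis (of_int (lattice_index n i) * x $ i))"
  by (simp add: lattice_vec_def inner_vec_def cis_sum)

text \<open>
  Moves the weight of the lattice point to \<open>\<eta>\<close>, at the price of a product of one-dimensional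
  weights that the decay of the one-dimensional coefficients absorbs.
\<close>

lemma norm_lattice_vec_le:
  fixes \<eta> :: "real ^ 'd"
  shows "1 + norm (lattice_vec n :: real ^ 'd) \<le> (1 + norm \<eta>) * (\<Prod>i\<in>UNIV. 1 + \<bar>of_int (lattice_index n i) - \<eta> $ i\<bar>)"
proof -
  have "norm (lattice_vec n :: real ^ 'd) \<le> norm \<eta> + norm (lattice_vec n - \<eta>)" by (rule norm_triangle_sub)
  also have "norm (lattice_vec n - \<eta>) \<le> (\<Sum>i\<in>UNIV. \<bar>of_int (lattice_index n i) - \<eta> $ i\<bar>)"
    using norm_le_l1_cart[of "lattice_vec n - \<eta>"] by (simp add: lattice_vec_def)
  finally have "1 + norm (lattice_vec n :: real ^ 'd) \<le> 1 + norm \<eta> + (\<Sum>i\<in>UNIV. \<bar>of_int (lattice_index n i) - \<eta> $ i\<bar>)" by simp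
  also have "\<dots> \<le> (1 + norm \<eta>) * (1 + (\<Sum>i\<in>UNIV. \<bar>of_int (lattice_index n i) - \<eta> $ i\<bar>))"
    by (simp add: algebra_simps sum_nonneg)
  also have "\<dots> \<le> (1 + norm \<eta>) * (\<Prod>i\<in>UNIV. 1 + \<bar>of_int (lattice_index n i) - \<eta> $ i\<bar>)"
    by (intro mult_left_mono one_plus_sum_le_prod) auto
  finally show ?thesis .
qed

lemma sum_prod_le_prod_bound:
  fixes q :: "'d::finite \<Rightarrow> 'k \<Rightarrow> real"
  assumes q: "\<And>i k. q i k \<ge> 0" and bnd: "\<And>i F. finite F \<Longrightarrow> sum (q i) F \<le> C"
    and F: "finite F"
  shows "(\<Sum>g\<in>F. \<Prod>i\<in>UNIV. q i (g i)) \<le> C ^ CARD('d)"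
proof -
  have "(\<Sum>g\<in>F. \<Prod>i\<in>UNIV. q i (g i)) \<le> (\<Sum>g\<in>PiE UNIV (\<lambda>i. (\<lambda>g. g i) ` F). \<Prod>i\<in>UNIV. q i (g i))"
    using F by (intro sum_mono2 finite_PiE) (auto intro!: prod_nonneg q)
  also have "\<dots> = (\<Prod>i\<in>UNIV. \<Sum>k\<in>(\<lambda>g. g i) ` F. q i k)"
    using F by (subst prod_sum_PiE) auto
  also have "\<dots> \<le> (\<Prod>i\<in>(UNIV::'d set). C)"
    using F by (intro prod_mono) (auto intro!: sum_nonneg q bnd)
  finally show ?thesis by simp
qed

lemma has_sum_symmetric_limit:
  fixes f :: "int \<Rightarrow> 'a :: {comm_monoid_add, t2_space}"
  assumes "(f has_sum S) UNIV"
  shows "(\<lambda>N. \<Sum>k = - int N..int N. f k) \<longlonglongrightarrow> S"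
proof -
  have "filterlim (\<lambda>N. {- int N..int N}) (finite_subsets_at_top UNIV) sequentially"
    unfolding filterlim_finite_subsets_at_top
  proof safe
    fix X :: "int set" assume "finite X"
    then have "finite ((\<lambda>k. nat \<bar>k\<bar>) ` X)" by simp
    then obtain M where M: "\<forall>n\<in>(\<lambda>k. nat \<bar>k\<bar>) ` X. n \<le> M" using finite_nat_set_iff_bounded_le by blast
    have "X \<subseteq> {- int N..int N}" if "M \<le> N" for N
    proof
      fix k assume "k \<in> X" 
      then have "nat \<bar>k\<bar> \<le> M" using M by auto
      then show "k \<in> {- int N..int N}" using that by auto
    qed
    then show "\<forall>\<^sub>F N in sequentially. finite {- int N..int N} \<and> X \<subseteq> {- int N..int N} \<and> {- int N..int N} \<subseteq> UNIV"
      by (intro eventually_sequentiallyI[of M]) auto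
  qed
  from filterlim_compose[OF assms[unfolded has_sum_def] this] show ?thesis .
qed

lemma abs_summable_if_bounded:
  fixes f :: "'a \<Rightarrow> complex"
  assumes "\<And>F. finite F \<Longrightarrow> (\<Sum>x\<in>F. norm (f x)) \<le> C"
  shows "(\<lambda>x. norm (f x)) summable_on UNIV"
  by (rule nonneg_bdd_above_summable_on) (use assms in \<open>auto intro!: bdd_aboveI[of _ C]\<close>)

text \<open>
  The product over the coordinates of the one-dimensional expansions.  The exponent \<open>r + 2\<close> of
  their decay leaves \<open>1 / (1 + \<bar>k - \<eta>\<bar>)\<^sup>2\<close> after absorbing the weight \<open>(1 + \<bar>k - \<eta>\<bar>) powr s\<close>, so the
  weighted coefficients have a sum that is bounded uniformly in \<open>\<eta>\<close>.
\<close>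

lemma cis_lattice_expansion:
  fixes s :: real
  assumes s: "s \<ge> 0"
  obtains B :: "nat \<Rightarrow> real ^ 'd \<Rightarrow> complex" and C where "C \<ge> 0" "\<And>n. B n \<in> borel_measurable borel"
    "\<And>\<eta> F. finite F \<Longrightarrow> (\<Sum>n\<in>F. (1 + norm (lattice_vec n :: real ^ 'd)) powr s * cmod (B n \<eta>)) \<le> C * (1 + norm \<eta>) powr s"
    "\<And>\<eta> x. x \<in> cbox 0 1 \<Longrightarrow> (\<lambda>n. B n \<eta> * cis (lattice_vec n \<bullet> x)) sums cis (\<eta> \<bullet> x)"
proof -
  define r where "r = nat \<lceil>s\<rceil>"
  obtain b :: "real \<Rightarrow> complex" and C where b: "continuous_on UNIV b" "\<And>u. (1 + \<bar>u\<bar>) ^ (r + 2) * cmod (b u) \<le> C"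
    "\<And>\<eta> x. 0 \<le> x \<Longrightarrow> x \<le> 1 \<Longrightarrow> (\<lambda>N. \<Sum>k = - int N..int N. b (of_int k - \<eta>) * cis (of_int k * x)) \<longlonglongrightarrow> cis (\<eta> * x)"
    using cis_expansion_1d[of "r + 2"] by blast
  obtain C2 :: real where C2: "C2 \<ge> 0" "\<And>u F. finite F \<Longrightarrow> (\<Sum>k\<in>F. 1 / (1 + \<bar>of_int k - u\<bar>)\<^sup>2) \<le> C2"
    by (rule shifted_inverse_squares) blast
  have C: "C \<ge> 0" using order_trans[OF norm_ge_zero[of "b 0"]] b(2)[of 0] by simp
  have [measurable]: "b \<in> borel_measurable borel" using b(1) by (rule borel_measurable_continuous_onI)
  define q where "q \<eta> i k = (1 + \<bar>of_int k - \<eta> $ i\<bar>) powr s * cmod (b (of_int k - \<eta> $ i))" for \<eta> :: "real ^ 'd" and i k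
  have q0: "q \<eta> i k \<ge> 0" for \<eta> i k by (simp add: q_def)
  have bq: "cmod (b (of_int k - \<eta> $ i)) \<le> q \<eta> i k" for \<eta> :: "real ^ 'd" and i k
    using s mult_right_mono[OF ge_one_powr_ge_zero[of "1 + \<bar>of_int k - \<eta> $ i\<bar>" s]] by (simp add: q_def)
  have qle: "q \<eta> i k \<le> C * (1 / (1 + \<bar>of_int k - \<eta> $ i\<bar>)\<^sup>2)" for \<eta> :: "real ^ 'd" and i k
  proof -
    define t where "t = 1 + \<bar>of_int k - \<eta> $ i\<bar>"
    have t: "t \<ge> 1" by (simp add: t_def)
    have "t powr s \<le> t powr real r" using t by (intro powr_mono) (auto simp: r_def real_nat_ceiling_ge)
    also have "\<dots> = t ^ r" using t by (simp add: powr_realpow)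
    finally have "t powr s * cmod (b (of_int k - \<eta> $ i)) \<le> t ^ r * cmod (b (of_int k - \<eta> $ i))"
      by (intro mult_right_mono) auto
    also have "\<dots> = (t ^ (r + 2) * cmod (b (of_int k - \<eta> $ i))) * (1 / t\<^sup>2)"
      using t by (simp add: power_add power2_eq_square)
    also have "\<dots> \<le> C * (1 / t\<^sup>2)"
      unfolding t_def by (intro mult_right_mono b(2)) auto
    finally show ?thesis by (simp add: q_def t_def)
  qed
  have qsum: "sum (q \<eta> i) F \<le> C * C2" if "finite F" for \<eta> :: "real ^ 'd" and i F
  proof -
    have "sum (q \<eta> i) F \<le> (\<Sum>k\<in>F. C * (1 / (1 + \<bar>of_int k - \<eta> $ i\<bar>)\<^sup>2))" by (intro sum_mono qle)
    also have "\<dots> \<le> C * C2" unfolding sum_distrib_left[symmetric] by (intro mult_left_mono C2 C that)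
    finally show ?thesis .
  qed
  define B where "B n \<eta> = (\<Prod>i\<in>UNIV. b (of_int (lattice_index n i) - \<eta> $ i))" for n and \<eta> :: "real ^ 'd"
  show ?thesis
  proof (rule that)
    show "(C * C2) ^ CARD('d) \<ge> 0" using C C2 by simp
    show "B n \<in> borel_measurable borel" for n unfolding B_def by measurable
    show "(\<Sum>n\<in>F. (1 + norm (lattice_vec n :: real ^ 'd)) powr s * cmod (B n \<eta>)) \<le> (C * C2) ^ CARD('d) * (1 + norm \<eta>) powr s"
      if F: "finite F" for \<eta> F
    proof -
      have "(1 + norm (lattice_vec n :: real ^ 'd)) powr s * cmod (B n \<eta>) \<le> (1 + norm \<eta>) powr s * (\<Prod>i\<in>UNIV. q \<eta> i (lattice_index n i))" for n
      proof -
        have "(1 + norm (lattice_vec n :: real ^ 'd)) powr s \<le> ((1 + norm \<eta>) * (\<Prod>i\<in>UNIV. 1 + \<bar>of_int (lattice_index n i) - \<eta> $ i\<bar>)) powr s"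
          by (intro powr_mono2 s norm_lattice_vec_le) auto
        also have "\<dots> = (1 + norm \<eta>) powr s * (\<Prod>i\<in>UNIV. (1 + \<bar>of_int (lattice_index n i) - \<eta> $ i\<bar>) powr s)"
          by (subst powr_mult) (auto intro!: prod_nonneg simp: prod_powr_distrib)
        finally have "(1 + norm (lattice_vec n :: real ^ 'd)) powr s * cmod (B n \<eta>) \<le> \<dots> * cmod (B n \<eta>)"
          by (intro mult_right_mono) auto
        then show ?thesis by (simp add: B_def q_def prod.distrib prod_norm mult.assoc)
      qed
      then have "(\<Sum>n\<in>F. (1 + norm (lattice_vec n :: real ^ 'd)) powr s * cmod (B n \<eta>)) \<le> (\<Sum>n\<in>F. (1 + norm \<eta>) powr s * (\<Prod>i\<in>UNIV. q \<eta> i (lattice_index n i)))"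
        by (rule sum_mono)
      also have "\<dots> = (1 + norm \<eta>) powr s * (\<Sum>g\<in>lattice_index ` F. \<Prod>i\<in>UNIV. q \<eta> i (g i))"
        using bij_lattice_index by (subst sum.reindex) (auto simp: sum_distrib_left inj_on_def bij_def)
      also have "\<dots> \<le> (1 + norm \<eta>) powr s * (C * C2) ^ CARD('d)"
        by (intro mult_left_mono sum_prod_le_prod_bound q0 qsum) (use F in auto)
      finally show ?thesis by (simp add: mult.commute)
    qed
    show "(\<lambda>n. B n \<eta> * cis (lattice_vec n \<bullet> x)) sums cis (\<eta> \<bullet> x)" if x: "x \<in> cbox 0 1" for \<eta> x :: "real ^ 'd"
    proof -
      define t where "t i k = b (of_int k - \<eta> $ i) * cis (of_int k * x $ i)" for i k
      have abs1: "(\<lambda>k. norm (t i k)) summable_on UNIV" for i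
      proof (rule abs_summable_if_bounded)
        fix F :: "int set" assume "finite F"
        then show "(\<Sum>k\<in>F. cmod (t i k)) \<le> C * C2"
          using order_trans[OF sum_mono qsum, of F "\<lambda>k. cmod (t i k)" \<eta> i] bq by (simp add: t_def norm_mult)
      qed
      have absd: "(\<lambda>g. norm (\<Prod>i\<in>UNIV. t i (g i))) summable_on UNIV"
      proof (rule abs_summable_if_bounded)
        fix F :: "('d \<Rightarrow> int) set" assume F: "finite F"
        have "(\<Sum>g\<in>F. cmod (\<Prod>i\<in>UNIV. t i (g i))) \<le> (\<Sum>g\<in>F. \<Prod>i\<in>UNIV. q \<eta> i (g i))"
          by (intro sum_mono) (auto simp: prod_norm[symmetric] t_def norm_mult intro!: prod_mono bq)
        also have "\<dots> \<le> (C * C2) ^ CARD('d)" by (intro sum_prod_le_prod_bound q0 qsum F) auto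
        finally show "(\<Sum>g\<in>F. cmod (\<Prod>i\<in>UNIV. t i (g i))) \<le> (C * C2) ^ CARD('d)" .
      qed
      have lim: "infsum (t i) UNIV = cis (\<eta> $ i * x $ i)" for i
      proof (rule LIMSEQ_unique)
        show "(\<lambda>N. \<Sum>k = - int N..int N. t i k) \<longlonglongrightarrow> infsum (t i) UNIV"
          by (rule has_sum_symmetric_limit) (use abs1[of i] in \<open>auto intro: has_sum_infsum abs_summable_summable\<close>)
        show "(\<lambda>N. \<Sum>k = - int N..int N. t i k) \<longlonglongrightarrow> cis (\<eta> $ i * x $ i)"
          unfolding t_def by (rule b(3)) (use x in \<open>auto simp: mem_box_cart\<close>)
      qed
      have "infsum (\<lambda>g. \<Prod>i\<in>UNIV. t i (g i)) (PiE UNIV (\<lambda>_. UNIV)) = (\<Prod>i\<in>UNIV. infsum (t i) UNIV)"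
        by (rule infsum_prod_PiE_abs) (auto intro: abs1)
      also have "\<dots> = cis (\<eta> \<bullet> x)" by (simp add: lim inner_vec_def cis_sum)
      finally have "((\<lambda>g. \<Prod>i\<in>UNIV. t i (g i)) has_sum cis (\<eta> \<bullet> x)) UNIV"
        using has_sum_infsum[OF abs_summable_summable[OF absd]] by (simp add: PiE_UNIV_domain)
      then have "((\<lambda>n. \<Prod>i\<in>UNIV. t i (lattice_index n i)) has_sum cis (\<eta> \<bullet> x)) UNIV"
        using has_sum_reindex_bij_betw[OF bij_lattice_index, of "\<lambda>g. \<Prod>i\<in>UNIV. t i (g i)"] by simp
      then have "(\<lambda>n. \<Prod>i\<in>UNIV. t i (lattice_index n i)) sums cis (\<eta> \<bullet> x)" by (rule has_sum_imp_sums)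
      then show ?thesis by (simp add: t_def B_def prod.distrib cis_lattice_vec)
    qed
  qed
qed

lemma completion_ex_borel_complex:
  fixes f :: "'a::euclidean_space \<Rightarrow> complex"
  assumes "f \<in> borel_measurable lebesgue"
  obtains g where "g \<in> borel_measurable borel" "AE x in lborel. f x = g x"
proof -
  have m: "(\<lambda>x. Re (f x)) \<in> borel_measurable lebesgue" "(\<lambda>x. Im (f x)) \<in> borel_measurable lebesgue"
    using assms by measurable
  obtain u where u: "u \<in> borel_measurable lborel" "AE x in lborel. Re (f x) = u x"
    using completion_ex_borel_measurable_real[OF m(1)] by blast
  obtain v where v: "v \<in> borel_measurable lborel" "AE x in lborel. Im (f x) = v x"
    using completion_ex_borel_measurable_real[OF m(2)] by blast
  show ?thesis
  proof (rule that)
    show "(\<lambda>x. Complex (u x) (v x)) \<in> borel_measurable borel"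
      using u(1) v(1) by (simp add: borel_measurable_complex_iff)
    show "AE x in lborel. f x = Complex (u x) (v x)"
      using u(2) v(2) by eventually_elim (simp add: complex_eq_iff)
  qed
qed

text \<open>
  With \<open>ft\<close> the Fourier transform of \<open>fe\<close>, in \<open>fe x = \<integral>\<xi>. ft \<xi> * cis (2 * pi * (\<xi> \<bullet> x))\<close> each
  character is expanded over the lattice, and sum and
  integral are exchanged: \<open>a n\<close> is the integral of \<open>ft\<close> against the coefficient \<open>B n\<close>.  The estimate
  survives because the expansion of frequency \<open>2 * pi * \<xi>\<close> costs at most a constant times
  \<open>(1 + \<bar>\<xi>\<bar>) powr s\<close>.
\<close>

lemma lattice_representation:
  fixes s :: real
  assumes s: "s \<ge> 0"
  obtains C where "C > 0" "\<And>(fe :: real ^ 'd \<Rightarrow> complex) N. integrable lebesgue fe \<Longrightarrow> N \<ge> 0 \<Longrightarrow>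
    (\<integral>\<^sup>+ \<xi>. ennreal ((1 + norm \<xi>) powr s * norm (fourier fe \<xi>)) \<partial>lebesgue) \<le> ennreal N \<Longrightarrow>
    \<exists>a. lattice_expansion s (C * N) fe a"
proof -
  obtain B :: "nat \<Rightarrow> real ^ 'd \<Rightarrow> complex" and C where C: "C \<ge> 0" and [measurable]: "\<And>n. B n \<in> borel_measurable borel"
    and Bsum: "\<And>\<eta> F. finite F \<Longrightarrow> (\<Sum>n\<in>F. (1 + norm (lattice_vec n :: real ^ 'd)) powr s * cmod (B n \<eta>)) \<le> C * (1 + norm \<eta>) powr s"
    and Bsums: "\<And>\<eta> x. x \<in> cbox 0 1 \<Longrightarrow> (\<lambda>n. B n \<eta> * cis (lattice_vec n \<bullet> x)) sums cis (\<eta> \<bullet> x)"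
    by (rule cis_lattice_expansion[OF s, where 'd = 'd]) blast
  define C' where "C' = C * (2 * pi) powr s"
  have C': "C' \<ge> 0" using C by (simp add: C'_def)
  define w where "w n = (1 + norm (lattice_vec n :: real ^ 'd)) powr s" for n
  have w1: "w n \<ge> 1" for n unfolding w_def using s by (intro ge_one_powr_ge_zero) auto
  have Bsum': "(\<Sum>n\<in>F. w n * cmod (B n ((2 * pi) *\<^sub>R \<xi>))) \<le> C' * (1 + norm \<xi>) powr s" if "finite F" for F \<xi>
  proof -
    have "(\<Sum>n\<in>F. w n * cmod (B n ((2 * pi) *\<^sub>R \<xi>))) \<le> C * (1 + norm ((2 * pi) *\<^sub>R \<xi>)) powr s"
      unfolding w_def by (rule Bsum[OF that])
    also have "\<dots> \<le> C * ((2 * pi) * (1 + norm \<xi>)) powr s"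
      using pi_gt3 by (intro mult_left_mono C powr_mono2 s) (auto simp: algebra_simps)
    also have "\<dots> = C' * (1 + norm \<xi>) powr s" by (simp add: C'_def powr_mult)
    finally show ?thesis .
  qed
  show ?thesis
  proof (rule that[of "C' + 1"])
    show "C' + 1 > 0" using C' by simp
    fix fe :: "real ^ 'd \<Rightarrow> complex" and N :: real
    assume fe: "integrable lebesgue fe" and N: "N \<ge> 0"
      and le: "(\<integral>\<^sup>+ \<xi>. ennreal ((1 + norm \<xi>) powr s * norm (fourier fe \<xi>)) \<partial>lebesgue) \<le> ennreal N"
    obtain f where [measurable]: "f \<in> borel_measurable borel" and fef: "AE x in lborel. fe x = f x"
      by (rule completion_ex_borel_complex[OF borel_measurable_integrable[OF fe]])
    have fef': "AE x in lebesgue. fe x = f x" using fef by (rule AE_completion)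
    have fm: "f \<in> borel_measurable lebesgue" by (simp add: measurable_completion)
    have "integrable lebesgue f"
      by (rule integrable_cong_AE_imp[OF fe fm]) (use fef' in auto)
    then have f: "integrable lborel f" by (subst (asm) integrable_completion) auto
    define ft where "ft \<xi> = (\<integral>x. f x * cis (- 2 * pi * (\<xi> \<bullet> x)) \<partial>lborel)" for \<xi>
    have [measurable]: "ft \<in> borel_measurable borel" unfolding ft_def by measurable
    have ft: "fourier fe \<xi> = ft \<xi>" for \<xi>
    proof -
      have "fourier fe \<xi> = (LINT x|lebesgue. f x * cis (- 2 * pi * (\<xi> \<bullet> x)))"
        unfolding fourier_def
      proof (rule integral_cong_AE)
        show "AE x in lebesgue. fe x * exp (- 2 * of_real pi * \<i> * of_real (\<xi> \<bullet> x)) = f x * cis (- 2 * pi * (\<xi> \<bullet> x))"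
          using fef' by eventually_elim (simp add: cis_conv_exp mult_ac)
        show "(\<lambda>x. fe x * exp (- 2 * of_real pi * \<i> * of_real (\<xi> \<bullet> x))) \<in> borel_measurable lebesgue"
          by (rule borel_measurable_times[OF borel_measurable_integrable[OF fe]], rule measurable_completion) measurable
        show "(\<lambda>x. f x * cis (- 2 * pi * (\<xi> \<bullet> x))) \<in> borel_measurable lebesgue"
          by (intro measurable_completion) measurable
      qed
      also have "\<dots> = ft \<xi>" unfolding ft_def by (rule integral_completion) measurable
      finally show ?thesis .
    qed
    define G where "G \<xi> = (1 + norm \<xi>) powr s * norm (ft \<xi>)" for \<xi>
    have [measurable]: "G \<in> borel_measurable borel" unfolding G_def by measurable
    have G0: "G \<xi> \<ge> 0" for \<xi> by (simp add: G_def)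
    have Gle: "(\<integral>\<^sup>+ \<xi>. ennreal (G \<xi>) \<partial>lborel) \<le> ennreal N"
      using le by (simp add: ft G_def nn_integral_completion)
    have G: "integrable lborel G"
      by (rule integrableI_nonneg) (auto simp: G0 intro!: AE_I2 le_less_trans[OF Gle])
    have GN: "(\<integral>\<xi>. G \<xi> \<partial>lborel) \<le> N"
      using Gle N G0 by (subst (asm) nn_integral_eq_integral[OF G]) (auto simp: integral_nonneg_AE)
    have ftG: "norm (ft \<xi>) \<le> G \<xi>" for \<xi>
      unfolding G_def using mult_right_mono[OF ge_one_powr_ge_zero[of "1 + norm \<xi>" s], of "norm (ft \<xi>)"] s by simp
    have ft_int: "integrable lborel ft"
      by (rule Bochner_Integration.integrable_bound[OF G]) (auto intro!: order_trans[OF ftG])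
    let ?k = "\<lambda>n \<xi>. ft \<xi> * B n ((2 * pi) *\<^sub>R \<xi>)"
    have finle: "(\<Sum>n\<in>F. w n * norm (?k n \<xi>)) \<le> C' * G \<xi>" if "finite F" for F \<xi>
      using mult_left_mono[OF Bsum'[OF that], of "norm (ft \<xi>)" \<xi>]
      by (simp add: G_def norm_mult sum_distrib_left mult_ac)
    have le1: "w n * norm (?k n \<xi>) \<le> C' * G \<xi>" for n \<xi>
      using finle[of "{n}" \<xi>] by simp
    have intB: "integrable lborel (\<lambda>\<xi>. ?k n \<xi>)" for n
    proof (rule Bochner_Integration.integrable_bound)
      show "integrable lborel (\<lambda>\<xi>. C' * G \<xi>)" using G by simp
      have "norm (?k n \<xi>) \<le> C' * G \<xi>" for \<xi>
        using le1[of n \<xi>] mult_right_mono[OF w1[of n], of "norm (?k n \<xi>)"] by simp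
      then show "AE \<xi> in lborel. norm (?k n \<xi>) \<le> norm (C' * G \<xi>)"
        unfolding real_norm_def by (intro AE_I2) (rule order_trans[OF _ abs_ge_self])
    qed measurable
    define a where "a n = (\<integral>\<xi>. ?k n \<xi> \<partial>lborel)" for n
    define D where "D n = (\<integral>\<xi>. norm (?k n \<xi>) \<partial>lborel)" for n
    have aD: "cmod (a n) \<le> D n" for n unfolding a_def D_def by (rule integral_norm_bound)
    have Dsum: "(\<Sum>n\<in>F. w n * D n) \<le> C' * N" if "finite F" for F
    proof -
      have "(\<Sum>n\<in>F. w n * D n) = (\<integral>\<xi>. (\<Sum>n\<in>F. w n * norm (?k n \<xi>)) \<partial>lborel)"
        unfolding D_def using intB by (subst Bochner_Integration.integral_sum) auto
      also have "\<dots> \<le> (\<integral>\<xi>. C' * G \<xi> \<partial>lborel)"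
        using intB G finle[OF that] by (intro integral_mono Bochner_Integration.integrable_sum integrable_mult_right) auto
      also have "\<dots> \<le> C' * N" using GN C' by (simp add: mult_left_mono)
      finally show ?thesis .
    qed
    have D0: "D n \<ge> 0" for n by (simp add: D_def)
    have summD: "summable D"
    proof (rule bounded_imp_summable)
      show "sum D {..n} \<le> C' * N" for n
      proof -
        have "sum D {..n} \<le> (\<Sum>k\<le>n. w k * D k)"
          by (intro sum_mono) (use mult_right_mono[OF w1 D0] in auto)
        also have "\<dots> \<le> C' * N" by (rule Dsum) simp
        finally show ?thesis .
      qed
    qed (rule D0)
    show "\<exists>a. lattice_expansion s ((C' + 1) * N) fe a"
      unfolding lattice_expansion_def
    proof (intro exI[of _ a] conjI allI impI)
      fix F :: "nat set" assume F: "finite F"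
      have "(\<Sum>n\<in>F. w n * cmod (a n)) \<le> (\<Sum>n\<in>F. w n * D n)"
        by (intro sum_mono mult_left_mono aD) (auto simp: w_def)
      also have "\<dots> \<le> (C' + 1) * N" using Dsum[OF F] N by (simp add: algebra_simps)
      finally show "(\<Sum>n\<in>F. (1 + norm (lattice_vec n :: real ^ 'd)) powr s * cmod (a n)) \<le> (C' + 1) * N" by (simp add: w_def)
    next
      have "AE x in lborel. x \<in> box 0 1 \<longrightarrow> f x = (\<integral>\<xi>. ft \<xi> * cis (2 * pi * (\<xi> \<bullet> x)) \<partial>lborel)"
        by (rule fourier_inversion_AE[OF f ft_int]) (simp add: ft_def)
      then have "AE x in lborel. x \<in> box 0 1 \<longrightarrow> (\<lambda>n. a n * cis (lattice_vec n \<bullet> x)) sums fe x"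
        using fef
      proof eventually_elim
        case (elim x)
        show ?case
        proof
          assume x: "x \<in> box 0 1"
          then have xc: "x \<in> cbox 0 1" using box_subset_cbox by blast
          have "(\<lambda>n. \<integral>\<xi>. ?k n \<xi> * cis (lattice_vec n \<bullet> x) \<partial>lborel) sums
            (\<integral>\<xi>. (\<Sum>n. ?k n \<xi> * cis (lattice_vec n \<bullet> x)) \<partial>lborel)"
          proof (rule sums_integral)
            show "integrable lborel (\<lambda>\<xi>. ?k n \<xi> * cis (lattice_vec n \<bullet> x))" for n
              using intB by (rule integrable_mult_left)
            show "AE \<xi> in lborel. summable (\<lambda>n. norm (?k n \<xi> * cis (lattice_vec n \<bullet> x)))"
            proof (intro AE_I2 bounded_imp_summable)
              fix \<xi> m
              have "(\<Sum>n\<le>m. norm (?k n \<xi> * cis (lattice_vec n \<bullet> x))) \<le> (\<Sum>n\<le>m. w n * norm (?k n \<xi>))"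
                by (intro sum_mono) (use mult_right_mono[OF w1] in \<open>auto simp: norm_mult\<close>)
              also have "\<dots> \<le> C' * G \<xi>" by (rule finle) simp
              finally show "(\<Sum>n\<le>m. norm (?k n \<xi> * cis (lattice_vec n \<bullet> x))) \<le> C' * G \<xi>" .
            qed auto
            show "summable (\<lambda>n. \<integral>\<xi>. norm (?k n \<xi> * cis (lattice_vec n \<bullet> x)) \<partial>lborel)"
              using summD by (simp add: D_def[abs_def] norm_mult)
          qed
          also have "(\<lambda>n. \<integral>\<xi>. ?k n \<xi> * cis (lattice_vec n \<bullet> x) \<partial>lborel) = (\<lambda>n. a n * cis (lattice_vec n \<bullet> x))"
            by (simp add: a_def)
          also have "(\<lambda>\<xi>. \<Sum>n. ?k n \<xi> * cis (lattice_vec n \<bullet> x)) = (\<lambda>\<xi>. ft \<xi> * cis (2 * pi * (\<xi> \<bullet> x)))"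
          proof
            fix \<xi>
            have "(\<lambda>n. ft \<xi> * (B n ((2 * pi) *\<^sub>R \<xi>) * cis (lattice_vec n \<bullet> x))) sums (ft \<xi> * cis (((2 * pi) *\<^sub>R \<xi>) \<bullet> x))"
              by (intro sums_mult Bsums xc)
            then show "(\<Sum>n. ?k n \<xi> * cis (lattice_vec n \<bullet> x)) = ft \<xi> * cis (2 * pi * (\<xi> \<bullet> x))"
              by (simp add: sums_iff mult.assoc)
          qed
          finally show "(\<lambda>n. a n * cis (lattice_vec n \<bullet> x)) sums fe x" using elim x by simp
        qed
      qed
      then show "AE x in lebesgue. x \<in> box 0 1 \<longrightarrow> (\<lambda>n. a n * cis (lattice_vec n \<bullet> x)) sums fe x"
        by (rule AE_completion)
    qed
  qed
qed

text \<open>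
  The infimum in the Barron norm need not be attained, so an extension within a factor \<open>2\<close> of it
  is used.  None may exist if the norm is \<open>0\<close>; but then \<open>f\<close> has expansions with arbitrarily small
  coefficient sums, which bound \<open>\<bar>f\<bar>\<close>, so \<open>f\<close> vanishes almost everywhere on the cube.
\<close>

lemma barron_lattice_coefficients:
  fixes s :: real
  assumes s: "s \<ge> 0"
  obtains C where "C > 0" "\<And>f :: real ^ 'd \<Rightarrow> complex. f \<in> barron_space s unit_cube \<Longrightarrow>
    \<exists>a. lattice_expansion s (C * enn2real (barron_norm s unit_cube f)) f a"
proof -
  obtain C where C: "C > 0" and rep: "\<And>(fe :: real ^ 'd \<Rightarrow> complex) N. integrable lebesgue fe \<Longrightarrow> N \<ge> 0 \<Longrightarrow>
    (\<integral>\<^sup>+ \<xi>. ennreal ((1 + norm \<xi>) powr s * norm (fourier fe \<xi>)) \<partial>lebesgue) \<le> ennreal N \<Longrightarrow>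
    \<exists>a. lattice_expansion s (C * N) fe a"
    by (rule lattice_representation[OF s, where 'd = 'd]) blast
  show ?thesis
  proof (rule that[of "2 * C"])
    show "2 * C > 0" using C by simp
    fix f :: "real ^ 'd \<Rightarrow> complex" assume f: "f \<in> barron_space s unit_cube"
    define \<beta> where "\<beta> = enn2real (barron_norm s unit_cube f)"
    have \<beta>: "barron_norm s unit_cube f = ennreal \<beta>" "\<beta> \<ge> 0" using f by (auto simp: \<beta>_def barron_space_def)
    have rep': "\<exists>a. lattice_expansion s (C * N) f a" if N: "N > \<beta>" for N
    proof -
      have "barron_norm s unit_cube f < ennreal N" using \<beta> N by (simp add: ennreal_less_iff)
      then obtain fe where fe: "fe \<in> L1_extensions unit_cube f"
          "(\<integral>\<^sup>+ \<xi>. ennreal ((1 + norm \<xi>) powr s * norm (fourier fe \<xi>)) \<partial>lebesgue) < ennreal N"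
        unfolding barron_norm_def INF_less_iff by blast
      obtain a where a: "\<forall>F. finite F \<longrightarrow> (\<Sum>n\<in>F. (1 + norm (lattice_vec n :: real ^ 'd)) powr s * cmod (a n)) \<le> C * N"
          "AE x in lebesgue. x \<in> box 0 1 \<longrightarrow> (\<lambda>n. a n * cis (lattice_vec n \<bullet> x)) sums fe x"
        using rep[of fe N] fe \<beta>(2) N by (auto simp: L1_extensions_def lattice_expansion_def less_imp_le)
      have "AE x in lebesgue. x \<in> unit_cube \<longrightarrow> fe x = f x" using fe(1) by (simp add: L1_extensions_def)
      with a(2) have "AE x in lebesgue. x \<in> box 0 1 \<longrightarrow> (\<lambda>n. a n * cis (lattice_vec n \<bullet> x)) sums f x"
        by eventually_elim (use box_subset_cbox[of 0 "1 :: real ^ 'd"] in \<open>auto simp: unit_cube_def\<close>)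
      then show ?thesis using a(1) unfolding lattice_expansion_def by blast
    qed
    show "\<exists>a. lattice_expansion s (2 * C * enn2real (barron_norm s unit_cube f)) f a"
      unfolding \<beta>_def[symmetric]
    proof (cases "\<beta> = 0")
      case False
      then show "\<exists>a. lattice_expansion s (2 * C * \<beta>) f a"
        using rep'[of "2 * \<beta>"] \<beta>(2) by (simp add: mult_ac)
    next
      case True
      have small: "AE x in lebesgue. x \<in> box 0 1 \<longrightarrow> norm (f x) \<le> C * (1 / real (Suc j))" for j
      proof -
        obtain a where a: "\<forall>F. finite F \<longrightarrow> (\<Sum>n\<in>F. (1 + norm (lattice_vec n :: real ^ 'd)) powr s * cmod (a n)) \<le> C * (1 / real (Suc j))"
          "AE x in lebesgue. x \<in> box 0 1 \<longrightarrow> (\<lambda>n. a n * cis (lattice_vec n \<bullet> x)) sums f x"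
          using rep'[of "1 / real (Suc j)"] True by (auto simp: lattice_expansion_def)
        have le: "norm z \<le> C * (1 / real (Suc j))" if z: "(\<lambda>n. a n * cis (lattice_vec n \<bullet> x)) sums z" for x :: "real ^ 'd" and z
        proof (rule tendsto_upperbound)
          show "(\<lambda>N. norm (\<Sum>n<N. a n * cis (lattice_vec n \<bullet> x))) \<longlonglongrightarrow> norm z"
            using z unfolding sums_def by (rule tendsto_norm)
          have "norm (\<Sum>n<N. a n * cis (lattice_vec n \<bullet> x)) \<le> C * (1 / real (Suc j))" for N
          proof -
            have "norm (\<Sum>n<N. a n * cis (lattice_vec n \<bullet> x)) \<le> (\<Sum>n<N. (1 + norm (lattice_vec n :: real ^ 'd)) powr s * cmod (a n))"
            proof (rule sum_norm_le)
              fix n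
              have "1 * cmod (a n) \<le> (1 + norm (lattice_vec n :: real ^ 'd)) powr s * cmod (a n)"
                using s by (intro mult_right_mono ge_one_powr_ge_zero) auto
              then show "norm (a n * cis (lattice_vec n \<bullet> x)) \<le> (1 + norm (lattice_vec n :: real ^ 'd)) powr s * cmod (a n)"
                by (simp add: norm_mult)
            qed
            also have "\<dots> \<le> C * (1 / real (Suc j))" using a(1) by blast
            finally show ?thesis .
          qed
          then show "\<forall>\<^sub>F N in sequentially. norm (\<Sum>n<N. a n * cis (lattice_vec n \<bullet> x)) \<le> C * (1 / real (Suc j))"
            by (intro always_eventually allI)
        qed simp
        from a(2) show ?thesis by eventually_elim (use le in blast)
      qed
      then have "AE x in lebesgue. \<forall>j. x \<in> box 0 1 \<longrightarrow> norm (f x) \<le> C * (1 / real (Suc j))"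
        by (subst AE_all_countable) auto
      then have "AE x in lebesgue. x \<in> box 0 1 \<longrightarrow> (\<lambda>n. 0 * cis (lattice_vec n \<bullet> x)) sums f x"
      proof eventually_elim
        case (elim x)
        show ?case
        proof
          assume x: "x \<in> box 0 1"
          have "(\<lambda>j. C * (1 / real (Suc j))) \<longlonglongrightarrow> C * 0"
            by (intro tendsto_mult_left LIMSEQ_Suc[OF lim_1_over_n])
          then have "norm (f x) \<le> C * 0"
            by (rule tendsto_lowerbound) (use elim x in auto)
          then show "(\<lambda>n. 0 * cis (lattice_vec n \<bullet> x)) sums f x" by simp
        qed
      qed
      then show "\<exists>a. lattice_expansion s (2 * C * \<beta>) f a"
        by (intro exI[of _ "\<lambda>_. 0"]) (simp add: True lattice_expansion_def)
    qed
  qed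
qed

section \<open>Square integrals of lattice series\<close>

text \<open>
  A period cell of the characters \<open>cis (k \<bullet> x)\<close> that contains the unit cube.
\<close>

definition torus :: "(real ^ 'd) set" where
  "torus = cbox (\<chi> i. - pi) (\<chi> i. pi)"

lemma torus_sets [measurable]: "torus \<in> sets borel"
  by (simp add: torus_def)

lemma finite_measure_torus: "finite_measure (restrict_space lborel (torus :: (real ^ 'd) set))"
  by (rule finite_measureI)
     (use emeasure_bounded_finite[OF bounded_cbox, of "(\<chi> i. - pi) :: real ^ 'd" "\<chi> i. pi"]
       in \<open>auto simp: emeasure_restrict_space torus_def space_restrict_space\<close>)

lemma box_subset_torus: "box 0 1 \<subseteq> (torus :: (real ^ 'd) set)"
proof
  fix x :: "real ^ 'd" assume "x \<in> box 0 1"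
  then have "0 < x $ i \<and> x $ i < 1" for i by (simp add: mem_box_cart)
  then have "- pi \<le> x $ i \<and> x $ i \<le> pi" for i using pi_gt3 by (smt (verit))
  then show "x \<in> torus" by (simp add: torus_def mem_box_cart)
qed

lemma torus_orthogonal:
  "(\<integral>x. cis (lattice_vec m \<bullet> x) * cnj (cis (lattice_vec n \<bullet> x)) \<partial>restrict_space lborel (torus :: (real ^ 'd) set))
    = (if m = n then of_real ((2 * pi) ^ CARD('d)) else 0)"
proof -
  define g where "g i t = indicator {-pi..pi} t *\<^sub>R (cis (of_int (lattice_index m i) * t) * cnj (cis (of_int (lattice_index n i) * t)))" for i :: 'd and t
  have gi: "integrable lborel (g i)" for i
    unfolding g_def
    by (rule Bochner_Integration.integrable_bound[where f = "indicator {-pi..pi} :: real \<Rightarrow> real"])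
       (auto simp: indicator_def norm_mult)
  have gint: "(\<integral>t. g i t \<partial>lborel) = (if lattice_index m i = lattice_index n i then of_real (2 * pi) else 0)" for i
    using circle_orthogonal[of "lattice_index m i" "lattice_index n i"]
    by (simp add: g_def integral_restrict_space)
  have pt: "indicator torus x *\<^sub>R (cis (lattice_vec m \<bullet> x) * cnj (cis (lattice_vec n \<bullet> x))) = (\<Prod>i\<in>UNIV. g i (x $ i))" for x :: "real ^ 'd"
  proof (cases "x \<in> torus")
    case True
    then have "g i (x $ i) = cis (of_int (lattice_index m i) * x $ i) * cnj (cis (of_int (lattice_index n i) * x $ i))" for i
      by (auto simp: g_def torus_def mem_box_cart)
    then show ?thesis using True by (simp add: cis_lattice_vec prod.distrib)
  next
    case False
    then obtain i where "x $ i \<notin> {-pi..pi}" by (auto simp: torus_def mem_box_cart)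
    then have "g i (x $ i) = 0" by (simp add: g_def)
    then have "(\<Prod>i\<in>UNIV. g i (x $ i)) = 0" by (intro prod_zero) auto
    then show ?thesis using False by simp
  qed
  have "(\<integral>x. cis (lattice_vec m \<bullet> x) * cnj (cis (lattice_vec n \<bullet> x)) \<partial>restrict_space lborel (torus :: (real ^ 'd) set))
     = (\<integral>x. (\<Prod>i\<in>UNIV. g i ((x :: real ^ 'd) $ i)) \<partial>lborel)"
    by (subst integral_restrict_space) (auto simp: pt)
  also have "\<dots> = (\<Prod>i\<in>(UNIV :: 'd set). if lattice_index m i = lattice_index n i then of_real (2 * pi) else 0)"
    by (subst integral_prod_vec[OF gi]) (simp add: gint)
  also have "\<dots> = (if m = n then of_real ((2 * pi) ^ CARD('d)) else 0)"
  proof (cases "m = n")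
    case False
    then have "(lattice_index m :: 'd \<Rightarrow> int) \<noteq> lattice_index n"
      using inj_eq[OF bij_is_inj[OF bij_lattice_index]] by blast
    then obtain i :: 'd where "lattice_index m i \<noteq> lattice_index n i" by (auto simp: fun_eq_iff)
    then have "\<exists>i\<in>UNIV. (if lattice_index m i = lattice_index n (i::'d) then complex_of_real (2 * pi) else 0) = 0"
      by (intro bexI[of _ i]) auto
    then show ?thesis using False by (simp only: prod_zero[OF finite] if_False)
  qed simp
  finally show ?thesis .
qed

text \<open>
  Orthogonality gives the identity for finite sums, and Fatou's lemma passes to the limit.
\<close>

lemma parseval_le:
  fixes B :: "nat \<Rightarrow> complex"
  assumes B: "summable (\<lambda>n. norm (B n))"
  shows "(\<integral>\<^sup>+ x. ennreal ((cmod (\<Sum>n. B n * cis (lattice_vec n \<bullet> x)))\<^sup>2) * indicator (torus :: (real ^ 'd) set) x \<partial>lborel)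
    \<le> ennreal ((2 * pi) ^ CARD('d)) * (\<Sum>n. ennreal ((cmod (B n))\<^sup>2))"
proof -
  define M where "M = restrict_space lborel (torus :: (real ^ 'd) set)"
  have fin: "finite_measure M" unfolding M_def by (rule finite_measure_torus)
  define e where "e n x = cis (lattice_vec n \<bullet> x)" for n and x :: "real ^ 'd"
  have [measurable]: "e n \<in> borel_measurable M" for n
    unfolding e_def M_def by (intro measurable_restrict_space1) measurable
  have conv: "(\<lambda>N. \<Sum>n<N. B n * e n x) \<longlonglongrightarrow> (\<Sum>n. B n * e n x)" for x
    by (intro summable_LIMSEQ summable_norm_cancel[of "\<lambda>n. B n * e n x"]) (use B in \<open>simp add: norm_mult e_def\<close>)
  have step: "(\<integral>\<^sup>+ x. ennreal ((cmod (\<Sum>n<N. B n * e n x))\<^sup>2) \<partial>M) \<le> ennreal ((2 * pi) ^ CARD('d)) * (\<Sum>n. ennreal ((cmod (B n))\<^sup>2))" for N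
  proof -
    have "(\<integral>\<^sup>+ x. ennreal ((cmod (\<Sum>n<N. B n * e n x))\<^sup>2) \<partial>M) = ennreal (\<integral>x. (cmod (\<Sum>n<N. B n * e n x))\<^sup>2 \<partial>M)"
    proof (rule nn_integral_eq_integral)
      show "integrable M (\<lambda>x. (cmod (\<Sum>n<N. B n * e n x))\<^sup>2)"
      proof (rule finite_measure.integrable_const_bound[OF fin, of _ "(\<Sum>n<N. cmod (B n))\<^sup>2"])
        have "cmod (\<Sum>n<N. B n * e n x) \<le> (\<Sum>n<N. cmod (B n))" for x
          by (rule sum_norm_le) (simp add: norm_mult e_def)
        then show "AE x in M. norm ((cmod (\<Sum>n<N. B n * e n x))\<^sup>2) \<le> (\<Sum>n<N. cmod (B n))\<^sup>2"
          by (auto intro!: power_mono)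
      qed measurable
    qed auto
    also have "(\<integral>x. (cmod (\<Sum>n<N. B n * e n x))\<^sup>2 \<partial>M) = (2 * pi) ^ CARD('d) * (\<Sum>n<N. (cmod (B n))\<^sup>2)"
    proof (rule norm_sum_orthogonal[OF fin])
      show "(\<integral>x. e k x * cnj (e l x) \<partial>M) = (if k = l then of_real ((2 * pi) ^ CARD('d)) else 0)" for k l
        unfolding e_def M_def by (rule torus_orthogonal)
    qed (auto simp: e_def[abs_def] M_def intro!: measurable_restrict_space1)
    also have "ennreal \<dots> = ennreal ((2 * pi) ^ CARD('d)) * (\<Sum>n<N. ennreal ((cmod (B n))\<^sup>2))"
      by (simp add: ennreal_mult sum_nonneg)
    also have "\<dots> \<le> ennreal ((2 * pi) ^ CARD('d)) * (\<Sum>n. ennreal ((cmod (B n))\<^sup>2))"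
      by (intro mult_left_mono sum_le_suminf) auto
    finally show ?thesis .
  qed
  have "(\<integral>\<^sup>+ x. ennreal ((cmod (\<Sum>n. B n * e n x))\<^sup>2) \<partial>M) = (\<integral>\<^sup>+ x. liminf (\<lambda>N. ennreal ((cmod (\<Sum>n<N. B n * e n x))\<^sup>2)) \<partial>M)"
  proof (intro nn_integral_cong)
    fix x
    have "(\<lambda>N. ennreal ((cmod (\<Sum>n<N. B n * e n x))\<^sup>2)) \<longlonglongrightarrow> ennreal ((cmod (\<Sum>n. B n * e n x))\<^sup>2)"
      by (intro tendsto_ennrealI tendsto_power tendsto_norm conv)
    from lim_imp_Liminf[OF sequentially_bot this]
    show "ennreal ((cmod (\<Sum>n. B n * e n x))\<^sup>2) = liminf (\<lambda>N. ennreal ((cmod (\<Sum>n<N. B n * e n x))\<^sup>2))" ..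
  qed
  also have "\<dots> \<le> liminf (\<lambda>N. \<integral>\<^sup>+ x. ennreal ((cmod (\<Sum>n<N. B n * e n x))\<^sup>2) \<partial>M)"
    by (rule nn_integral_liminf) measurable
  also have "\<dots> \<le> ennreal ((2 * pi) ^ CARD('d)) * (\<Sum>n. ennreal ((cmod (B n))\<^sup>2))"
    by (rule Liminf_le) (simp_all only: step eventually_True trivial_limit_sequentially not_False_eq_True)
  finally show ?thesis
    by (simp add: e_def M_def nn_integral_restrict_space)
qed

lemma dyadic_small:
  fixes t :: real
  assumes "0 < t" "t < 1"
  shows "\<exists>n. (1/2) ^ Suc n \<le> t \<and> t \<le> (1/2) ^ n"
proof -
  obtain m where m: "(1/2) ^ m < t" using real_arch_pow_inv[of t "1/2"] assms by auto
  define k where "k = (LEAST m. (1/2 :: real) ^ m < t)"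
  have k: "(1/2) ^ k < t" unfolding k_def using m by (rule LeastI)
  with assms obtain n where n: "k = Suc n" by (cases k) auto
  have "\<not> (1/2) ^ n < t" using not_less_Least[of n "\<lambda>m. (1/2 :: real) ^ m < t"] n by (simp add: k_def)
  then show ?thesis using k n by (intro exI[of _ n]) auto
qed

lemma dyadic_large:
  fixes t :: real
  assumes "1 \<le> t"
  shows "\<exists>n. 2 ^ n \<le> t \<and> t \<le> 2 ^ Suc n"
proof -
  obtain m where m: "t < 2 ^ m" using real_arch_pow[of 2 t] by auto
  define k where "k = (LEAST m. t < 2 ^ m)"
  have k: "t < 2 ^ k" unfolding k_def using m by (rule LeastI)
  with assms obtain n where n: "k = Suc n" by (cases k) auto
  have "\<not> t < 2 ^ n" using not_less_Least[of n "\<lambda>m. t < 2 ^ m"] n by (simp add: k_def)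
  then show ?thesis using k n by (intro exI[of _ n]) auto
qed

lemma ennreal_term_le_suminf: "f n \<le> (\<Sum>n. f n :: ennreal)"
  using sum_le_suminf[of f "{n}"] by simp

lemma cball_sets [measurable]: "cball a r \<in> sets borel"
  by (simp add: borel_closed)

text \<open>
  For bounding integrals over dyadic annuli: the sum is taken over the balls that contain them.
\<close>

lemma nn_integral_sum_cball_finite:
  fixes a r :: "nat \<Rightarrow> real"
  assumes "\<And>n. a n \<ge> 0" "\<And>n. r n \<ge> 0" "summable (\<lambda>n. a n * r n ^ DIM('a))"
  shows "(\<integral>\<^sup>+ z. (\<Sum>n. ennreal (a n) * indicator (cball 0 (r n)) (z :: 'a::euclidean_space)) \<partial>lborel) < \<infinity>"
proof -
  have "(\<integral>\<^sup>+ z. (\<Sum>n. ennreal (a n) * indicator (cball 0 (r n)) (z :: 'a)) \<partial>lborel)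
      = (\<Sum>n. \<integral>\<^sup>+ z. ennreal (a n) * indicator (cball 0 (r n)) (z :: 'a) \<partial>lborel)"
    by (rule nn_integral_suminf) measurable
  also have "\<dots> = (\<Sum>n. ennreal (unit_ball_vol (real DIM('a)) * (a n * r n ^ DIM('a))))"
    using assms by (simp add: nn_integral_cmult emeasure_cball ennreal_mult[symmetric] mult_ac)
  also have "\<dots> < \<infinity>"
    using assms by (subst suminf_ennreal2) (auto intro!: summable_mult)
  finally show ?thesis .
qed

text \<open>
  On the annulus \<open>\<bar>z\<bar> \<approx> 2\<^sup>j\<close>, of volume about \<open>2 ^ (j * d)\<close>, the integrand is about \<open>2 powr (- j * (d + 2 * \<sigma>))\<close>
  times \<open>min 4 (4 ^ j)\<close>.  The contributions form a geometric series for \<open>j \<rightarrow> \<infinity>\<close> since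
  \<open>\<sigma> > 0\<close>, and for \<open>j \<rightarrow> -\<infinity>\<close> since \<open>\<sigma> < 1\<close>.
\<close>

lemma gagliardo_kernel_finite:
  fixes \<sigma> :: real
  assumes \<sigma>: "0 < \<sigma>" "\<sigma> < 1"
  shows "(\<integral>\<^sup>+ z. ennreal (min 4 ((norm z)\<^sup>2) / norm (z :: 'a::euclidean_space) powr (real DIM('a) + 2 * \<sigma>)) \<partial>lborel) < \<infinity>"
proof -
  define d where "d = DIM('a)"
  define p where "p = real d + 2 * \<sigma>"
  have p: "p > 0" using \<sigma> by (simp add: p_def)
  \<comment> \<open>Bounds of the integrand on the annuli inside and outside the unit ball.\<close>
  define a where "a n = ((1/2) ^ n)\<^sup>2 / ((1/2) ^ Suc n) powr p" for n :: nat
  define b where "b n = 4 / (2 ^ n) powr p" for n :: nat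
  have ab0: "a n \<ge> 0" "b n \<ge> 0" for n by (auto simp: a_def b_def)
  have pw: "((c :: real) ^ n) powr p = (c powr p) ^ n" if "c > 0" for c n
    using that by (induction n) (auto simp: powr_mult)
  have suma: "summable (\<lambda>n. a n * ((1/2) ^ n) ^ d)"
  proof -
    define h :: real where "h = (1/2) powr (2 * \<sigma>)"
    have "(1/2) powr 2 < h" unfolding h_def using \<sigma> by (intro powr_less_mono') auto
    then have h: "h > 1/4" by (simp add: power2_eq_square)
    have hp: "(1/2) powr p = (1/2) ^ d * h" by (simp add: p_def h_def powr_add powr_realpow)
    have "a n * ((1/2) ^ n) ^ d = (1 / ((1/2) ^ d * h)) * ((1/4) / h) ^ n" for n
    proof -
      have "((1/2 :: real) ^ n)\<^sup>2 = (1/4) ^ n" by (simp add: power2_eq_square flip: power_mult_distrib)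
      moreover have "((1/2 :: real) ^ n) ^ d = ((1/2) ^ d) ^ n" by (simp add: mult.commute flip: power_mult)
      moreover have "((1/2 :: real) ^ Suc n) powr p = ((1/2) ^ d * h) * ((1/2) ^ d * h) ^ n"
        by (subst pw) (simp_all add: hp)
      ultimately show ?thesis using h by (simp add: a_def power_divide power_mult_distrib)
    qed
    moreover have "norm ((1/4) / h) < 1" using h by simp
    ultimately show ?thesis by (simp only: summable_mult summable_geometric)
  qed
  have sumb: "summable (\<lambda>n. b n * (2 ^ Suc n) ^ d)"
  proof -
    define h :: real where "h = 2 powr (2 * \<sigma>)"
    have h: "h > 1" unfolding h_def using \<sigma> by simp
    have hp: "2 powr p = 2 ^ d * h" by (simp add: p_def h_def powr_add powr_realpow)
    have "b n * (2 ^ Suc n) ^ d = (4 * 2 ^ d) * (1 / h) ^ n" for n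
    proof -
      have "((2 :: real) ^ n) powr p = (2 ^ d * h) ^ n" by (subst pw) (simp_all add: hp)
      moreover have "((2 :: real) ^ Suc n) ^ d = 2 ^ d * (2 ^ d) ^ n"
        by (simp add: power_mult_distrib mult.commute flip: power_mult)
      ultimately show ?thesis using h by (simp add: b_def power_divide power_mult_distrib)
    qed
    moreover have "norm (1 / h) < 1" using h by simp
    ultimately show ?thesis by (simp only: summable_mult summable_geometric)
  qed
  have pt: "ennreal (min 4 ((norm z)\<^sup>2) / norm z powr p)
    \<le> (\<Sum>n. ennreal (a n) * indicator (cball 0 ((1/2) ^ n)) z) + (\<Sum>n. ennreal (b n) * indicator (cball 0 (2 ^ Suc n)) z)"
    for z :: 'a
  proof (cases "z = 0")
    case False
    then have z: "norm z > 0" by simp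
    show ?thesis
    proof (cases "norm z < 1")
      case True
      obtain n where n: "(1/2) ^ Suc n \<le> norm z" "norm z \<le> (1/2) ^ n" using dyadic_small[OF z True] by blast
      have "min 4 ((norm z)\<^sup>2) / norm z powr p \<le> a n"
        unfolding a_def using n z p
        by (intro frac_le powr_mono2 min.coboundedI2 power_mono) auto
      then have "ennreal (min 4 ((norm z)\<^sup>2) / norm z powr p) \<le> ennreal (a n) * indicator (cball 0 ((1/2) ^ n)) z"
        using n by (simp add: ennreal_leI)
      also have "\<dots> \<le> (\<Sum>n. ennreal (a n) * indicator (cball 0 ((1/2) ^ n)) z)"
        by (rule ennreal_term_le_suminf)
      finally show ?thesis by (rule order_trans) simp
    next
      case False
      obtain n where n: "2 ^ n \<le> norm z" "norm z \<le> 2 ^ Suc n" using dyadic_large[of "norm z"] False by auto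
      have "min 4 ((norm z)\<^sup>2) / norm z powr p \<le> b n"
        unfolding b_def using n p
        by (intro frac_le powr_mono2 min.cobounded1) auto
      then have "ennreal (min 4 ((norm z)\<^sup>2) / norm z powr p) \<le> ennreal (b n) * indicator (cball 0 (2 ^ Suc n)) z"
        using n by (simp add: ennreal_leI)
      also have "\<dots> \<le> (\<Sum>n. ennreal (b n) * indicator (cball 0 (2 ^ Suc n)) z)"
        by (rule ennreal_term_le_suminf)
      finally show ?thesis by (rule order_trans) simp
    qed
  qed simp
  have "(\<integral>\<^sup>+ z. ennreal (min 4 ((norm z)\<^sup>2) / norm (z :: 'a) powr p) \<partial>lborel)
     \<le> (\<integral>\<^sup>+ z. (\<Sum>n. ennreal (a n) * indicator (cball 0 ((1/2) ^ n)) (z :: 'a)) + (\<Sum>n. ennreal (b n) * indicator (cball 0 (2 ^ Suc n)) z) \<partial>lborel)"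
    by (rule nn_integral_mono) (rule pt)
  also have "\<dots> = (\<integral>\<^sup>+ z. (\<Sum>n. ennreal (a n) * indicator (cball 0 ((1/2) ^ n)) (z :: 'a)) \<partial>lborel)
      + (\<integral>\<^sup>+ z. (\<Sum>n. ennreal (b n) * indicator (cball 0 (2 ^ Suc n)) (z :: 'a)) \<partial>lborel)"
    by (rule nn_integral_add) measurable
  also have "\<dots> < \<infinity>"
    using nn_integral_sum_cball_finite[of a "\<lambda>n. (1/2) ^ n", where 'a = 'a] nn_integral_sum_cball_finite[of b "\<lambda>n. 2 ^ Suc n", where 'a = 'a]
      suma sumb ab0 by (simp add: d_def)
  finally show ?thesis by (simp add: p_def d_def)
qed

lemma nn_integral_affine:
  fixes f :: "'a::euclidean_space \<Rightarrow> ennreal"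
  assumes c: "c \<noteq> 0" and [measurable]: "f \<in> borel_measurable borel"
  shows "(\<integral>\<^sup>+ x. f x \<partial>lborel) = ennreal (\<bar>c\<bar> ^ DIM('a)) * (\<integral>\<^sup>+ x. f (t + c *\<^sub>R x) \<partial>lborel)"
  by (subst lborel_affine[OF c, of t])
     (simp add: nn_integral_density nn_integral_distr nn_integral_cmult ennreal_power)

text \<open>
  The Fourier multiplier of the squared Slobodeckij seminorm on the whole space.
\<close>

definition gagliardo_symbol :: "real \<Rightarrow> real ^ 'd \<Rightarrow> ennreal" where
  "gagliardo_symbol \<sigma> \<kappa> =
     (\<integral>\<^sup>+ h. ennreal ((cmod (cis (\<kappa> \<bullet> h) - 1))\<^sup>2 / norm h powr (real CARD('d) + 2 * \<sigma>)) \<partial>lborel)"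

text \<open>
  Substituting \<open>h = z / \<bar>\<kappa>\<bar>\<close> extracts the power of \<open>\<bar>\<kappa>\<bar>\<close>; the remaining integrand is at most
  the kernel of \<open>gagliardo_kernel_finite\<close>, since \<open>\<bar>cis (\<kappa> \<bullet> h) - 1\<bar>\<close> is at most both \<open>2\<close> and \<open>\<bar>z\<bar>\<close>.
\<close>

lemma gagliardo_character:
  fixes \<sigma> :: real
  assumes \<sigma>: "0 < \<sigma>" "\<sigma> < 1"
  obtains K where "K \<ge> 0" "\<And>\<kappa> :: real ^ 'd.
    gagliardo_symbol \<sigma> \<kappa> \<le> ennreal (K * norm \<kappa> powr (2 * \<sigma>))"
proof -
  define p where "p = real CARD('d) + 2 * \<sigma>"
  define I where "I = (\<integral>\<^sup>+ z. ennreal (min 4 ((norm z)\<^sup>2) / norm (z :: real ^ 'd) powr p) \<partial>lborel)"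
  have I: "I < \<infinity>" unfolding I_def p_def using gagliardo_kernel_finite[OF \<sigma>, where 'a = "real ^ 'd"] by simp
  define K where "K = enn2real I"
  have IK: "I = ennreal K" using I by (simp add: K_def)
  have K0: "K \<ge> 0" by (simp add: K_def)
  show ?thesis
  proof (rule that[OF K0])
    fix \<kappa> :: "real ^ 'd"
    show "gagliardo_symbol \<sigma> \<kappa> \<le> ennreal (K * norm \<kappa> powr (2 * \<sigma>))"
    proof (cases "\<kappa> = 0")
      case False
      define c where "c = 1 / norm \<kappa>"
      have c: "c > 0" "c * norm \<kappa> = 1" using False by (auto simp: c_def)
      have eq: "(\<integral>\<^sup>+ h. ennreal ((cmod (cis (\<kappa> \<bullet> h) - 1))\<^sup>2 / norm h powr p) \<partial>lborel)
         = ennreal (\<bar>c\<bar> ^ DIM(real ^ 'd)) * (\<integral>\<^sup>+ z. ennreal ((cmod (cis (\<kappa> \<bullet> (0 + c *\<^sub>R z)) - 1))\<^sup>2 / norm (0 + c *\<^sub>R z) powr p) \<partial>lborel)"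
        by (rule nn_integral_affine) (use c in auto)
      have "(\<integral>\<^sup>+ z. ennreal ((cmod (cis (\<kappa> \<bullet> (0 + c *\<^sub>R z)) - 1))\<^sup>2 / norm (0 + c *\<^sub>R z) powr p) \<partial>lborel)
        \<le> (\<integral>\<^sup>+ z. ennreal (norm \<kappa> powr p) * ennreal (min 4 ((norm z)\<^sup>2) / norm (z :: real ^ 'd) powr p) \<partial>lborel)"
      proof (rule nn_integral_mono)
        fix z :: "real ^ 'd"
        have 1: "cmod (cis (\<kappa> \<bullet> (c *\<^sub>R z)) - 1) \<le> norm z"
        proof -
          have "cmod (cis (\<kappa> \<bullet> (c *\<^sub>R z)) - 1) \<le> \<bar>\<kappa> \<bullet> (c *\<^sub>R z)\<bar>"
            using norm_cis_diff_le[of "\<kappa> \<bullet> (c *\<^sub>R z)" 0] by simp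
          also have "\<dots> \<le> norm \<kappa> * norm (c *\<^sub>R z)" by (rule Cauchy_Schwarz_ineq2)
          also have "\<dots> = norm z" using c by (simp add: mult.commute mult.assoc[symmetric])
          finally show ?thesis .
        qed
        have 2: "cmod (cis (\<kappa> \<bullet> (c *\<^sub>R z)) - 1) \<le> 2" by (rule order_trans[OF norm_triangle_ineq4]) simp
        have "(cmod (cis (\<kappa> \<bullet> (c *\<^sub>R z)) - 1))\<^sup>2 \<le> min 4 ((norm z)\<^sup>2)"
          using power_mono[OF 1, of 2] power_mono[OF 2, of 2] by simp
        then have "(cmod (cis (\<kappa> \<bullet> (c *\<^sub>R z)) - 1))\<^sup>2 / norm (c *\<^sub>R z) powr p \<le> min 4 ((norm z)\<^sup>2) / norm (c *\<^sub>R z) powr p"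
          by (rule divide_right_mono) simp
        also have "\<dots> = norm \<kappa> powr p * (min 4 ((norm z)\<^sup>2) / norm z powr p)"
          using c by (simp add: c_def powr_divide)
        finally have "(cmod (cis (\<kappa> \<bullet> (c *\<^sub>R z)) - 1))\<^sup>2 / norm (c *\<^sub>R z) powr p \<le> norm \<kappa> powr p * (min 4 ((norm z)\<^sup>2) / norm z powr p)" .
        then show "ennreal ((cmod (cis (\<kappa> \<bullet> (0 + c *\<^sub>R z)) - 1))\<^sup>2 / norm (0 + c *\<^sub>R z) powr p) \<le> ennreal (norm \<kappa> powr p) * ennreal (min 4 ((norm z)\<^sup>2) / norm z powr p)"
          by (simp add: ennreal_mult[symmetric] ennreal_leI)
      qed
      also have "\<dots> = ennreal (norm \<kappa> powr p) * I"
        unfolding I_def by (rule nn_integral_cmult) measurable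
      finally have "(\<integral>\<^sup>+ h. ennreal ((cmod (cis (\<kappa> \<bullet> h) - 1))\<^sup>2 / norm h powr p) \<partial>lborel)
        \<le> ennreal (\<bar>c\<bar> ^ DIM(real ^ 'd)) * (ennreal (norm \<kappa> powr p) * I)"
        unfolding eq by (rule mult_left_mono) simp
      also have "\<dots> = ennreal (c ^ CARD('d) * norm \<kappa> powr p * K)"
        using c by (simp add: IK ennreal_mult K0 mult.assoc)
      also have "c ^ CARD('d) * norm \<kappa> powr p = norm \<kappa> powr (2 * \<sigma>)"
        using False by (simp add: c_def p_def power_one_over powr_add powr_realpow)
      finally show ?thesis by (simp add: gagliardo_symbol_def p_def mult.commute)
    qed (simp add: gagliardo_symbol_def)
  qed
qed

definition lattice_series :: "(nat \<Rightarrow> complex) \<Rightarrow> real ^ 'd \<Rightarrow> complex" where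
  "lattice_series B x = (\<Sum>n. B n * cis (lattice_vec n \<bullet> x))"

lemma lattice_series_sums:
  assumes "summable (\<lambda>n. norm (B n))"
  shows "(\<lambda>n. B n * cis (lattice_vec n \<bullet> x)) sums lattice_series B x"
  unfolding lattice_series_def
  by (rule summable_sums, rule summable_norm_cancel) (use assms in \<open>simp add: norm_mult\<close>)

lemma lattice_series_measurable [measurable]: "lattice_series B \<in> borel_measurable borel"
  unfolding lattice_series_def by measurable

lemma L2_norm_sq_lattice_series:
  assumes B: "summable (\<lambda>n. norm (B n))"
  shows "L2_norm_sq (box 0 1 :: (real ^ 'd) set) (lattice_series B) \<le> ennreal ((2 * pi) ^ CARD('d)) * (\<Sum>n. ennreal ((cmod (B n))\<^sup>2))"
proof -
  have "L2_norm_sq (box 0 1 :: (real ^ 'd) set) (lattice_series B)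
     \<le> (\<integral>\<^sup>+ x. ennreal ((cmod (\<Sum>n. B n * cis (lattice_vec n \<bullet> x)))\<^sup>2) * indicator (torus :: (real ^ 'd) set) x \<partial>lborel)"
    unfolding L2_norm_sq_def nn_integral_completion lattice_series_def
    using box_subset_torus by (intro nn_integral_mono) (auto simp: indicator_def)
  also have "\<dots> \<le> ennreal ((2 * pi) ^ CARD('d)) * (\<Sum>n. ennreal ((cmod (B n))\<^sup>2))"
    by (rule parseval_le[OF B])
  finally show ?thesis .
qed

text \<open>
  With \<open>y = x + h\<close>, and \<open>h\<close> ranging over the whole space, the difference at fixed \<open>h\<close> is again a
  lattice series in \<open>x\<close>, with coefficients \<open>B n * (cis (k \<bullet> h) - 1)\<close>.  Its square integral over
  the period cell is bounded by \<open>parseval_le\<close>; integrating over \<open>h\<close> produces the symbol.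
\<close>

lemma slobodeckij_sq_lattice_series:
  fixes B :: "nat \<Rightarrow> complex" and \<sigma> :: real
  assumes B: "summable (\<lambda>n. norm (B n))"
    and K: "\<And>\<kappa> :: real ^ 'd. gagliardo_symbol \<sigma> \<kappa> \<le> ennreal (K * norm \<kappa> powr (2 * \<sigma>))"
  shows "slobodeckij_sq \<sigma> (box 0 1 :: (real ^ 'd) set) (lattice_series B)
    \<le> ennreal ((2 * pi) ^ CARD('d)) * (\<Sum>n. ennreal ((cmod (B n))\<^sup>2) * ennreal (K * norm (lattice_vec n :: real ^ 'd) powr (2 * \<sigma>)))"
proof -
  define p where "p = real CARD('d) + 2 * \<sigma>"
  define c where "c = ennreal ((2 * pi) ^ CARD('d))"
  let ?U = "box 0 1 :: (real ^ 'd) set"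
  let ?v = "lattice_series B :: real ^ 'd \<Rightarrow> complex"
  let ?q = "\<lambda>h x. ennreal ((cmod (?v (x + h) - ?v x))\<^sup>2 / norm h powr p)"
  let ?g = "\<lambda>n h. ennreal ((cmod (cis (lattice_vec n \<bullet> (h :: real ^ 'd)) - 1))\<^sup>2 / norm h powr p)"
  have "slobodeckij_sq \<sigma> ?U ?v = (\<integral>\<^sup>+ x. (\<integral>\<^sup>+ y. ennreal ((cmod (?v x - ?v y))\<^sup>2 / norm (x - y) powr p) * indicator ?U y \<partial>lborel) * indicator ?U x \<partial>lborel)"
    unfolding slobodeckij_sq_def nn_integral_completion p_def ..
  also have "\<dots> \<le> (\<integral>\<^sup>+ x. (\<integral>\<^sup>+ h. ?q h x * indicator torus x \<partial>lborel) \<partial>lborel)"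
  proof (rule nn_integral_mono)
    fix x :: "real ^ 'd"
    have "(\<integral>\<^sup>+ y. ennreal ((cmod (?v x - ?v y))\<^sup>2 / norm (x - y) powr p) * indicator ?U y \<partial>lborel)
       \<le> (\<integral>\<^sup>+ y. ennreal ((cmod (?v x - ?v y))\<^sup>2 / norm (x - y) powr p) \<partial>lborel)"
      by (rule nn_integral_mono) (simp add: indicator_def)
    also have "\<dots> = (\<integral>\<^sup>+ h. ennreal ((cmod (?v x - ?v (x + 1 *\<^sub>R h)))\<^sup>2 / norm (x - (x + 1 *\<^sub>R h)) powr p) \<partial>lborel)"
      using nn_integral_affine[of 1 "\<lambda>y. ennreal ((cmod (?v x - ?v y))\<^sup>2 / norm (x - y) powr p)" x] by simp
    also have "\<dots> = (\<integral>\<^sup>+ h. ?q h x \<partial>lborel)"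
      by (simp add: norm_minus_commute)
    finally show "(\<integral>\<^sup>+ y. ennreal ((cmod (?v x - ?v y))\<^sup>2 / norm (x - y) powr p) * indicator ?U y \<partial>lborel) * indicator ?U x
       \<le> (\<integral>\<^sup>+ h. ?q h x * indicator torus x \<partial>lborel)"
      using box_subset_torus by (auto simp: indicator_def)
  qed
  also have "\<dots> = (\<integral>\<^sup>+ h. (\<integral>\<^sup>+ x. ?q h x * indicator torus x \<partial>lborel) \<partial>lborel)"
    by (rule lborel_pair.Fubini') measurable
  also have "\<dots> \<le> (\<integral>\<^sup>+ h. c * (\<Sum>n. ennreal ((cmod (B n))\<^sup>2) * ?g n h) \<partial>lborel)"
  proof (rule nn_integral_mono)
    fix h :: "real ^ 'd"
    define B' where "B' n = B n * (cis (lattice_vec n \<bullet> h) - 1)" for n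
    have "cmod (B' n) \<le> cmod (B n) * 2" for n
      unfolding B'_def norm_mult by (intro mult_left_mono order_trans[OF norm_triangle_ineq4]) auto
    then have B': "summable (\<lambda>n. norm (B' n))"
      by (intro summable_comparison_test[OF _ summable_mult2[OF B, of 2]]) auto
    have diff: "?v (x + h) - ?v x = (\<Sum>n. B' n * cis (lattice_vec n \<bullet> x))" for x
    proof -
      have "(\<lambda>n. B n * cis (lattice_vec n \<bullet> (x + h)) - B n * cis (lattice_vec n \<bullet> x)) sums (?v (x + h) - ?v x)"
        by (rule sums_diff) (rule lattice_series_sums[OF B])+
      also have "(\<lambda>n. B n * cis (lattice_vec n \<bullet> (x + h)) - B n * cis (lattice_vec n \<bullet> x)) = (\<lambda>n. B' n * cis (lattice_vec n \<bullet> x))"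
      proof
        fix n
        have *: "cis (lattice_vec n \<bullet> (x + h)) = cis (lattice_vec n \<bullet> x) * cis (lattice_vec n \<bullet> h)"
          by (simp add: inner_add_right cis_mult)
        show "B n * cis (lattice_vec n \<bullet> (x + h)) - B n * cis (lattice_vec n \<bullet> x) = B' n * cis (lattice_vec n \<bullet> x)"
          unfolding * B'_def by algebra
      qed
      finally show ?thesis by (rule sums_unique)
    qed
    have "(\<integral>\<^sup>+ x. ?q h x * indicator torus x \<partial>lborel)
      = (\<integral>\<^sup>+ x. ennreal (1 / norm h powr p) * (ennreal ((cmod (\<Sum>n. B' n * cis (lattice_vec n \<bullet> (x :: real ^ 'd))))\<^sup>2) * indicator torus x) \<partial>lborel)"
      unfolding diff
    proof (rule nn_integral_cong)
      fix x :: "real ^ 'd"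
      let ?y = "(cmod (\<Sum>n. B' n * cis (lattice_vec n \<bullet> x)))\<^sup>2"
      have "ennreal (?y / norm h powr p) = ennreal (1 / norm h powr p * ?y)" by simp
      also have "\<dots> = ennreal (1 / norm h powr p) * ennreal ?y" by (rule ennreal_mult) auto
      finally have *: "ennreal (?y / norm h powr p) = ennreal (1 / norm h powr p) * ennreal ?y" .
      show "ennreal (?y / norm h powr p) * indicator torus x
        = ennreal (1 / norm h powr p) * (ennreal ?y * indicator torus x)"
        by (subst *) (rule mult.assoc)
    qed
    also have "\<dots> = ennreal (1 / norm h powr p) * (\<integral>\<^sup>+ x. ennreal ((cmod (\<Sum>n. B' n * cis (lattice_vec n \<bullet> (x :: real ^ 'd))))\<^sup>2) * indicator torus x \<partial>lborel)"
      by (rule nn_integral_cmult) measurable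
    also have "\<dots> \<le> ennreal (1 / norm h powr p) * (c * (\<Sum>n. ennreal ((cmod (B' n))\<^sup>2)))"
      unfolding c_def by (intro mult_left_mono parseval_le B') auto
    also have "\<dots> = c * (\<Sum>n. ennreal (1 / norm h powr p) * ennreal ((cmod (B' n))\<^sup>2))"
      by (simp only: ennreal_suminf_cmult mult.left_commute[of c])
    also have "(\<lambda>n. ennreal (1 / norm h powr p) * ennreal ((cmod (B' n))\<^sup>2)) = (\<lambda>n. ennreal ((cmod (B n))\<^sup>2) * ?g n h)"
    proof
      fix n
      have "1 / norm h powr p * (cmod (B' n))\<^sup>2 = (cmod (B n))\<^sup>2 * ((cmod (cis (lattice_vec n \<bullet> h) - 1))\<^sup>2 / norm h powr p)"
        by (simp add: B'_def norm_mult power_mult_distrib)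
      then show "ennreal (1 / norm h powr p) * ennreal ((cmod (B' n))\<^sup>2)
        = ennreal ((cmod (B n))\<^sup>2) * ?g n h"
        by (subst (1 2) ennreal_mult[symmetric]) simp_all
    qed
    finally show "(\<integral>\<^sup>+ x. ?q h x * indicator torus x \<partial>lborel)
      \<le> c * (\<Sum>n. ennreal ((cmod (B n))\<^sup>2) * ?g n h)" .
  qed
  also have "\<dots> = c * (\<integral>\<^sup>+ h. (\<Sum>n. ennreal ((cmod (B n))\<^sup>2) * ?g n h) \<partial>lborel)"
    by (rule nn_integral_cmult) measurable
  also have "\<dots> = c * (\<Sum>n. \<integral>\<^sup>+ h. ennreal ((cmod (B n))\<^sup>2) * ?g n h \<partial>lborel)"
    by (subst nn_integral_suminf) measurable
  also have "\<dots> = c * (\<Sum>n. ennreal ((cmod (B n))\<^sup>2) * (\<integral>\<^sup>+ h. ?g n h \<partial>lborel))"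
    by (subst nn_integral_cmult) auto
  also have "\<dots> \<le> c * (\<Sum>n. ennreal ((cmod (B n))\<^sup>2) * ennreal (K * norm (lattice_vec n :: real ^ 'd) powr (2 * \<sigma>)))"
    using K unfolding p_def gagliardo_symbol_def by (intro mult_left_mono suminf_le) auto
  finally show ?thesis by (simp add: c_def)
qed

section \<open>Weak derivatives of lattice series\<close>

lemma iter_partial_zero_outside:
  assumes U: "open U" and zero: "\<And>x. x \<in> U \<Longrightarrow> \<phi> x = 0" and x: "x \<in> U"
  shows "iter_partial is \<phi> x = 0"
  using x
proof (induction "is" arbitrary: x)
  case (Cons i "is")
  have "((\<lambda>_. 0) has_derivative (\<lambda>_. 0)) (at x)" by simp
  then have "(iter_partial is \<phi> has_derivative (\<lambda>_. 0)) (at x)"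
    by (rule has_derivative_transform_within_open[OF _ U Cons.prems]) (simp add: Cons.IH)
  then have "frechet_derivative (iter_partial is \<phi>) (at x) = (\<lambda>_. 0)"
    by (rule frechet_derivative_at[symmetric])
  then show ?case by (simp add: partial_deriv_def)
qed (simp add: zero)

lemma directional_derivative:
  fixes h :: "'a::real_normed_vector \<Rightarrow> complex"
  assumes "h differentiable (at (x + t *\<^sub>R e))"
  shows "((\<lambda>t. h (x + t *\<^sub>R e)) has_vector_derivative frechet_derivative h (at (x + t *\<^sub>R e)) e) (at t)"
proof -
  let ?D = "frechet_derivative h (at (x + t *\<^sub>R e))"
  have D: "(h has_derivative ?D) (at (x + t *\<^sub>R e))" using assms by (simp add: frechet_derivative_works)
  have "((\<lambda>t. x + t *\<^sub>R e) has_derivative (\<lambda>u. u *\<^sub>R e)) (at t)"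
    by (auto intro!: derivative_eq_intros)
  from diff_chain_at[OF this D]
  have "((\<lambda>t. h (x + t *\<^sub>R e)) has_derivative (\<lambda>u. ?D (u *\<^sub>R e))) (at t)" by (simp add: o_def)
  moreover have "?D (u *\<^sub>R e) = u *\<^sub>R ?D e" for u
    using has_derivative_linear[OF D] by (simp add: linear_cmul)
  ultimately show ?thesis by (simp add: has_vector_derivative_def)
qed

text \<open>
  The derivative is the limit of difference quotients, whose integrals vanish by translation
  invariance.  The quotients are dominated by the mean value theorem.
\<close>

lemma integral_partial_derivative_zero:
  fixes h :: "'a::euclidean_space \<Rightarrow> complex"
  assumes diff: "\<And>x. h differentiable (at x)"
    and cont: "continuous_on UNIV (\<lambda>x. frechet_derivative h (at x) e)"
    and supp: "\<And>x. x \<notin> S \<Longrightarrow> h x = 0" "\<And>x. x \<notin> S \<Longrightarrow> frechet_derivative h (at x) e = 0" and S: "compact S"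
  shows "(\<integral>x. frechet_derivative h (at x) e \<partial>lborel) = 0"
proof -
  define D where "D x = frechet_derivative h (at x) e" for x
  have hc: "continuous_on UNIV h" using diff by (auto intro: differentiable_imp_continuous_on simp: differentiable_on_def)
  have [measurable]: "h \<in> borel_measurable borel" "D \<in> borel_measurable borel"
    using hc cont unfolding D_def by (auto intro: borel_measurable_continuous_onI)
  have bounded: "\<exists>M\<ge>0. \<forall>x. norm (f x) \<le> M" if "continuous_on UNIV f" "\<And>x. x \<notin> S \<Longrightarrow> f x = 0" for f :: "'a \<Rightarrow> complex"
  proof -
    have "bounded (f ` S)"
      using compact_continuous_image[OF continuous_on_subset[OF that(1) subset_UNIV] S] by (rule compact_imp_bounded)
    then obtain M where "M > 0" "\<And>x. x \<in> S \<Longrightarrow> norm (f x) \<le> M" by (auto simp: bounded_pos)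
    then show ?thesis using that(2) by (intro exI[of _ M]) (metis less_imp_le norm_zero)
  qed
  obtain M where M: "M \<ge> 0" "\<And>x. norm (D x) \<le> M" using bounded[of D] cont supp(2) unfolding D_def by auto
  obtain M' where M': "M' \<ge> 0" "\<And>x. norm (h x) \<le> M'" using bounded[OF hc supp(1)] by auto
  obtain R where R: "R > 0" "\<And>x. x \<in> S \<Longrightarrow> norm x \<le> R"
    using compact_imp_bounded[OF S] by (auto simp: bounded_pos)
  \<comment> \<open>A box that contains \<open>S\<close> and all its translates by \<open>- t n *\<^sub>R e\<close>, so that the difference
    quotients vanish outside.\<close>
  obtain a b :: 'a where ab: "cball 0 (R + norm e) \<subseteq> cbox a b"
    using bounded_subset_cbox_symmetric[OF bounded_cball] by metis
  have far: "x \<notin> S" if "x \<notin> cbox a b" for x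
  proof
    assume "x \<in> S"
    then have "x \<in> cball 0 (R + norm e)" using R(2)[of x] by (simp add: add_increasing2)
    then show False using ab that by auto
  qed
  have int_h: "integrable lborel h"
    by (rule integrable_compact_support[of h M' a b]) (use M' far supp in auto)
  define t where "t n = 1 / real (Suc n)" for n
  have t: "t n > 0" "t n \<le> 1" for n by (auto simp: t_def)
  have t0: "t \<longlonglongrightarrow> 0" unfolding t_def by (rule LIMSEQ_Suc[OF lim_1_over_n])
  define q where "q n x = (h (x + t n *\<^sub>R e) - h x) / of_real (t n)" for n x
  have [measurable]: "q n \<in> borel_measurable borel" for n unfolding q_def by measurable
  have "(\<lambda>n. \<integral>x. q n x \<partial>lborel) \<longlonglongrightarrow> (\<integral>x. D x \<partial>lborel)"
  proof (rule integral_dominated_convergence)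
    show "integrable lborel (\<lambda>x. indicator (cbox a b) x *\<^sub>R M)"
      by (intro integrable_scaleR_left integrable_real_indicator)
         (use emeasure_bounded_finite[OF bounded_cbox, of a b] in auto)
    show "AE x in lborel. (\<lambda>n. q n x) \<longlonglongrightarrow> D x"
    proof (intro AE_I2)
      fix x
      have "((\<lambda>t. h (x + t *\<^sub>R e)) has_vector_derivative D x) (at 0)"
        using directional_derivative[of h x 0 e] diff by (simp add: D_def)
      then have "((\<lambda>y. (h (x + y *\<^sub>R e) - h x) /\<^sub>R y) \<longlongrightarrow> D x) (at 0)"
      proof -
        assume "((\<lambda>t. h (x + t *\<^sub>R e)) has_vector_derivative D x) (at 0)"
        then have "((\<lambda>y. (h (x + y *\<^sub>R e) - h x - y *\<^sub>R D x) /\<^sub>R \<bar>y\<bar>) \<longlongrightarrow> 0) (at 0)"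
          by (simp add: has_vector_derivative_def has_derivative_at_within)
        then have "((\<lambda>y. norm ((h (x + y *\<^sub>R e) - h x - y *\<^sub>R D x) /\<^sub>R \<bar>y\<bar>)) \<longlongrightarrow> 0) (at 0)"
          by (rule tendsto_norm_zero)
        moreover have "norm ((h (x + y *\<^sub>R e) - h x - y *\<^sub>R D x) /\<^sub>R \<bar>y\<bar>) = norm ((h (x + y *\<^sub>R e) - h x) /\<^sub>R y - D x)" if "y \<noteq> 0" for y
        proof -
          have "(h (x + y *\<^sub>R e) - h x) /\<^sub>R y - D x = (h (x + y *\<^sub>R e) - h x - y *\<^sub>R D x) /\<^sub>R y"
            using that by (simp add: scaleR_diff_right)
          then show ?thesis by simp
        qed
        ultimately have "((\<lambda>y. norm ((h (x + y *\<^sub>R e) - h x) /\<^sub>R y - D x)) \<longlongrightarrow> 0) (at 0)"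
          by (elim Lim_transform_eventually) (auto simp: eventually_at_filter)
        then show ?thesis by (simp add: tendsto_norm_zero_iff LIM_zero_iff)
      qed
      moreover have "filterlim t (at 0) sequentially"
        unfolding filterlim_at using t t0 by (auto intro!: always_eventually simp: less_imp_neq[symmetric])
      ultimately have "(\<lambda>n. (h (x + t n *\<^sub>R e) - h x) /\<^sub>R t n) \<longlonglongrightarrow> D x"
        by (rule filterlim_compose)
      then show "(\<lambda>n. q n x) \<longlonglongrightarrow> D x"
        by (simp add: q_def scaleR_conv_of_real divide_inverse mult.commute)
    qed
    show "AE x in lborel. norm (q n x) \<le> indicator (cbox a b) x *\<^sub>R M" for n
    proof (intro AE_I2)
      fix x
      have "norm (h (x + t n *\<^sub>R e) - h (x + 0 *\<^sub>R e)) \<le> M * norm (t n - 0)"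
      proof (rule differentiable_bound[of UNIV "\<lambda>t. h (x + t *\<^sub>R e)" "\<lambda>t u. u *\<^sub>R D (x + t *\<^sub>R e)"])
        show "((\<lambda>t. h (x + t *\<^sub>R e)) has_derivative (\<lambda>u. u *\<^sub>R D (x + t *\<^sub>R e))) (at t within UNIV)" for t
          using directional_derivative[of h x t e] diff by (simp add: D_def has_vector_derivative_def)
        show "onorm (\<lambda>u. u *\<^sub>R D (x + t *\<^sub>R e)) \<le> M" for t
        proof (rule onorm_le)
          fix u
          show "norm (u *\<^sub>R D (x + t *\<^sub>R e)) \<le> M * norm u"
            using mult_right_mono[OF M(2)[of "x + t *\<^sub>R e"], of "norm u"] by (simp add: mult.commute)
        qed
      qed auto
      then have le: "norm (q n x) \<le> M"
        using t[of n] by (simp add: q_def norm_divide field_simps)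
      show "norm (q n x) \<le> indicator (cbox a b) x *\<^sub>R M"
      proof (cases "x \<in> cbox a b")
        case False
        have "x + t n *\<^sub>R e \<notin> S"
        proof
          assume "x + t n *\<^sub>R e \<in> S"
          then have "norm (x + t n *\<^sub>R e) \<le> R" by (rule R(2))
          then have "norm x \<le> R + norm (t n *\<^sub>R e)"
            using norm_triangle_ineq4[of "x + t n *\<^sub>R e" "t n *\<^sub>R e"] by simp
          also have "norm (t n *\<^sub>R e) \<le> norm e" using t[of n] by (simp add: mult_left_le_one_le)
          finally show False using ab False by auto
        qed
        then show ?thesis using False far supp(1) by (simp add: q_def)
      qed (use le in simp)
    qed
  qed measurable
  moreover have "(\<integral>x. q n x \<partial>lborel) = 0" for n
  proof -
    have 1: "integrable lborel (\<lambda>x. h (t n *\<^sub>R e + 1 *\<^sub>R x))" by (rule integrable_affine) (use int_h in auto)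
    have 2: "(\<integral>x. h x \<partial>lborel) = (\<integral>x. h (t n *\<^sub>R e + 1 *\<^sub>R x) \<partial>lborel)"
      using integral_affine[of 1 h "t n *\<^sub>R e"] by simp
    have "(\<integral>x. q n x \<partial>lborel) = (\<integral>x. h (t n *\<^sub>R e + 1 *\<^sub>R x) - h x \<partial>lborel) / of_real (t n)"
      by (simp add: q_def add.commute)
    also have "\<dots> = 0" using Bochner_Integration.integral_diff[OF 1 int_h] 2 by simp
    finally show ?thesis .
  qed
  ultimately have "(\<lambda>n. 0) \<longlonglongrightarrow> (\<integral>x. D x \<partial>lborel)" by simp
  from LIMSEQ_unique[OF this tendsto_const] show ?thesis by (simp add: D_def)
qed

lemma test_function_facts:
  fixes \<phi> :: "real ^ 'd \<Rightarrow> complex"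
  assumes \<phi>: "\<phi> \<in> test_functions U"
  defines "S \<equiv> closure {x. \<phi> x \<noteq> 0}"
  shows test_function_diff: "iter_partial is \<phi> differentiable (at x)"
    and test_function_cont: "continuous_on UNIV (iter_partial is \<phi>)"
    and test_function_supp: "x \<notin> S \<Longrightarrow> iter_partial is \<phi> x = 0"
    and test_function_compact: "compact S" and test_function_sub: "S \<subseteq> U"
proof -
  have diff: "iter_partial is \<phi> differentiable (at x)" for "is" x using \<phi> by (auto simp: test_functions_def)
  show "iter_partial is \<phi> differentiable (at x)" by (rule diff)
  show "continuous_on UNIV (iter_partial is \<phi>)"
    using diff by (auto intro: differentiable_imp_continuous_on simp: differentiable_on_def)
  show "compact S" "S \<subseteq> U" using \<phi> by (auto simp: test_functions_def S_def)
  assume "x \<notin> S"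
  then show "iter_partial is \<phi> x = 0"
    using closure_subset[of "{x. \<phi> x \<noteq> 0}"]
    by (intro iter_partial_zero_outside[of "- S"]) (auto simp: S_def)
qed

lemma integrable_test_function_times:
  fixes \<phi> :: "real ^ 'd \<Rightarrow> complex"
  assumes \<phi>: "\<phi> \<in> test_functions U" and [measurable]: "w \<in> borel_measurable borel" and w: "\<And>x. norm (w x) \<le> C"
  shows "integrable lborel (\<lambda>x. w x * iter_partial is \<phi> x)"
proof -
  note f = test_function_facts[OF \<phi>]
  have [measurable]: "iter_partial is \<phi> \<in> borel_measurable borel"
    by (rule borel_measurable_continuous_onI) (rule f(2))
  define S where "S = closure {x. \<phi> x \<noteq> 0}"
  obtain a b where ab: "S \<subseteq> cbox a b"
    using bounded_subset_cbox_symmetric[OF compact_imp_bounded[OF f(4)]] unfolding S_def by metis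
  have "bounded (iter_partial is \<phi> ` S)"
    unfolding S_def by (intro compact_imp_bounded compact_continuous_image f(4) continuous_on_subset[OF f(2)]) auto
  then obtain M where M: "M > 0" "\<And>x. x \<in> S \<Longrightarrow> norm (iter_partial is \<phi> x) \<le> M" by (auto simp: bounded_pos)
  have Mx: "norm (iter_partial is \<phi> x) \<le> M" for x
    using M f(3)[of x "is"] unfolding S_def by (cases "x \<in> S") (auto simp: S_def)
  have C: "C \<ge> 0" using order_trans[OF norm_ge_zero w[of 0]] .
  show ?thesis
  proof (rule integrable_compact_support[of _ "C * M" a b])
    show "norm (w x * iter_partial is \<phi> x) \<le> C * M" for x
      unfolding norm_mult by (intro mult_mono w Mx C) auto
    show "w x * iter_partial is \<phi> x = 0" if "x \<notin> cbox a b" for x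
      using ab that f(3)[of x "is"] by (auto simp: S_def)
  qed measurable
qed

text \<open>
  The product \<open>cis (\<kappa> \<bullet> x) * \<psi> x\<close> has compact support, so its partial derivatives integrate to \<open>0\<close>.
\<close>

lemma character_by_parts:
  fixes \<phi> :: "real ^ 'd \<Rightarrow> complex"
  assumes \<phi>: "\<phi> \<in> test_functions U"
  shows "(\<integral>x. cis (\<kappa> \<bullet> x) * iter_partial (i # is) \<phi> x \<partial>lborel)
    = - (\<i> * of_real (\<kappa> $ i)) * (\<integral>x. cis (\<kappa> \<bullet> x) * iter_partial is \<phi> x \<partial>lborel)"
proof -
  note f = test_function_facts[OF \<phi>]
  define S where "S = closure {x. \<phi> x \<noteq> 0}"
  define \<psi> where "\<psi> = iter_partial is \<phi>"
  define h where "h x = cis (\<kappa> \<bullet> x) * \<psi> x" for x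
  define e where "e = (axis i 1 :: real ^ 'd)"
  have der: "(h has_derivative (\<lambda>u. cis (\<kappa> \<bullet> x) * frechet_derivative \<psi> (at x) u + (\<i> * of_real (\<kappa> \<bullet> u)) * cis (\<kappa> \<bullet> x) * \<psi> x)) (at x)" for x
  proof -
    have "(\<psi> has_derivative frechet_derivative \<psi> (at x)) (at x)"
      using f(1)[of "is" x] unfolding \<psi>_def by (simp add: frechet_derivative_works)
    moreover have "((\<lambda>x. cis (\<kappa> \<bullet> x)) has_derivative (\<lambda>u. (\<i> * of_real (\<kappa> \<bullet> u)) * cis (\<kappa> \<bullet> x))) (at x)"
    proof -
      have "((\<lambda>x. exp (\<i> * of_real (\<kappa> \<bullet> x))) has_derivative (\<lambda>u. (\<i> * of_real (\<kappa> \<bullet> u)) * exp (\<i> * of_real (\<kappa> \<bullet> x)))) (at x)"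
      proof -
        have g: "((\<lambda>x. \<i> * of_real (\<kappa> \<bullet> x)) has_derivative (\<lambda>u. \<i> * of_real (\<kappa> \<bullet> u))) (at x)"
          by (auto intro!: derivative_eq_intros)
        have "(exp has_derivative (*) (exp z)) (at z)" for z :: complex
          using DERIV_exp by (simp add: has_field_derivative_def)
        from has_derivative_compose[OF g this] show ?thesis by (simp add: mult.commute)
      qed
      then show ?thesis by (simp add: cis_conv_exp)
    qed
    ultimately show ?thesis unfolding h_def
      by (intro has_derivative_eq_rhs[OF has_derivative_mult]) auto
  qed
  have D: "frechet_derivative h (at x) e = cis (\<kappa> \<bullet> x) * iter_partial (i # is) \<phi> x + (\<i> * of_real (\<kappa> $ i)) * (cis (\<kappa> \<bullet> x) * \<psi> x)" for x
    by (subst frechet_derivative_at[OF der, symmetric]) (simp add: \<psi>_def partial_deriv_def e_def inner_axis)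
  have contc: "continuous_on UNIV (\<lambda>x :: real ^ 'd. cis (\<kappa> \<bullet> x))"
    unfolding cis_conv_exp by (intro continuous_intros)
  have "(\<integral>x. frechet_derivative h (at x) e \<partial>lborel) = 0"
  proof (rule integral_partial_derivative_zero[where S = S])
    show "h differentiable at x" for x using der by (auto simp: differentiable_def)
    show "continuous_on UNIV (\<lambda>x. frechet_derivative h (at x) e)"
      unfolding D \<psi>_def by (intro continuous_intros contc f(2))
    show "compact S" unfolding S_def by (rule f(4))
    show "h x = 0" "frechet_derivative h (at x) e = 0" if "x \<notin> S" for x
      using f(3)[of x "is"] f(3)[of x "i # is"] that unfolding D by (auto simp: S_def h_def \<psi>_def)
  qed
  moreover have int: "integrable lborel (\<lambda>x. cis (\<kappa> \<bullet> x) * iter_partial js \<phi> x)" for js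
    by (rule integrable_test_function_times[OF \<phi>, of _ 1]) auto
  have "(\<integral>x. frechet_derivative h (at x) e \<partial>lborel) = (\<integral>x. cis (\<kappa> \<bullet> x) * iter_partial (i # is) \<phi> x \<partial>lborel)
      + (\<i> * of_real (\<kappa> $ i)) * (\<integral>x. cis (\<kappa> \<bullet> x) * \<psi> x \<partial>lborel)"
    unfolding D \<psi>_def by (subst Bochner_Integration.integral_add[OF int]) (auto intro: int integrable_mult_right simp del: iter_partial.simps)
  ultimately show ?thesis unfolding \<psi>_def by (simp add: add_eq_0_iff del: iter_partial.simps)
qed

text \<open>
  The value at frequency \<open>\<kappa>\<close> of the symbol of the derivative of multi-index \<open>\<alpha>\<close>.
\<close>

definition monomial :: "('d::finite \<Rightarrow> nat) \<Rightarrow> real ^ 'd \<Rightarrow> complex" where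
  "monomial \<alpha> \<kappa> = (\<Prod>i\<in>UNIV. (\<i> * of_real (\<kappa> $ i)) ^ \<alpha> i)"

lemma prod_list_count:
  fixes g :: "'d::finite \<Rightarrow> 'c::comm_monoid_mult"
  shows "prod_list (map g is) = (\<Prod>i\<in>UNIV. g i ^ count_list is i)"
proof (induction "is")
  case (Cons j "is")
  have "(\<Prod>i\<in>UNIV. g i ^ count_list (j # is) i) = (\<Prod>i\<in>UNIV. (if i = j then g j else 1) * g i ^ count_list is i)"
    by (intro prod.cong) auto
  also have "\<dots> = g j * (\<Prod>i\<in>UNIV. g i ^ count_list is i)" by (simp add: prod.distrib)
  finally show ?case using Cons by simp
qed simp

lemma character_by_parts_iterated:
  fixes \<phi> :: "real ^ 'd \<Rightarrow> complex"
  assumes \<phi>: "\<phi> \<in> test_functions U" and cnt: "\<And>i. count_list is i = \<alpha> i"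
  shows "(\<integral>x. cis (\<kappa> \<bullet> x) * iter_partial is \<phi> x \<partial>lborel)
    = (-1) ^ (\<Sum>i\<in>UNIV. \<alpha> i) * monomial \<alpha> \<kappa> * (\<integral>x. cis (\<kappa> \<bullet> x) * \<phi> x \<partial>lborel)"
proof -
  have "(\<integral>x. cis (\<kappa> \<bullet> x) * iter_partial js \<phi> x \<partial>lborel)
    = prod_list (map (\<lambda>i. - (\<i> * of_real (\<kappa> $ i))) js) * (\<integral>x. cis (\<kappa> \<bullet> x) * \<phi> x \<partial>lborel)" for js
  proof (induction js)
    case (Cons j js)
    show ?case unfolding character_by_parts[OF \<phi>] Cons by (simp add: mult.assoc)
  qed simp
  also have "prod_list (map (\<lambda>i. - (\<i> * of_real (\<kappa> $ i))) is) = (\<Prod>i\<in>UNIV. (- 1) ^ \<alpha> i * (\<i> * of_real (\<kappa> $ i)) ^ \<alpha> i)"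
    unfolding prod_list_count cnt by (intro prod.cong refl) (simp add: power_mult_distrib[symmetric])
  also have "\<dots> = (-1) ^ (\<Sum>i\<in>UNIV. \<alpha> i) * monomial \<alpha> \<kappa>"
    by (simp add: prod.distrib monomial_def power_sum)
  finally show ?thesis .
qed

lemma lattice_series_bound:
  assumes "summable (\<lambda>n. norm (B n))"
  shows "norm (lattice_series B x) \<le> (\<Sum>n. norm (B n))"
  unfolding lattice_series_def
  by (rule order_trans[OF summable_norm]) (use assms in \<open>auto simp: norm_mult\<close>)

lemma integral_lattice_series_times:
  fixes \<phi> :: "real ^ 'd \<Rightarrow> complex"
  assumes \<phi>: "\<phi> \<in> test_functions U" and B: "summable (\<lambda>n. norm (B n))"
  shows "(\<lambda>n. B n * (\<integral>x. cis (lattice_vec n \<bullet> x) * iter_partial is \<phi> x \<partial>lborel)) sums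
    (\<integral>x. lattice_series B x * iter_partial is \<phi> x \<partial>lborel)"
proof -
  have int: "integrable lborel (\<lambda>x. B n * cis (lattice_vec n \<bullet> x) * iter_partial is \<phi> x)" for n
    by (rule integrable_test_function_times[OF \<phi>, of _ "norm (B n)"]) (auto simp: norm_mult)
  have "(\<lambda>n. \<integral>x. B n * cis (lattice_vec n \<bullet> x) * iter_partial is \<phi> x \<partial>lborel) sums
    (\<integral>x. (\<Sum>n. B n * cis (lattice_vec n \<bullet> x) * iter_partial is \<phi> x) \<partial>lborel)"
  proof (rule sums_integral[OF int])
    show "AE x in lborel. summable (\<lambda>n. norm (B n * cis (lattice_vec n \<bullet> x) * iter_partial is \<phi> x))"
      using summable_mult2[OF B] by (simp add: norm_mult)
    show "summable (\<lambda>n. \<integral>x. norm (B n * cis (lattice_vec n \<bullet> x) * iter_partial is \<phi> x) \<partial>lborel)"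
      using summable_mult2[OF B] by (simp add: norm_mult)
  qed
  also have "(\<lambda>n. \<integral>x. B n * cis (lattice_vec n \<bullet> x) * iter_partial is \<phi> x \<partial>lborel) = (\<lambda>n. B n * (\<integral>x. cis (lattice_vec n \<bullet> x) * iter_partial is \<phi> x \<partial>lborel))"
    by (simp add: mult.assoc)
  also have "(\<lambda>x. \<Sum>n. B n * cis (lattice_vec n \<bullet> x) * iter_partial is \<phi> x) = (\<lambda>x. lattice_series B x * iter_partial is \<phi> x)"
  proof
    fix x
    show "(\<Sum>n. B n * cis (lattice_vec n \<bullet> x) * iter_partial is \<phi> x) = lattice_series B x * iter_partial is \<phi> x"
      using sums_mult2[OF lattice_series_sums[OF B], of x "iter_partial is \<phi> x"] by (simp add: sums_iff)
  qed
  finally show ?thesis .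
qed

text \<open>
  Here \<open>g\<close> may be arbitrary on the null set \<open>S\<close> and outside \<open>T\<close>; its measurability follows from that
  of \<open>f\<close>.  This is needed because functions are only given up to null sets.
\<close>

lemma set_lebesgue_integral_spike:
  fixes f :: "'a::euclidean_space \<Rightarrow> 'b::euclidean_space"
  assumes f: "f absolutely_integrable_on T" and S: "negligible S" "\<And>x. x \<in> T - S \<Longrightarrow> g x = f x"
  shows "(LINT x:T|lebesgue. g x) = (LINT x:T|lebesgue. f x)"
proof -
  have g: "g absolutely_integrable_on T" by (rule absolutely_integrable_spike[OF f S])
  show ?thesis
    using set_lebesgue_integral_eq_integral(2)[OF f] set_lebesgue_integral_eq_integral(2)[OF g] integral_spike[OF S(1), of T f g] S(2) by simp
qed

lemma absolutely_integrable_if_integrable_lborel: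
  fixes f :: "'a::euclidean_space \<Rightarrow> complex"
  assumes "integrable lborel f" "T \<in> sets borel"
  shows "f absolutely_integrable_on T"
proof -
  have "integrable lborel (\<lambda>x. indicator T x *\<^sub>R f x)" using assms by (intro integrable_mult_indicator) auto
  then show ?thesis unfolding set_integrable_def
    by (subst integrable_completion) auto
qed

text \<open>
  Against a test function the series may be integrated term by term, and every term may be
  integrated by parts.
\<close>

lemma has_weak_deriv_lattice_series:
  fixes u :: "real ^ 'd \<Rightarrow> complex"
  assumes U: "open U" and u: "AE x in lebesgue. x \<in> U \<longrightarrow> u x = lattice_series B x"
    and B: "summable (\<lambda>n. norm (B n))" and B\<alpha>: "summable (\<lambda>n. norm (B n * monomial \<alpha> (lattice_vec n)))"
  shows "has_weak_deriv U \<alpha> u (lattice_series (\<lambda>n. B n * monomial \<alpha> (lattice_vec n)))"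
proof -
  define v where "v = (lattice_series B :: real ^ 'd \<Rightarrow> complex)"
  define w where "w = (lattice_series (\<lambda>n. B n * monomial \<alpha> (lattice_vec n)) :: real ^ 'd \<Rightarrow> complex)"
  have [measurable]: "v \<in> borel_measurable borel" "w \<in> borel_measurable borel" by (simp_all add: v_def w_def)
  obtain Cv where Cv: "\<And>x. norm (v x) \<le> Cv" unfolding v_def using lattice_series_bound[OF B] by blast
  obtain Cw where Cw: "\<And>x. norm (w x) \<le> Cw" unfolding w_def using lattice_series_bound[OF B\<alpha>] by blast
  obtain N where N: "N \<in> null_sets lebesgue" "{x \<in> space lebesgue. \<not> (x \<in> U \<longrightarrow> u x = v x)} \<subseteq> N"
    using u unfolding v_def by (auto elim!: AE_E3 simp: eventually_ae_filter)
  have negN: "negligible N" using N(1) by (simp add: negligible_iff_null_sets)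
  have uv: "u x = v x" if "x \<in> U - N" for x using N(2) that by auto
  have compact_int: "f absolutely_integrable_on K" if K: "compact K" and [measurable]: "f \<in> borel_measurable borel" and f: "\<And>x. norm (f x) \<le> C"
    for K and f :: "real ^ 'd \<Rightarrow> complex" and C
  proof -
    obtain a b where ab: "K \<subseteq> cbox a b" using bounded_subset_cbox_symmetric[OF compact_imp_bounded[OF K]] by metis
    have [measurable]: "K \<in> sets borel" using K by (simp add: borel_compact)
    have C: "C \<ge> 0" using order_trans[OF norm_ge_zero f[of 0]] .
    have "integrable lborel (\<lambda>x. indicator K x *\<^sub>R f x)"
      by (rule integrable_compact_support[of _ C a b]) (use ab f C in \<open>auto simp: indicator_def\<close>)
    then show ?thesis unfolding set_integrable_def by (subst integrable_completion) auto
  qed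
  have Ub: "U \<in> sets borel" using U by simp
  show ?thesis unfolding has_weak_deriv_def w_def[symmetric]
  proof (intro conjI allI impI ballI)
    fix K assume K: "compact K \<and> K \<subseteq> U"
    show "w absolutely_integrable_on K" using K Cw by (intro compact_int) auto
    have "v absolutely_integrable_on K" using K Cv by (intro compact_int) auto
    then show "u absolutely_integrable_on K"
      by (rule absolutely_integrable_spike[OF _ negN]) (use K uv in auto)
  next
    fix \<phi> :: "real ^ 'd \<Rightarrow> complex" and "is" assume \<phi>: "\<phi> \<in> test_functions U" and cnt: "\<forall>i. count_list is i = \<alpha> i"
    have setint: "(LINT x:U|lebesgue. f x * iter_partial js \<phi> x) = (\<integral>x. f x * iter_partial js \<phi> x \<partial>lborel)"
      if [measurable]: "f \<in> borel_measurable borel" for f js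
    proof -
      have [measurable]: "iter_partial js \<phi> \<in> borel_measurable borel"
        by (rule borel_measurable_continuous_onI) (rule test_function_cont[OF \<phi>])
      have "indicator U x *\<^sub>R (f x * iter_partial js \<phi> x) = f x * iter_partial js \<phi> x" for x
        using test_function_supp[OF \<phi>, of x js] test_function_sub[OF \<phi>] by (cases "x \<in> U") auto
      then show ?thesis unfolding set_lebesgue_integral_def by (simp add: integral_completion)
    qed
    have iv: "integrable lborel (\<lambda>x. v x * iter_partial is \<phi> x)"
      by (rule integrable_test_function_times[OF \<phi> _ Cv]) simp
    have "(LINT x:U|lebesgue. u x * iter_partial is \<phi> x) = (LINT x:U|lebesgue. v x * iter_partial is \<phi> x)"
      by (rule set_lebesgue_integral_spike[OF absolutely_integrable_if_integrable_lborel[OF iv Ub] negN]) (simp add: uv)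
    also have "\<dots> = (\<integral>x. v x * iter_partial is \<phi> x \<partial>lborel)" by (rule setint) simp
    also have "\<dots> = (-1) ^ (\<Sum>i\<in>UNIV. \<alpha> i) * (\<integral>x. w x * iter_partial [] \<phi> x \<partial>lborel)"
    proof (rule sums_unique2)
      show "(\<lambda>n. B n * (\<integral>x. cis (lattice_vec n \<bullet> x) * iter_partial is \<phi> x \<partial>lborel)) sums (\<integral>x. v x * iter_partial is \<phi> x \<partial>lborel)"
        unfolding v_def by (rule integral_lattice_series_times[OF \<phi> B])
      have "(\<lambda>n. (-1) ^ (\<Sum>i\<in>UNIV. \<alpha> i) * (B n * monomial \<alpha> (lattice_vec n) * (\<integral>x. cis (lattice_vec n \<bullet> x) * iter_partial [] \<phi> x \<partial>lborel))) sums
        ((-1) ^ (\<Sum>i\<in>UNIV. \<alpha> i) * (\<integral>x. w x * iter_partial [] \<phi> x \<partial>lborel))"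
        unfolding w_def by (intro sums_mult integral_lattice_series_times[OF \<phi> B\<alpha>])
      also have "(\<lambda>n. (-1) ^ (\<Sum>i\<in>UNIV. \<alpha> i) * (B n * monomial \<alpha> (lattice_vec n) * (\<integral>x. cis (lattice_vec n \<bullet> x) * iter_partial [] \<phi> x \<partial>lborel)))
        = (\<lambda>n. B n * (\<integral>x. cis (lattice_vec n \<bullet> x) * iter_partial is \<phi> x \<partial>lborel))"
        using cnt by (subst character_by_parts_iterated[OF \<phi>, of "is" \<alpha>]) (auto simp: fun_eq_iff)
      finally show "(\<lambda>n. B n * (\<integral>x. cis (lattice_vec n \<bullet> x) * iter_partial is \<phi> x \<partial>lborel)) sums
        ((-1) ^ (\<Sum>i\<in>UNIV. \<alpha> i) * (\<integral>x. w x * iter_partial [] \<phi> x \<partial>lborel))" .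
    qed
    also have "(\<integral>x. w x * iter_partial [] \<phi> x \<partial>lborel) = (LINT x:U|lebesgue. w x * iter_partial [] \<phi> x)"
      by (rule setint[symmetric]) simp
    finally show "(LINT x:U|lebesgue. u x * iter_partial is \<phi> x) = (-1) ^ (\<Sum>i\<in>UNIV. \<alpha> i) * (LINT x:U|lebesgue. w x * \<phi> x)"
      by simp
  qed
qed

section \<open>The Sobolev norm of a lattice series\<close>

lemma norm_monomial_le: "norm (monomial \<alpha> \<kappa>) \<le> (1 + norm \<kappa>) ^ (\<Sum>i\<in>UNIV. \<alpha> i)"
proof -
  have "norm (monomial \<alpha> \<kappa>) = (\<Prod>i\<in>UNIV. \<bar>\<kappa> $ i\<bar> ^ \<alpha> i)"
    by (simp add: monomial_def prod_norm[symmetric] norm_power norm_mult)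
  also have "\<dots> \<le> (\<Prod>i\<in>UNIV. (1 + norm \<kappa>) ^ \<alpha> i)"
    by (intro prod_mono conjI power_mono) (auto intro: order_trans[OF component_le_norm_cart])
  also have "\<dots> = (1 + norm \<kappa>) ^ (\<Sum>i\<in>UNIV. \<alpha> i)" by (simp add: power_sum)
  finally show ?thesis .
qed

lemma summable_if_finite_sums_bounded:
  fixes f :: "nat \<Rightarrow> real"
  assumes "\<And>n. f n \<ge> 0" "\<And>F. finite F \<Longrightarrow> sum f F \<le> C"
  shows "summable f"
  by (rule bounded_imp_summable[of _ C]) (use assms in auto)

lemma suminf_ennreal_le:
  fixes f g :: "nat \<Rightarrow> real"
  assumes "\<And>n. 0 \<le> f n" "\<And>n. f n \<le> g n" "\<And>F. finite F \<Longrightarrow> sum g F \<le> S"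
  shows "(\<Sum>n. ennreal (f n)) \<le> ennreal S"
proof (rule suminf_le_const[OF summableI])
  fix n
  have "sum f {..<n} \<le> S" using sum_mono[of "{..<n}" f g] assms(2) assms(3)[of "{..<n}"] by force
  then show "(\<Sum>i<n. ennreal (f i)) \<le> ennreal S" using assms(1) by (simp add: ennreal_leI)
qed

text \<open>
  The derivatives of \<open>lattice_series A\<close> of order up to \<open>k = \<lfloor>m\<rfloor>\<close> have coefficients
  \<open>A n * monomial \<alpha> (lattice_vec n)\<close>.  Those are at most \<open>(1 + \<bar>lattice_vec n\<bar>) ^ k * \<bar>A n\<bar>\<close>, and the
  symbol of the seminorm of order \<open>\<sigma>\<close> supplies the missing power \<open>m - k = \<sigma>\<close> of the weight.
\<close>

lemma sobolev_norm_lattice_series: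
  fixes m :: real
  assumes m: "m \<ge> 0"
  obtains C where "C > 0" "\<And>(u :: real ^ 'd \<Rightarrow> complex) A S.
    summable (\<lambda>n. (1 + norm (lattice_vec n :: real ^ 'd)) powr m * cmod (A n)) \<Longrightarrow>
    (AE x in lebesgue. x \<in> box 0 1 \<longrightarrow> u x = lattice_series A x) \<Longrightarrow>
    (\<And>F. finite F \<Longrightarrow> (\<Sum>n\<in>F. ((1 + norm (lattice_vec n :: real ^ 'd)) powr m * cmod (A n))\<^sup>2) \<le> S) \<Longrightarrow>
    sobolev_norm m (box 0 1) u \<le> ennreal (C * sqrt S)"
proof -
  define k where "k = nat \<lfloor>m\<rfloor>"
  define \<sigma> where "\<sigma> = frac m"
  have mk: "m = real k + \<sigma>" using m by (simp add: k_def \<sigma>_def frac_def)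
  have \<sigma>: "0 \<le> \<sigma>" "\<sigma> < 1" by (simp_all add: \<sigma>_def frac_ge_0 frac_lt_1)
  have "\<exists>K\<ge>0. \<sigma> \<noteq> 0 \<longrightarrow> (\<forall>\<kappa> :: real ^ 'd.
    gagliardo_symbol \<sigma> \<kappa> \<le> ennreal (K * norm \<kappa> powr (2 * \<sigma>)))"
  proof (cases "\<sigma> = 0")
    case False
    then have "0 < \<sigma>" using \<sigma> by simp
    then obtain K where "K \<ge> 0" "\<And>\<kappa> :: real ^ 'd.
      gagliardo_symbol \<sigma> \<kappa> \<le> ennreal (K * norm \<kappa> powr (2 * \<sigma>))"
      by (rule gagliardo_character[OF _ \<sigma>(2), where 'd = 'd]) blast
    then show ?thesis by blast
  qed (rule exI[of _ 0], simp)
  then obtain K where K: "K \<ge> 0" "\<sigma> \<noteq> 0 \<Longrightarrow> gagliardo_symbol \<sigma> \<kappa>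
      \<le> ennreal (K * norm \<kappa> powr (2 * \<sigma>))" for \<kappa> :: "real ^ 'd"
    by blast
  define w where "w n = (1 + norm (lattice_vec n :: real ^ 'd)) powr m" for n
  define c where "c = (2 * pi) ^ CARD('d)"
  have c: "c > 0" by (simp add: c_def)
  define P1 where "P1 = real (card {\<alpha> :: 'd \<Rightarrow> nat. (\<Sum>i\<in>UNIV. \<alpha> i) \<le> k})"
  define P2 where "P2 = real (card {\<alpha> :: 'd \<Rightarrow> nat. (\<Sum>i\<in>UNIV. \<alpha> i) = k})"
  define Q where "Q = P1 * c + P2 * (c * K)"
  have Q: "Q \<ge> 0" using c K(1) by (simp add: Q_def P1_def P2_def)
  show ?thesis
  proof (rule that[of "sqrt Q + 1"])
    show "sqrt Q + 1 > 0" using Q by (simp add: add_nonneg_pos)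
    fix u :: "real ^ 'd \<Rightarrow> complex" and A S
    assume sA: "summable (\<lambda>n. (1 + norm (lattice_vec n :: real ^ 'd)) powr m * cmod (A n))"
      and u: "AE x in lebesgue. x \<in> box 0 1 \<longrightarrow> u x = lattice_series A x"
      and S: "\<And>F. finite F \<Longrightarrow> (\<Sum>n\<in>F. ((1 + norm (lattice_vec n :: real ^ 'd)) powr m * cmod (A n))\<^sup>2) \<le> S"
    have S0: "S \<ge> 0" using S[of "{}"] by simp
    define B where "B \<alpha> n = A n * monomial \<alpha> (lattice_vec n :: real ^ 'd)" for \<alpha> n
    have mon: "norm (B \<alpha> n) \<le> (1 + norm (lattice_vec n :: real ^ 'd)) powr real k * cmod (A n)" if "(\<Sum>i\<in>UNIV. \<alpha> i) \<le> k" for \<alpha> n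
    proof -
      have "norm (monomial \<alpha> (lattice_vec n :: real ^ 'd)) \<le> (1 + norm (lattice_vec n :: real ^ 'd)) ^ k"
        by (rule order_trans[OF norm_monomial_le]) (use that in \<open>auto intro: power_increasing\<close>)
      from mult_right_mono[OF this, of "cmod (A n)"] show ?thesis
        by (simp add: B_def norm_mult powr_realpow add_pos_nonneg mult.commute)
    qed
    have wk: "(1 + norm (lattice_vec n :: real ^ 'd)) powr real k \<le> w n" for n
      unfolding w_def by (rule powr_mono) (use mk \<sigma> in simp_all)
    have monw: "norm (B \<alpha> n) \<le> w n * cmod (A n)" if "(\<Sum>i\<in>UNIV. \<alpha> i) \<le> k" for \<alpha> n
      by (rule order_trans[OF mon[OF that] mult_right_mono[OF wk]]) simp
    have sB: "summable (\<lambda>n. norm (B \<alpha> n))" if "(\<Sum>i\<in>UNIV. \<alpha> i) \<le> k" for \<alpha>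
      using monw[OF that] sA by (intro summable_comparison_test[OF _ sA]) (auto simp: w_def)
    have sA': "summable (\<lambda>n. norm (A n))"
      using sB[of "\<lambda>_. 0"] by (simp add: B_def monomial_def)
    have D: "(\<lambda>\<alpha>. lattice_series (B \<alpha>)) \<in> weak_deriv_families k (box 0 1) u"
      unfolding weak_deriv_families_def mem_Collect_eq B_def
    proof (intro allI impI has_weak_deriv_lattice_series open_box u sA')
      fix \<alpha> :: "'d \<Rightarrow> nat" assume "(\<Sum>i\<in>UNIV. \<alpha> i) \<le> k"
      from sB[OF this] show "summable (\<lambda>n. norm (A n * monomial \<alpha> (lattice_vec n)))" by (simp add: B_def)
    qed
    have L2: "L2_norm_sq (box 0 1) (lattice_series (B \<alpha>) :: real ^ 'd \<Rightarrow> complex) \<le> ennreal (c * S)" if "(\<Sum>i\<in>UNIV. \<alpha> i) \<le> k" for \<alpha>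
    proof -
      have "(\<Sum>n. ennreal ((cmod (B \<alpha> n))\<^sup>2)) \<le> ennreal S"
      proof (rule suminf_ennreal_le)
        show "(cmod (B \<alpha> n))\<^sup>2 \<le> (w n * cmod (A n))\<^sup>2" for n
          by (rule power_mono[OF monw[OF that] norm_ge_zero])
      qed (use S in \<open>auto simp: w_def\<close>)
      then have "ennreal c * (\<Sum>n. ennreal ((cmod (B \<alpha> n))\<^sup>2)) \<le> ennreal c * ennreal S"
        by (rule mult_left_mono[OF _ zero_le])
      also have "\<dots> = ennreal (c * S)" using c S0 by (simp add: ennreal_mult)
      finally show ?thesis
        unfolding c_def by (rule order_trans[OF L2_norm_sq_lattice_series[OF sB[OF that]]])
    qed
    have Sl: "slobodeckij_sq \<sigma> (box 0 1) (lattice_series (B \<alpha>) :: real ^ 'd \<Rightarrow> complex) \<le> ennreal (c * K * S)"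
      if "\<sigma> \<noteq> 0" "(\<Sum>i\<in>UNIV. \<alpha> i) = k" for \<alpha>
    proof -
      have ak: "(\<Sum>i\<in>UNIV. \<alpha> i) \<le> k" using that by simp
      have "(\<Sum>n. ennreal ((cmod (B \<alpha> n))\<^sup>2) * ennreal (K * norm (lattice_vec n :: real ^ 'd) powr (2 * \<sigma>)))
        = (\<Sum>n. ennreal ((cmod (B \<alpha> n))\<^sup>2 * (K * norm (lattice_vec n :: real ^ 'd) powr (2 * \<sigma>))))"
        using K(1) by (simp add: ennreal_mult)
      also have "\<dots> \<le> ennreal (K * S)"
      proof (rule suminf_ennreal_le)
        fix n
        define t where "t = 1 + norm (lattice_vec n :: real ^ 'd)"
        have t: "t > 0" by (simp add: t_def add_pos_nonneg)
        show "0 \<le> (cmod (B \<alpha> n))\<^sup>2 * (K * norm (lattice_vec n :: real ^ 'd) powr (2 * \<sigma>))" using K(1) by simp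
        have "(cmod (B \<alpha> n))\<^sup>2 * (K * norm (lattice_vec n :: real ^ 'd) powr (2 * \<sigma>)) \<le> (t powr real k * cmod (A n))\<^sup>2 * (K * t powr (2 * \<sigma>))"
          using mon[OF ak, of n] K(1) \<sigma> unfolding t_def
          by (intro mult_mono power_mono mult_left_mono powr_mono2) auto
        also have "\<dots> = K * (t powr m * cmod (A n))\<^sup>2"
        proof -
          have "(t powr real k)\<^sup>2 * t powr (2 * \<sigma>) = (t powr m)\<^sup>2"
          proof -
            have "(t powr real k)\<^sup>2 * t powr (2 * \<sigma>) = t powr (real k + real k + 2 * \<sigma>)"
              by (simp only: power2_eq_square powr_add)
            also have "real k + real k + 2 * \<sigma> = m + m" by (simp add: mk)
            also have "t powr (m + m) = (t powr m)\<^sup>2" by (simp only: power2_eq_square powr_add)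
            finally show ?thesis .
          qed
          then show ?thesis by (simp add: power_mult_distrib mult_ac)
        qed
        finally show "(cmod (B \<alpha> n))\<^sup>2 * (K * norm (lattice_vec n :: real ^ 'd) powr (2 * \<sigma>)) \<le> K * (w n * cmod (A n))\<^sup>2"
          by (simp add: w_def t_def)
      next
        show "(\<Sum>n\<in>F. K * (w n * cmod (A n))\<^sup>2) \<le> K * S" if "finite F" for F
          unfolding sum_distrib_left[symmetric] w_def by (intro mult_left_mono S that K(1))
      qed
      finally have "ennreal c * (\<Sum>n. ennreal ((cmod (B \<alpha> n))\<^sup>2) * ennreal (K * norm (lattice_vec n :: real ^ 'd) powr (2 * \<sigma>)))
         \<le> ennreal c * ennreal (K * S)" by (rule mult_left_mono) simp
      also have "\<dots> = ennreal (c * K * S)" using c K(1) S0 by (simp add: ennreal_mult[symmetric] mult.assoc)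
      finally show ?thesis
        unfolding c_def by (rule order_trans[OF slobodeckij_sq_lattice_series[OF sB[OF ak] K(2)[OF that(1)]]])
    qed
    have "sobolev_norm_sq m (box 0 1) u \<le>
        (\<Sum>\<alpha> | (\<Sum>i\<in>UNIV. \<alpha> i) \<le> k. L2_norm_sq (box 0 1) (lattice_series (B \<alpha>) :: real ^ 'd \<Rightarrow> complex)) +
        (if \<sigma> = 0 then 0 else (\<Sum>\<alpha> | (\<Sum>i\<in>UNIV. \<alpha> i) = k. slobodeckij_sq \<sigma> (box 0 1) (lattice_series (B \<alpha>) :: real ^ 'd \<Rightarrow> complex)))"
      unfolding sobolev_norm_sq_def Let_def k_def[symmetric] \<sigma>_def[symmetric]
      by (rule INF_lower[OF D])
    also have "\<dots> \<le> of_nat (card {\<alpha> :: 'd \<Rightarrow> nat. (\<Sum>i\<in>UNIV. \<alpha> i) \<le> k}) * ennreal (c * S) +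
        of_nat (card {\<alpha> :: 'd \<Rightarrow> nat. (\<Sum>i\<in>UNIV. \<alpha> i) = k}) * ennreal (c * K * S)"
    proof (intro add_mono)
      show "(\<Sum>\<alpha> | (\<Sum>i\<in>UNIV. \<alpha> i) \<le> k. L2_norm_sq (box 0 1) (lattice_series (B \<alpha>) :: real ^ 'd \<Rightarrow> complex))
        \<le> of_nat (card {\<alpha> :: 'd \<Rightarrow> nat. (\<Sum>i\<in>UNIV. \<alpha> i) \<le> k}) * ennreal (c * S)"
        by (rule sum_bounded_above) (auto intro: L2)
      show "(if \<sigma> = 0 then 0 else (\<Sum>\<alpha> | (\<Sum>i\<in>UNIV. \<alpha> i) = k. slobodeckij_sq \<sigma> (box 0 1) (lattice_series (B \<alpha>) :: real ^ 'd \<Rightarrow> complex)))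
        \<le> of_nat (card {\<alpha> :: 'd \<Rightarrow> nat. (\<Sum>i\<in>UNIV. \<alpha> i) = k}) * ennreal (c * K * S)"
        using sum_bounded_above[of "{\<alpha> :: 'd \<Rightarrow> nat. (\<Sum>i\<in>UNIV. \<alpha> i) = k}" "\<lambda>\<alpha>. slobodeckij_sq \<sigma> (box 0 1) (lattice_series (B \<alpha>) :: real ^ 'd \<Rightarrow> complex)"] Sl by auto
    qed
    also have "\<dots> = ennreal (Q * S)"
      using c K(1) S0
    proof -
      have P0: "P1 \<ge> 0" "P2 \<ge> 0" by (simp_all add: P1_def P2_def)
      have "Q * S = P1 * (c * S) + P2 * (c * K * S)" by (simp add: Q_def algebra_simps)
      also have "ennreal \<dots> = ennreal (P1 * (c * S)) + ennreal (P2 * (c * K * S))"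
        using c K(1) S0 P0 by (intro ennreal_plus) auto
      also have "\<dots> = ennreal P1 * ennreal (c * S) + ennreal P2 * ennreal (c * K * S)"
        using c K(1) S0 P0 by (intro arg_cong2[of _ _ _ _ "(+)"] ennreal_mult) auto
      finally show ?thesis by (simp add: P1_def P2_def ennreal_of_nat_eq_real_of_nat)
    qed
    finally have le: "sobolev_norm_sq m (box 0 1) u \<le> ennreal (Q * S)" .
    then have fin: "sobolev_norm_sq m (box 0 1) u \<noteq> \<infinity>" by (auto simp: top_unique)
    have "enn2real (sobolev_norm_sq m (box 0 1) u) \<le> Q * S"
      using enn2real_mono[OF le] Q S0 by simp
    then have "sqrt (enn2real (sobolev_norm_sq m (box 0 1) u)) \<le> sqrt Q * sqrt S"
      by (simp flip: real_sqrt_mult)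
    also have "\<dots> \<le> (sqrt Q + 1) * sqrt S" using S0 by (intro mult_right_mono) auto
    finally show "sobolev_norm m (box 0 1) u \<le> ennreal ((sqrt Q + 1) * sqrt S)"
      using fin by (simp add: sobolev_norm_def ennreal_leI)
  qed
qed

section \<open>Selecting the frequencies\<close>

text \<open>
  A lattice point in the ball has all coordinates in \<open>{-r..r}\<close> with \<open>r = \<lfloor>\<rho> - 1\<rfloor>\<close>.  The \<open>1\<close> in the
  weight is what makes \<open>2 * r + 1 \<le> 2 * \<rho>\<close> true, without an additive constant, and the ball empty
  for \<open>\<rho> < 1\<close>; so the bound holds for all \<open>\<rho> \<ge> 0\<close>, as is needed for small \<open>n\<close>.
\<close>

lemma card_lattice_ball:
  fixes \<rho> :: real
  assumes \<rho>: "\<rho> \<ge> 0"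
  shows "finite {n. 1 + norm (lattice_vec n :: real ^ 'd) \<le> \<rho>}"
    and "real (card {n. 1 + norm (lattice_vec n :: real ^ 'd) \<le> \<rho>}) \<le> (2 * \<rho>) ^ CARD('d)"
proof -
  define \<Lambda> where "\<Lambda> = {n. 1 + norm (lattice_vec n :: real ^ 'd) \<le> \<rho>}"
  define r where "r = \<lfloor>\<rho> - 1\<rfloor>"
  define G where "G = PiE (UNIV :: 'd set) (\<lambda>_. {-r..r})"
  have inj: "inj_on (lattice_index :: nat \<Rightarrow> 'd \<Rightarrow> int) \<Lambda>"
    using bij_is_inj[OF bij_lattice_index] by (rule inj_on_subset) simp
  have sub: "(lattice_index :: nat \<Rightarrow> 'd \<Rightarrow> int) ` \<Lambda> \<subseteq> G"
  proof
    fix g :: "'d \<Rightarrow> int" assume "g \<in> lattice_index ` \<Lambda>"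
    then obtain n where n: "n \<in> \<Lambda>" "g = lattice_index n" by auto
    have "\<bar>g i\<bar> \<le> r" for i
    proof -
      have "\<bar>of_int (g i) :: real\<bar> \<le> norm (lattice_vec n :: real ^ 'd)"
        using component_le_norm_cart[of "lattice_vec n :: real ^ 'd" i] by (simp add: n lattice_vec_def)
      also have "\<dots> \<le> \<rho> - 1" using n by (simp add: \<Lambda>_def)
      finally have "of_int \<bar>g i\<bar> \<le> \<rho> - 1" by simp
      then show ?thesis unfolding r_def by (rule le_floor_iff[THEN iffD2])
    qed
    then show "g \<in> G" by (auto simp: G_def abs_le_iff minus_le_iff)
  qed
  have fG: "finite G" unfolding G_def by (intro finite_PiE) auto
  show fin: "finite {n. 1 + norm (lattice_vec n :: real ^ 'd) \<le> \<rho>}"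
    using finite_subset[OF sub fG] inj unfolding \<Lambda>_def by (rule finite_imageD)
  show "real (card {n. 1 + norm (lattice_vec n :: real ^ 'd) \<le> \<rho>}) \<le> (2 * \<rho>) ^ CARD('d)"
  proof (cases "\<rho> < 1")
    case True
    then have "\<Lambda> = {}" by (auto simp: \<Lambda>_def dest: order_trans[rotated]) (smt (verit) norm_ge_zero)
    then show ?thesis using \<rho> by (simp add: \<Lambda>_def)
  next
    case False
    then have r: "r \<ge> 0" "real_of_int r \<le> \<rho> - 1" by (auto simp: r_def)
    have "card \<Lambda> = card ((lattice_index :: nat \<Rightarrow> 'd \<Rightarrow> int) ` \<Lambda>)" using inj by (simp add: card_image)
    also have "\<dots> \<le> card G" by (rule card_mono[OF fG sub])
    also have "card G = (nat (2 * r + 1)) ^ CARD('d)" by (simp add: G_def card_PiE)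
    finally have "real (card \<Lambda>) \<le> real ((nat (2 * r + 1)) ^ CARD('d))" by (simp only: of_nat_le_iff)
    also have "\<dots> = (2 * real_of_int r + 1) ^ CARD('d)" using r by simp
    also have "\<dots> \<le> (2 * \<rho>) ^ CARD('d)" using r by (intro power_mono) auto
    finally show ?thesis by (simp add: \<Lambda>_def)
  qed
qed

text \<open>
  Stechkin's estimate.  At most \<open>N\<close> entries exceed \<open>W / N\<close> since the total is at most \<open>W\<close>, and the
  squares of the others are at most \<open>W / N\<close> times the entries.
\<close>

lemma stechkin_selection:
  fixes b :: "'k \<Rightarrow> real"
  assumes b: "\<And>k. b k \<ge> 0" and W: "\<And>F. finite F \<Longrightarrow> F \<inter> \<Lambda> = {} \<Longrightarrow> sum b F \<le> W" and N: "N > 0"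
  obtains T where "finite T" "real (card T) \<le> N" "T \<inter> \<Lambda> = {}"
    "\<And>F. finite F \<Longrightarrow> F \<inter> (\<Lambda> \<union> T) = {} \<Longrightarrow> (\<Sum>k\<in>F. (b k)\<^sup>2) \<le> W\<^sup>2 / N"
proof -
  have W0: "W \<ge> 0" using W[of "{}"] by simp
  define T where "T = {k. k \<notin> \<Lambda> \<and> b k > W / N}"
  have cardF: "real (card F) \<le> N" if F: "finite F" "F \<subseteq> T" for F
  proof (cases "F = {}")
    case False
    then obtain k where k: "k \<in> F" by auto
    have "0 \<le> W / N" using W0 N by simp
    also have "\<dots> < b k" using k F by (auto simp: T_def)
    also have "b k \<le> W" using W[of "{k}"] k F by (auto simp: T_def)
    finally have Wpos: "W > 0" .
    have "real (card F) * (W / N) \<le> sum b F"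
      by (rule sum_bounded_below) (use F in \<open>auto simp: T_def\<close>)
    also have "\<dots> \<le> W" using F by (intro W) (auto simp: T_def)
    finally show ?thesis using Wpos N by (simp add: field_simps)
  qed (use N in simp)
  have finT: "finite T"
  proof (rule ccontr)
    assume "infinite T"
    then obtain F where F: "F \<subseteq> T" "finite F" "card F = nat \<lceil>N\<rceil> + 1" by (metis infinite_arbitrarily_large)
    then have "real (nat \<lceil>N\<rceil> + 1) \<le> N" using cardF[of F] by simp
    then show False using real_nat_ceiling_ge[of N] by linarith
  qed
  show ?thesis
  proof (rule that[OF finT cardF[OF finT subset_refl]])
    show "T \<inter> \<Lambda> = {}" by (auto simp: T_def)
    fix F assume F: "finite F" "F \<inter> (\<Lambda> \<union> T) = {}"
    have "(\<Sum>k\<in>F. (b k)\<^sup>2) \<le> (\<Sum>k\<in>F. (W / N) * b k)"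
    proof (rule sum_mono)
      fix k assume "k \<in> F"
      then have "b k \<le> W / N" using F by (auto simp: T_def)
      then show "(b k)\<^sup>2 \<le> (W / N) * b k" using mult_right_mono[OF _ b[of k], of "b k" "W / N"] by (simp add: power2_eq_square)
    qed
    also have "\<dots> = (W / N) * sum b F" by (simp add: sum_distrib_left)
    also have "\<dots> \<le> (W / N) * W" using F W0 N by (intro mult_left_mono W) auto
    finally show "(\<Sum>k\<in>F. (b k)\<^sup>2) \<le> W\<^sup>2 / N" by (simp add: power2_eq_square)
  qed
qed

text \<open>
  The frequency \<open>k\<close> of \<open>cis (k \<bullet> x)\<close> corresponds to \<open>\<theta> = k / (2 * pi)\<close>; unused terms get the
  coefficient \<open>0\<close>.
\<close>

lemma lattice_sum_in_exp_sums:
  assumes I: "finite I" "card I \<le> n" and M: "(\<Sum>k\<in>I. cmod (a k)) \<le> M"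
  shows "(\<lambda>x :: real ^ 'd. \<Sum>k\<in>I. a k * cis (lattice_vec k \<bullet> x)) \<in> exp_sums n M"
proof -
  obtain h where h: "bij_betw h {..<card I} I"
    using ex_bij_betw_nat_finite[OF I(1)] by (auto simp: atLeast0LessThan)
  define a' where "a' j = (if j < card I then a (h j) else 0)" for j
  define \<theta> where "\<theta> j = (1 / (2 * pi)) *\<^sub>R (lattice_vec (h j) :: real ^ 'd)" for j
  have cisj: "exp (2 * of_real pi * \<i> * of_real (\<theta> j \<bullet> x)) = cis (lattice_vec (h j) \<bullet> x)" for j x
    by (simp add: \<theta>_def cis_conv_exp)
  have ext: "(\<Sum>j<n. F j) = (\<Sum>j<card I. F j)" if "\<And>j. j \<ge> card I \<Longrightarrow> F j = 0" for F :: "nat \<Rightarrow> 'z::comm_monoid_add"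
    using I(2) that by (intro sum.mono_neutral_right) auto
  have "(\<Sum>j<n. norm (a' j)) = (\<Sum>j<card I. cmod (a (h j)))"
    by (subst ext) (auto simp: a'_def)
  also have "\<dots> = (\<Sum>k\<in>I. cmod (a k))" by (rule sum.reindex_bij_betw[OF h])
  finally have 1: "(\<Sum>j<n. norm (a' j)) \<le> M" using M by simp
  have 2: "(\<Sum>k\<in>I. a k * cis (lattice_vec k \<bullet> x)) = (\<Sum>j<n. a' j * exp (2 * of_real pi * \<i> * of_real (\<theta> j \<bullet> x)))" for x :: "real ^ 'd"
  proof -
    have "(\<Sum>j<n. a' j * exp (2 * of_real pi * \<i> * of_real (\<theta> j \<bullet> x))) = (\<Sum>j<card I. a (h j) * cis (lattice_vec (h j) \<bullet> x))"
      unfolding cisj by (subst ext) (auto simp: a'_def)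
    also have "\<dots> = (\<Sum>k\<in>I. a k * cis (lattice_vec k \<bullet> x))" by (rule sum.reindex_bij_betw[OF h])
    finally show ?thesis by simp
  qed
  show ?thesis unfolding exp_sums_def mem_Collect_eq
    by (rule exI[of _ a'], rule exI[of _ \<theta>]) (use 1 2 in auto)
qed

text \<open>
  With \<open>N = n / 2\<close>, the radius
  \<open>\<rho> = N powr (1 / d) / 2\<close> is chosen so that \<open>(2 * \<rho>) ^ d = N\<close>, which bounds the number of low
  frequencies; the error \<open>W / sqrt N\<close> with \<open>W = \<rho> powr (m - s) * A\<close> is then a multiple of
  \<open>A * N powr (- 1 / 2 - (s - m) / d)\<close>.
\<close>

lemma n_term_approximation:
  fixes m s :: real
  assumes m: "0 \<le> m" and ms: "m \<le> s"
  obtains C where "C > 0" "\<And>(f :: real ^ 'd \<Rightarrow> complex) a A n.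
    lattice_expansion s A f a \<Longrightarrow> n \<ge> 1 \<Longrightarrow>
    \<exists>g\<in>exp_sums n A. sobolev_norm m (box 0 1) (\<lambda>x. f x - g x) \<le> ennreal (C * A * real n powr (- 1 / 2 - (s - m) / real CARD('d)))"
proof -
  obtain C where C: "C > 0" and sob: "\<And>(u :: real ^ 'd \<Rightarrow> complex) A S.
    summable (\<lambda>n. (1 + norm (lattice_vec n :: real ^ 'd)) powr m * cmod (A n)) \<Longrightarrow>
    (AE x in lebesgue. x \<in> box 0 1 \<longrightarrow> u x = lattice_series A x) \<Longrightarrow>
    (\<And>F. finite F \<Longrightarrow> (\<Sum>n\<in>F. ((1 + norm (lattice_vec n :: real ^ 'd)) powr m * cmod (A n))\<^sup>2) \<le> S) \<Longrightarrow>
    sobolev_norm m (box 0 1) u \<le> ennreal (C * sqrt S)"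
    by (rule sobolev_norm_lattice_series[OF m, where 'd = 'd]) blast
  define d where "d = real CARD('d)"
  have d: "d > 0" by (simp add: d_def)
  define C' where "C' = C * (2 powr (s - m) * 2 powr (1 / 2 + (s - m) / d))"
  show ?thesis
  proof (rule that[of C'])
    show "C' > 0" using C by (simp add: C'_def)
    fix f :: "real ^ 'd \<Rightarrow> complex" and a :: "nat \<Rightarrow> complex" and A :: real and n :: nat
    assume fa: "lattice_expansion s A f a" and n: "n \<ge> 1"
    have a: "(\<Sum>n\<in>F. (1 + norm (lattice_vec n :: real ^ 'd)) powr s * cmod (a n)) \<le> A" if "finite F" for F
      using fa that by (simp add: lattice_expansion_def)
    have f: "AE x in lebesgue. x \<in> box 0 1 \<longrightarrow> (\<lambda>n. a n * cis (lattice_vec n \<bullet> x)) sums f x"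
      using fa by (simp add: lattice_expansion_def)
    define \<mu> where "\<mu> k = 1 + norm (lattice_vec k :: real ^ 'd)" for k
    have \<mu>1: "\<mu> k \<ge> 1" for k by (simp add: \<mu>_def)
    have A0: "A \<ge> 0" using a[of "{}"] by simp
    define N where "N = real n / 2"
    have N: "N > 0" using n by (simp add: N_def)
    define \<rho> where "\<rho> = N powr (1 / d) / 2"
    have \<rho>: "\<rho> > 0" using N by (simp add: \<rho>_def)
    define \<Lambda> where "\<Lambda> = {k. \<mu> k \<le> \<rho>}"
    have \<Lambda>: "finite \<Lambda>" "real (card \<Lambda>) \<le> N"
    proof -
      show "finite \<Lambda>" using card_lattice_ball(1)[of \<rho>, where 'd = 'd] \<rho> by (simp add: \<Lambda>_def \<mu>_def)
      have "real (card \<Lambda>) \<le> (2 * \<rho>) ^ CARD('d)"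
        using card_lattice_ball(2)[of \<rho>, where 'd = 'd] \<rho> by (simp add: \<Lambda>_def \<mu>_def)
      also have "\<dots> = (N powr (1 / d)) powr d" using N by (simp add: \<rho>_def d_def powr_realpow)
      also have "\<dots> = N" using N d by (simp add: powr_powr)
      finally show "real (card \<Lambda>) \<le> N" .
    qed
    define b where "b k = \<mu> k powr m * cmod (a k)" for k
    define W where "W = \<rho> powr (m - s) * A"
    have W0: "W \<ge> 0" using A0 by (simp add: W_def)
    have bW: "sum b F \<le> W" if F: "finite F" "F \<inter> \<Lambda> = {}" for F
    proof -
      have "sum b F \<le> (\<Sum>k\<in>F. \<rho> powr (m - s) * (\<mu> k powr s * cmod (a k)))"
      proof (rule sum_mono)
        fix k assume "k \<in> F"
        then have k: "\<rho> < \<mu> k" using F by (auto simp: \<Lambda>_def)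
        have "\<mu> k powr m = \<mu> k powr (m - s) * \<mu> k powr s" by (simp flip: powr_add)
        also have "\<dots> \<le> \<rho> powr (m - s) * \<mu> k powr s"
          using k \<rho> ms by (intro mult_right_mono powr_mono2') auto
        finally have "\<mu> k powr m * cmod (a k) \<le> \<rho> powr (m - s) * \<mu> k powr s * cmod (a k)"
          by (rule mult_right_mono) simp
        then show "b k \<le> \<rho> powr (m - s) * (\<mu> k powr s * cmod (a k))" by (simp add: b_def mult.assoc)
      qed
      also have "\<dots> = \<rho> powr (m - s) * (\<Sum>k\<in>F. \<mu> k powr s * cmod (a k))" by (simp add: sum_distrib_left)
      also have "\<dots> \<le> W" unfolding W_def \<mu>_def by (intro mult_left_mono a F(1)) auto
      finally show ?thesis .
    qed
    obtain T where T: "finite T" "real (card T) \<le> N" "T \<inter> \<Lambda> = {}"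
      and T2: "\<And>F. finite F \<Longrightarrow> F \<inter> (\<Lambda> \<union> T) = {} \<Longrightarrow> (\<Sum>k\<in>F. (b k)\<^sup>2) \<le> W\<^sup>2 / N"
      by (rule stechkin_selection[of b \<Lambda> W N]) (use bW N in \<open>auto simp: b_def\<close>)
    define I where "I = \<Lambda> \<union> T"
    have I: "finite I" using \<Lambda> T by (simp add: I_def)
    have cI: "card I \<le> n"
    proof -
      have "real (card I) \<le> real (card \<Lambda>) + real (card T)" using card_Un_le[of \<Lambda> T] by (simp add: I_def)
      also have "\<dots> \<le> real n" using \<Lambda>(2) T(2) by (simp add: N_def)
      finally show ?thesis by simp
    qed
    define g where "g x = (\<Sum>k\<in>I. a k * cis (lattice_vec k \<bullet> x))" for x :: "real ^ 'd"
    have pow1: "cmod (a k) \<le> \<mu> k powr s * cmod (a k)" for k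
      using mult_right_mono[OF ge_one_powr_ge_zero[OF \<mu>1, of s k], of "cmod (a k)"] m ms by simp
    have "(\<Sum>k\<in>I. cmod (a k)) \<le> A"
      using order_trans[OF sum_mono[OF pow1] a[OF I, folded \<mu>_def]] .
    then have gin: "g \<in> exp_sums n A"
      unfolding g_def using I cI by (intro lattice_sum_in_exp_sums)
    define A' where "A' k = (if k \<in> I then 0 else a k)" for k
    have A'b: "\<mu> k powr m * cmod (A' k) = (if k \<in> I then 0 else b k)" for k by (simp add: A'_def b_def)
    have sA': "summable (\<lambda>k. (1 + norm (lattice_vec k :: real ^ 'd)) powr m * cmod (A' k))"
    proof (rule summable_if_finite_sums_bounded)
      fix F :: "nat set" assume F: "finite F"
      have "(\<Sum>k\<in>F. \<mu> k powr m * cmod (A' k)) = sum b (F - I)"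
        unfolding A'b using F by (intro sum.mono_neutral_cong_right) auto
      also have "\<dots> \<le> W" using F by (intro bW) (auto simp: I_def)
      finally show "(\<Sum>k\<in>F. (1 + norm (lattice_vec k :: real ^ 'd)) powr m * cmod (A' k)) \<le> W" by (simp add: \<mu>_def)
    qed simp
    have u: "AE x in lebesgue. x \<in> box 0 1 \<longrightarrow> f x - g x = lattice_series A' x"
      using f
    proof eventually_elim
      case (elim x)
      show ?case
      proof
        assume "x \<in> box 0 1"
        with elim have "(\<lambda>k. a k * cis (lattice_vec k \<bullet> x)) sums f x" by simp
        moreover have "(\<lambda>k. if k \<in> I then a k * cis (lattice_vec k \<bullet> x) else 0) sums g x"
          unfolding g_def by (rule sums_If_finite_set[OF I])
        ultimately have "(\<lambda>k. a k * cis (lattice_vec k \<bullet> x) - (if k \<in> I then a k * cis (lattice_vec k \<bullet> x) else 0)) sums (f x - g x)"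
          by (rule sums_diff)
        also have "(\<lambda>k. a k * cis (lattice_vec k \<bullet> x) - (if k \<in> I then a k * cis (lattice_vec k \<bullet> x) else 0)) = (\<lambda>k. A' k * cis (lattice_vec k \<bullet> x))"
          by (auto simp: A'_def)
        finally show "f x - g x = lattice_series A' x" by (simp add: lattice_series_def sums_iff)
      qed
    qed
    have "sobolev_norm m (box 0 1) (\<lambda>x. f x - g x) \<le> ennreal (C * sqrt (W\<^sup>2 / N))"
    proof (rule sob[OF sA' u])
      fix F :: "nat set" assume F: "finite F"
      have "(\<Sum>k\<in>F. (\<mu> k powr m * cmod (A' k))\<^sup>2) = (\<Sum>k\<in>F - I. (b k)\<^sup>2)"
        unfolding A'b using F by (intro sum.mono_neutral_cong_right) auto
      also have "\<dots> \<le> W\<^sup>2 / N" using F by (intro T2) (auto simp: I_def)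
      finally show "(\<Sum>k\<in>F. ((1 + norm (lattice_vec k :: real ^ 'd)) powr m * cmod (A' k))\<^sup>2) \<le> W\<^sup>2 / N" by (simp add: \<mu>_def)
    qed
    also have "C * sqrt (W\<^sup>2 / N) = C' * A * real n powr (- 1 / 2 - (s - m) / d)"
    proof -
      have "sqrt (W\<^sup>2 / N) = W * N powr (- 1 / 2)"
      proof -
        have "N powr (- 1 / 2) = inverse (N powr (1 / 2))" using powr_minus[of N "1 / 2"] by simp
        also have "\<dots> = inverse (sqrt N)" using N by (simp only: powr_half_sqrt less_imp_le)
        finally have *: "N powr (- 1 / 2) = inverse (sqrt N)" .
        show ?thesis unfolding * using W0 by (simp add: divide_inverse real_sqrt_mult real_sqrt_inverse)
      qed
      also have "\<dots> = N powr ((m - s) / d) * 2 powr (s - m) * A * N powr (- 1 / 2)"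
      proof -
        have "\<rho> powr (m - s) = N powr ((m - s) / d) / 2 powr (m - s)"
          using N by (simp add: \<rho>_def powr_divide powr_powr)
        also have "\<dots> = N powr ((m - s) / d) * 2 powr (s - m)"
          using powr_minus[of 2 "m - s"] by (simp only: divide_inverse minus_diff_eq)
        finally show ?thesis by (simp add: W_def)
      qed
      also have "\<dots> = 2 powr (s - m) * A * N powr (- 1 / 2 - (s - m) / d)"
      proof -
        have "(m - s) / d + - 1 / 2 = - 1 / 2 - (s - m) / d" by (simp add: diff_divide_distrib)
        then have *: "N powr (- 1 / 2 - (s - m) / d) = N powr ((m - s) / d) * N powr (- 1 / 2)"
          by (simp only: powr_add[symmetric])
        show ?thesis unfolding * by (simp only: mult_ac)
      qed
      also have "N powr (- 1 / 2 - (s - m) / d) = real n powr (- 1 / 2 - (s - m) / d) * 2 powr (1 / 2 + (s - m) / d)"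
      proof -
        define q where "q = 1 / 2 + (s - m) / d"
        have e: "- 1 / 2 - (s - m) / d = - q" by (simp add: q_def)
        have "N powr (- q) = real n powr (- q) / 2 powr (- q)" by (simp only: N_def powr_divide of_nat_0_le_iff zero_le_numeral)
        also have "\<dots> = real n powr (- q) * 2 powr q" by (simp only: powr_minus divide_inverse inverse_inverse_eq)
        finally show ?thesis unfolding e q_def[symmetric] .
      qed
      finally show ?thesis by (simp add: C'_def mult_ac)
    qed
    finally show "\<exists>g\<in>exp_sums n A. sobolev_norm m (box 0 1) (\<lambda>x. f x - g x) \<le> ennreal (C' * A * real n powr (- 1 / 2 - (s - m) / real CARD('d)))"
      using gin unfolding d_def by blast
  qed
qed

theorem theorem1:
  fixes m s :: real
  assumes "0 \<le> m" and "m \<le> s"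
  shows "\<exists>C>0. \<forall>f \<in> barron_space s (unit_cube :: (real ^ 'd) set).
           \<exists>M\<ge>0. ennreal M \<le> ennreal C * barron_norm s unit_cube f \<and>
             (\<forall>n\<ge>1. (INF g\<in>exp_sums n M. sobolev_norm m (interior unit_cube) (\<lambda>x. f x - g x))
                \<le> ennreal C * barron_norm s unit_cube f *
                   ennreal (real n powr (- 1 / 2 - (s - m) / real CARD('d))))"
proof -
  obtain C1 where C1: "C1 > 0" and coeff: "\<And>f :: real ^ 'd \<Rightarrow> complex. f \<in> barron_space s unit_cube \<Longrightarrow>
    \<exists>a. lattice_expansion s (C1 * enn2real (barron_norm s unit_cube f)) f a"
    by (rule barron_lattice_coefficients[OF order_trans[OF assms], where 'd = 'd]) blast
  obtain C2 where C2: "C2 > 0" and approx: "\<And>(f :: real ^ 'd \<Rightarrow> complex) a A n.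
    lattice_expansion s A f a \<Longrightarrow> n \<ge> 1 \<Longrightarrow>
    \<exists>g\<in>exp_sums n A. sobolev_norm m (box 0 1) (\<lambda>x. f x - g x) \<le> ennreal (C2 * A * real n powr (- 1 / 2 - (s - m) / real CARD('d)))"
    by (rule n_term_approximation[OF assms, where 'd = 'd]) blast
  \<comment> \<open>The coefficients contribute the factor \<open>C1\<close> to \<open>M\<close>, and \<open>C2 * C1\<close> to the error.\<close>
  define C where "C = C1 * (1 + C2)"
  have C: "C > 0" "C1 \<le> C" "C2 * C1 \<le> C"
    using C1 C2 by (auto simp: C_def distrib_left add_pos_pos mult.commute)
  have int: "interior (unit_cube :: (real ^ 'd) set) = box 0 1" by (simp add: unit_cube_def)
  show ?thesis unfolding int
  proof (rule exI[of _ C], intro conjI ballI)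
    show "C > 0" by (rule C(1))
    fix f :: "real ^ 'd \<Rightarrow> complex" assume f: "f \<in> barron_space s unit_cube"
    define \<beta> where "\<beta> = enn2real (barron_norm s unit_cube f)"
    have \<beta>: "barron_norm s unit_cube f = ennreal \<beta>" "\<beta> \<ge> 0" using f by (auto simp: \<beta>_def barron_space_def)
    obtain a where a: "lattice_expansion s (C1 * \<beta>) f a"
      using coeff[OF f] unfolding \<beta>_def by blast
    show "\<exists>M\<ge>0. ennreal M \<le> ennreal C * barron_norm s unit_cube f \<and>
             (\<forall>n\<ge>1. (INF g\<in>exp_sums n M. sobolev_norm m (box 0 1) (\<lambda>x. f x - g x))
                \<le> ennreal C * barron_norm s unit_cube f *
                   ennreal (real n powr (- 1 / 2 - (s - m) / real CARD('d))))"
    proof (intro exI[of _ "C1 * \<beta>"] conjI allI impI)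
      show "0 \<le> C1 * \<beta>" using C1 \<beta>(2) by simp
      show "ennreal (C1 * \<beta>) \<le> ennreal C * barron_norm s unit_cube f"
        using C \<beta> by (simp add: ennreal_mult[symmetric] ennreal_leI mult_right_mono)
      fix n :: nat assume n: "1 \<le> n"
      obtain g where g: "g \<in> exp_sums n (C1 * \<beta>)"
        "sobolev_norm m (box 0 1) (\<lambda>x. f x - g x) \<le> ennreal (C2 * (C1 * \<beta>) * real n powr (- 1 / 2 - (s - m) / real CARD('d)))"
        using approx[OF a n] by blast
      have "(INF g\<in>exp_sums n (C1 * \<beta>). sobolev_norm m (box 0 1) (\<lambda>x. f x - g x)) \<le> ennreal (C2 * (C1 * \<beta>) * real n powr (- 1 / 2 - (s - m) / real CARD('d)))"
        by (rule INF_lower2[of g]) (use g in auto)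
      also have "\<dots> \<le> ennreal (C * \<beta> * real n powr (- 1 / 2 - (s - m) / real CARD('d)))"
        using mult_right_mono[OF C(3) \<beta>(2)] by (intro ennreal_leI mult_right_mono) (auto simp: mult.assoc)
      also have "\<dots> = ennreal C * barron_norm s unit_cube f * ennreal (real n powr (- 1 / 2 - (s - m) / real CARD('d)))"
        using C(1) \<beta> by (simp add: ennreal_mult)
      finally show "(INF g\<in>exp_sums n (C1 * \<beta>). sobolev_norm m (box 0 1) (\<lambda>x. f x - g x))
        \<le> ennreal C * barron_norm s unit_cube f * ennreal (real n powr (- 1 / 2 - (s - m) / real CARD('d)))" .
    qed
  qed
qed

end
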